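(* Assume the decay condition and the growth condition (both stated in the context) hold. Let $(s_0,\theta_0)\in\operatorname{int}\mathcal S$ and $y_0=K_0'(s_0;\theta_0)$, and suppose that $\nabla_\theta K_0(s_0;\theta_0)=0$ and that $$H=\nabla_\theta^T\nabla_\theta K_0(s_0;\theta_0)-(\nabla_s\nabla_\theta K_0(s_0;\theta_0))^TK_0''(s_0;\theta_0)^{-1}(\nabla_s\nabla_\theta K_0(s_0;\theta_0))$$ is negative definite. Suppose also that the prior distribution $\pi_\Theta$ on $\mathcal R$ has a probability density function that is continuous and positive at $\theta_0$. Fix $y=y_0$, $x=ny_0$. Then there exists a neighbourhood $U\subset\mathcal R$ of $\theta_0$ such that, when $\Theta$ is distributed according to $\pi_{\Theta\mid U,x}$, and also when $\Theta$ is distributed according to $\hat\pi_{\Theta\mid U,x}$, $$\sqrt n\,(\Theta-\theta_0)\overset{d}{\longrightarrow}\mathcal N(0,-H^{-1})\qquad\text{as }n\to\infty.$$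
   Context: Setting. $d,p$ are positive integers and $\mathcal R\subset\mathbb R^{p\times1}$ is open. For each $\theta\in\mathcal R$, $Y_\theta$ is a random column vector in $\mathbb R^{d\times1}$ whose distribution does not depend on $n$, and for $n\in\mathbb N$, $X_\theta=\sum_{i=1}^nY^{(i)}$ where $Y^{(1)},Y^{(2)},\dots$ are i.i.d. copies of $Y_\theta$ (the dependence of $X_\theta$ on $n$ is suppressed). Let $\mathcal S_\theta=\{s\in\mathbb R^{1\times d}:\mathbb E(e^{sY_\theta})<\infty\}$, $\mathcal S=\{(s,\theta):\theta\in\mathcal R,\ s\in\mathcal S_\theta\}$, and let $\operatorname{int}\mathcal S$ be its interior in $\mathbb R^{1\times d}\times\mathbb R^{p\times 1}$. For complex row vectors $z$ with $\operatorname{Re}z\in\mathcal S_\theta$ put $M_0(z;\theta)=\mathbb E(e^{zY_\theta})$, and $K_0(s;\theta)=\log M_0(s;\theta)$ for real $s$. $K_0'=\nabla_sK_0$ is the $d\times1$ gradient and $K_0''$ the $d\times d$ Hessian with respect to $s$; $\nabla_\theta$ of a scalar is a $1\times p$ row vector, $\nabla_\theta^T\nabla_\theta K_0$ is the $p\times p$ Hessian in $\theta$, and $\nabla_s\nabla_\theta K_0$ is the $d\times p$ matrix with $i,j$ entry $\partial^2K_0/\partial s_i\partial\theta_j$. Throughout, $x\in\mathbb R^{d\times 1}$ and $y\in\mathbb R^{d\times 1}$ are related by $x=ny$. Decay condition: there is a continuous function $\delta:\operatorname{int}\mathcal S\to(0,\infty)$ such that $\left|\frac{M_0(s+\mathrm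 i\phi;\theta)}{M_0(s;\theta)}\right|\le(1+\delta(s,\theta)|\phi|^2)^{-\delta(s,\theta)}$ for all $\phi\in\mathbb R^{1\times d}$ and $(s,\theta)\in\operatorname{int}\mathcal S$. (This implies that $K_0''(s;\theta)$ is positive definite.) Growth condition: there is a continuous function $\gamma:\operatorname{int}\mathcal S\to(0,\infty)$ such that $\left|\frac{\partial^{k+\ell}M_0}{\partial\theta_{i_1}\cdots\partial\theta_{i_k}\partial s_{j_1}\cdots\partial s_{j_\ell}}(s+\mathrm i\phi;\theta)\right|\le\gamma(s,\theta)(1+|\phi|)^{\gamma(s,\theta)}$ for all $\phi\in\mathbb R^{1\times d}$ and $(s,\theta)\in\operatorname{int}\mathcal S$, for $k\in\{0,1\}$ with $1\le k+\ell\le6$ and for $k=2$ with $0\le\ell\le2$; and each of these partial derivatives exists and is continuous in all its variables. Saddlepoint. $\mathcal Y^o$ is the set of $(y,\theta)$ for which there is $s$ with $(s,\theta)\in\operatorname{int}\mathcal S$ and $K_0'(s;\theta)=y$; this $s$ is unique (strict convexity of $K_0$ in $s$) and is denoted $\hat s_0(\theta,y)$. Likelihoods. $L(\theta;x)$ is the value at $x$ of the continuous density of $X_\theta$ (which exists for $n$ large). For $(y,\theta)\in\mathcal Y^o$, the saddlepoint likelihood is, with $\hat s=\hat s_0(\theta,y)$, $$\hat L(\theta;x)=\frac{\exp\left(n[K_0(\hat s;\theta)-\hat sy]\right)}{\sqrt{\det(2\pi nK_0''(\hat s;\theta))}}.$$ Posteriors. For a prior $\pi_\Theta$ on $\mathcal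 R$ and $U\subset\mathcal R$ with $\pi_\Theta(U)>0$, the posterior $\pi_{\Theta\mid U,x}$ and saddlepoint posterior $\hat\pi_{\Theta\mid U,x}$ on $U$ are the probability measures defined by $$\frac{d\pi_{\Theta\mid U,x}}{d\pi_\Theta}(\theta)=\frac{L(\theta;x)\mathbf 1_{\{\theta\in U\}}}{\int_UL(\theta';x)\,d\pi_\Theta(\theta')},\qquad\frac{d\hat\pi_{\Theta\mid U,x}}{d\pi_\Theta}(\theta)=\frac{\hat L(\theta;x)\mathbf 1_{\{\theta\in U\}}}{\int_U\hat L(\theta';x)\,d\pi_\Theta(\theta')}.$$ *)

theory Defs
  imports "HOL-Probability.Probability"
begin

definition dir_deriv :: "'a::real_normed_vector \<Rightarrow> ('a \<Rightarrow> 'b::real_normed_vector) \<Rightarrow> 'a \<Rightarrow> 'b" where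
  "dir_deriv v f x = vector_derivative (\<lambda>t::real. f (x + t *\<^sub>R v)) (at 0)"

text \<open>
  With coordinate directions \<open>e\<^sub>1, \<dots>, e\<^sub>m\<close>, \<open>iter_deriv [e\<^sub>1, \<dots>, e\<^sub>m] f\<close> is the partial
  derivative written with the denominators in the order \<open>e\<^sub>1 \<dots> e\<^sub>m\<close>: the last direction is
  differentiated first.
\<close>

fun iter_deriv :: "'a::real_normed_vector list \<Rightarrow> ('a \<Rightarrow> 'b::real_normed_vector) \<Rightarrow> 'a \<Rightarrow> 'b" where
  "iter_deriv [] f = f"
| "iter_deriv (v # vs) f = dir_deriv v (iter_deriv vs f)"

fun iter_deriv_exists_on ::
  "'a::real_normed_vector set \<Rightarrow> 'a list \<Rightarrow> ('a \<Rightarrow> 'b::real_normed_vector) \<Rightarrow> bool" where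
  "iter_deriv_exists_on A [] f \<longleftrightarrow> True"
| "iter_deriv_exists_on A (v # vs) f \<longleftrightarrow>
     iter_deriv_exists_on A vs f \<and>
     (\<forall>x\<in>A. (\<lambda>t::real. iter_deriv vs f (x + t *\<^sub>R v)) differentiable (at 0))"

definition s_dir :: "'d::finite \<Rightarrow> (real^'d) \<times> (real^'p::finite)" where
  "s_dir j = (axis j 1, 0)"

definition th_dir :: "'p::finite \<Rightarrow> (real^'d::finite) \<times> (real^'p)" where
  "th_dir i = (0, axis i 1)"

text \<open>
  Row vectors \<open>s\<close> and column vectors \<open>y\<close> both have type \<open>real^'d\<close>, parameters have type
  \<open>real^'p\<close>; the matrix product \<open>s y\<close> is the inner product. Each \<open>\<theta>\<close> has its own probability
  space \<open>P \<theta>\<close>, carrying \<open>Y \<theta>\<close> and the i.i.d. copies \<open>Ys \<theta> 0, Ys \<theta> 1, \<dots>\<close>.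
\<close>

definition iid_copies_model ::
  "(real^'p::finite) set \<Rightarrow> (real^'p \<Rightarrow> 'w measure) \<Rightarrow> (real^'p \<Rightarrow> 'w \<Rightarrow> real^'d::finite)
    \<Rightarrow> (real^'p \<Rightarrow> nat \<Rightarrow> 'w \<Rightarrow> real^'d) \<Rightarrow> bool" where
  "iid_copies_model R P Y Ys \<longleftrightarrow>
     open R \<and>
     (\<forall>\<theta>\<in>R. prob_space (P \<theta>) \<and>
        Y \<theta> \<in> borel_measurable (P \<theta>) \<and>
        prob_space.indep_vars (P \<theta>) (\<lambda>_. borel) (Ys \<theta>) UNIV \<and>
        (\<forall>i. distr (P \<theta>) borel (Ys \<theta> i) = distr (P \<theta>) borel (Y \<theta>)))"

definition sum_copies ::
  "(real^'p::finite \<Rightarrow> nat \<Rightarrow> 'w \<Rightarrow> real^'d::finite) \<Rightarrow> nat \<Rightarrow> real^'p \<Rightarrow> 'w \<Rightarrow> real^'d" where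
  "sum_copies Ys n \<theta> \<omega> = (\<Sum>i<n. Ys \<theta> i \<omega>)"

definition S_at ::
  "(real^'p::finite \<Rightarrow> 'w measure) \<Rightarrow> (real^'p \<Rightarrow> 'w \<Rightarrow> real^'d::finite) \<Rightarrow> real^'p \<Rightarrow> (real^'d) set"
  where
  "S_at P Y \<theta> = {s. integrable (P \<theta>) (\<lambda>\<omega>. exp (s \<bullet> Y \<theta> \<omega>))}"

definition S_set ::
  "(real^'p::finite) set \<Rightarrow> (real^'p \<Rightarrow> 'w measure) \<Rightarrow> (real^'p \<Rightarrow> 'w \<Rightarrow> real^'d::finite)
    \<Rightarrow> ((real^'d) \<times> (real^'p)) set" where
  "S_set R P Y = {(s, \<theta>). \<theta> \<in> R \<and> s \<in> S_at P Y \<theta>}"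

definition cvec :: "real^'d::finite \<Rightarrow> real^'d \<Rightarrow> complex^'d" where
  "cvec s \<phi> = (\<chi> j. Complex (s $ j) (\<phi> $ j))"

definition M0 ::
  "(real^'p::finite \<Rightarrow> 'w measure) \<Rightarrow> (real^'p \<Rightarrow> 'w \<Rightarrow> real^'d::finite)
    \<Rightarrow> complex^'d \<Rightarrow> real^'p \<Rightarrow> complex" where
  "M0 P Y z \<theta> = (LINT \<omega>|P \<theta>. exp (\<Sum>j\<in>UNIV. z $ j * complex_of_real (Y \<theta> \<omega> $ j)))"

definition K0 ::
  "(real^'p::finite \<Rightarrow> 'w measure) \<Rightarrow> (real^'p \<Rightarrow> 'w \<Rightarrow> real^'d::finite)
    \<Rightarrow> real^'d \<Rightarrow> real^'p \<Rightarrow> real" where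
  "K0 P Y s \<theta> = ln (Re (M0 P Y (cvec s 0) \<theta>))"

definition grad_s_K0 ::
  "(real^'p::finite \<Rightarrow> 'w measure) \<Rightarrow> (real^'p \<Rightarrow> 'w \<Rightarrow> real^'d::finite)
    \<Rightarrow> real^'d \<Rightarrow> real^'p \<Rightarrow> real^'d" where
  "grad_s_K0 P Y s \<theta> = (\<chi> j. iter_deriv [s_dir j] (\<lambda>(s, \<theta>). K0 P Y s \<theta>) (s, \<theta>))"

definition hess_s_K0 ::
  "(real^'p::finite \<Rightarrow> 'w measure) \<Rightarrow> (real^'p \<Rightarrow> 'w \<Rightarrow> real^'d::finite)
    \<Rightarrow> real^'d \<Rightarrow> real^'p \<Rightarrow> real^'d^'d" where
  "hess_s_K0 P Y s \<theta> = (\<chi> i j. iter_deriv [s_dir i, s_dir j] (\<lambda>(s, \<theta>). K0 P Y s \<theta>) (s, \<theta>))"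

definition grad_th_K0 ::
  "(real^'p::finite \<Rightarrow> 'w measure) \<Rightarrow> (real^'p \<Rightarrow> 'w \<Rightarrow> real^'d::finite)
    \<Rightarrow> real^'d \<Rightarrow> real^'p \<Rightarrow> real^'p" where
  "grad_th_K0 P Y s \<theta> = (\<chi> i. iter_deriv [th_dir i] (\<lambda>(s, \<theta>). K0 P Y s \<theta>) (s, \<theta>))"

definition hess_th_K0 ::
  "(real^'p::finite \<Rightarrow> 'w measure) \<Rightarrow> (real^'p \<Rightarrow> 'w \<Rightarrow> real^'d::finite)
    \<Rightarrow> real^'d \<Rightarrow> real^'p \<Rightarrow> real^'p^'p" where
  "hess_th_K0 P Y s \<theta> = (\<chi> i j. iter_deriv [th_dir i, th_dir j] (\<lambda>(s, \<theta>). K0 P Y s \<theta>) (s, \<theta>))"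

text \<open>\<open>real^'p^'d\<close> is the type of matrices with rows indexed by \<open>'d\<close> and columns by \<open>'p\<close>.\<close>

definition mixed_K0 ::
  "(real^'p::finite \<Rightarrow> 'w measure) \<Rightarrow> (real^'p \<Rightarrow> 'w \<Rightarrow> real^'d::finite)
    \<Rightarrow> real^'d \<Rightarrow> real^'p \<Rightarrow> real^'p^'d" where
  "mixed_K0 P Y s \<theta> = (\<chi> i j. iter_deriv [s_dir i, th_dir j] (\<lambda>(s, \<theta>). K0 P Y s \<theta>) (s, \<theta>))"

definition H_matrix ::
  "(real^'p::finite \<Rightarrow> 'w measure) \<Rightarrow> (real^'p \<Rightarrow> 'w \<Rightarrow> real^'d::finite)
    \<Rightarrow> real^'d \<Rightarrow> real^'p \<Rightarrow> real^'p^'p" where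
  "H_matrix P Y s \<theta> = hess_th_K0 P Y s \<theta>
     - transpose (mixed_K0 P Y s \<theta>) ** matrix_inv (hess_s_K0 P Y s \<theta>) ** mixed_K0 P Y s \<theta>"

definition negative_definite :: "real^'n^'n::finite \<Rightarrow> bool" where
  "negative_definite A \<longleftrightarrow> (\<forall>v. v \<noteq> 0 \<longrightarrow> v \<bullet> (A *v v) < 0)"

definition decay_condition ::
  "(real^'p::finite) set \<Rightarrow> (real^'p \<Rightarrow> 'w measure) \<Rightarrow> (real^'p \<Rightarrow> 'w \<Rightarrow> real^'d::finite) \<Rightarrow> bool"
  where
  "decay_condition R P Y \<longleftrightarrow>
     (\<exists>\<delta>. continuous_on (interior (S_set R P Y)) \<delta> \<and>
        (\<forall>(s, \<theta>) \<in> interior (S_set R P Y). 0 < \<delta> (s, \<theta>) \<and>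
           (\<forall>\<phi>. norm (M0 P Y (cvec s \<phi>) \<theta> / M0 P Y (cvec s 0) \<theta>)
                  \<le> (1 + \<delta> (s, \<theta>) * (norm \<phi>)\<^sup>2) powr (- \<delta> (s, \<theta>)))))"

text \<open>
  Derivatives of \<open>M\<^sub>0(s + \<i>\<phi>; \<theta>)\<close> are taken in the real variables \<open>s\<close> and \<open>\<theta>\<close> with \<open>\<phi>\<close> held
  fixed; since \<open>M\<^sub>0\<close> is analytic in \<open>z = s + \<i>\<phi>\<close>, the \<open>s\<close>-derivatives are the complex ones.
\<close>

definition growth_condition ::
  "(real^'p::finite) set \<Rightarrow> (real^'p \<Rightarrow> 'w measure) \<Rightarrow> (real^'p \<Rightarrow> 'w \<Rightarrow> real^'d::finite) \<Rightarrow> bool"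
  where
  "growth_condition R P Y \<longleftrightarrow>
     (\<exists>\<gamma>. continuous_on (interior (S_set R P Y)) \<gamma> \<and>
        (\<forall>x \<in> interior (S_set R P Y). 0 < \<gamma> x) \<and>
        (\<forall>(is :: 'p list) (js :: 'd list).
           (length is \<le> 1 \<and> 1 \<le> length is + length js \<and> length is + length js \<le> 6)
             \<or> (length is = 2 \<and> length js \<le> 2) \<longrightarrow>
           (let vs = map th_dir is @ map s_dir js;
                D = (\<lambda>\<phi>. iter_deriv vs (\<lambda>(s, \<theta>). M0 P Y (cvec s \<phi>) \<theta>))
            in (\<forall>\<phi>. iter_deriv_exists_on (interior (S_set R P Y)) vs
                       (\<lambda>(s, \<theta>). M0 P Y (cvec s \<phi>) \<theta>)) \<and>
               continuous_on (UNIV \<times> interior (S_set R P Y)) (\<lambda>(\<phi>, x). D \<phi> x) \<and>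
               (\<forall>\<phi>. \<forall>x \<in> interior (S_set R P Y).
                  norm (D \<phi> x) \<le> \<gamma> x * (1 + norm \<phi>) powr \<gamma> x))))"

definition continuous_density ::
  "'w measure \<Rightarrow> ('w \<Rightarrow> real^'d::finite) \<Rightarrow> (real^'d \<Rightarrow> real) \<Rightarrow> bool" where
  "continuous_density M X f \<longleftrightarrow>
     continuous_on UNIV f \<and> (\<forall>x. 0 \<le> f x) \<and> distributed M lborel X (\<lambda>x. ennreal (f x))"

text \<open>A continuous density is unique if it exists; otherwise the likelihood is unspecified.\<close>

definition likelihood ::
  "(real^'p::finite \<Rightarrow> 'w measure) \<Rightarrow> (real^'p \<Rightarrow> nat \<Rightarrow> 'w \<Rightarrow> real^'d::finite)
    \<Rightarrow> nat \<Rightarrow> real^'d \<Rightarrow> real^'p \<Rightarrow> real" where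
  "likelihood P Ys n x \<theta> = (THE f. continuous_density (P \<theta>) (sum_copies Ys n \<theta>) f) x"

definition saddle_domain ::
  "(real^'p::finite) set \<Rightarrow> (real^'p \<Rightarrow> 'w measure) \<Rightarrow> (real^'p \<Rightarrow> 'w \<Rightarrow> real^'d::finite)
    \<Rightarrow> ((real^'d) \<times> (real^'p)) set" where
  "saddle_domain R P Y =
     {(y, \<theta>). \<exists>s. (s, \<theta>) \<in> interior (S_set R P Y) \<and> grad_s_K0 P Y s \<theta> = y}"

definition saddlepoint ::
  "(real^'p::finite) set \<Rightarrow> (real^'p \<Rightarrow> 'w measure) \<Rightarrow> (real^'p \<Rightarrow> 'w \<Rightarrow> real^'d::finite)
    \<Rightarrow> real^'p \<Rightarrow> real^'d \<Rightarrow> real^'d" where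
  "saddlepoint R P Y \<theta> y =
     (THE s. (s, \<theta>) \<in> interior (S_set R P Y) \<and> grad_s_K0 P Y s \<theta> = y)"

definition saddlepoint_likelihood ::
  "(real^'p::finite) set \<Rightarrow> (real^'p \<Rightarrow> 'w measure) \<Rightarrow> (real^'p \<Rightarrow> 'w \<Rightarrow> real^'d::finite)
    \<Rightarrow> nat \<Rightarrow> real^'d \<Rightarrow> real^'p \<Rightarrow> real" where
  "saddlepoint_likelihood R P Y n x \<theta> =
     (let y = x /\<^sub>R real n; s = saddlepoint R P Y \<theta> y
      in exp (real n * (K0 P Y s \<theta> - s \<bullet> y))
           / sqrt (det ((2 * pi * real n) *\<^sub>R hess_s_K0 P Y s \<theta>)))"

definition posterior ::
  "'t measure \<Rightarrow> 't set \<Rightarrow> ('t \<Rightarrow> real) \<Rightarrow> 't measure" where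
  "posterior prior U L =
     density prior (\<lambda>\<theta>. ennreal (L \<theta> * indicator U \<theta> / (LINT \<theta>':U|prior. L \<theta>')))"

definition weakly_converges ::
  "(nat \<Rightarrow> 'a::topological_space measure) \<Rightarrow> 'a measure \<Rightarrow> bool" where
  "weakly_converges M N \<longleftrightarrow>
     (\<forall>f::'a \<Rightarrow> real. continuous_on UNIV f \<longrightarrow> bounded (range f) \<longrightarrow>
        (\<lambda>n. LINT x|M n. f x) \<longlonglongrightarrow> (LINT x|N. f x))"

text \<open>Meaningful only for a positive definite covariance matrix \<open>C\<close>.\<close>

definition multivariate_normal :: "real^'n \<Rightarrow> real^'n^'n \<Rightarrow> (real^'n::finite) measure" where
  "multivariate_normal m C = density lborel
     (\<lambda>z. ennreal (exp (- ((z - m) \<bullet> (matrix_inv C *v (z - m))) / 2) / sqrt (det ((2 * pi) *\<^sub>R C))))"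

end

theory Submission
  imports Defs
begin

text \<open>
  Write \<open>F (s, \<theta>) = K\<^sub>0 (s; \<theta>) - s y\<^sub>0\<close> and let \<open>h \<theta> = F (\<sigma> \<theta>, \<theta>)\<close> be its value at the
  saddlepoint \<open>\<sigma> \<theta>\<close>. At \<open>x = n y\<^sub>0\<close> both likelihoods have the form
  \<open>c\<^sub>n exp (n (h \<theta> - h \<theta>\<^sub>0)) g\<^sub>n \<theta>\<close> with \<open>c\<^sub>n\<close> free of \<open>\<theta>\<close>, and \<open>c\<^sub>n\<close> cancels in the
  posterior. Hence one Laplace argument (\<open>laplace_posterior\<close>) serves for both: if
  \<open>h (\<theta>\<^sub>0 + w) - h \<theta>\<^sub>0 = w H w / 2 + o(|w|\<^sup>2)\<close> and \<open>g\<^sub>n\<close> is bounded near \<open>\<theta>\<^sub>0\<close> with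
  \<open>g\<^sub>n (\<theta>\<^sub>0 + u / \<surd>n)\<close> tending to a positive constant, then the substitution
  \<open>\<theta> = \<theta>\<^sub>0 + u / \<surd>n\<close> and dominated convergence turn every posterior expectation into a
  quotient of two integrals against \<open>exp (u H u / 2)\<close>.

  The expansion of \<open>h\<close> comes from comparing values of \<open>F\<close> rather than from differentiating the
  saddlepoint. The law tilted by \<open>exp (s y)\<close> has mean \<open>K\<^sub>0'\<close> and covariance \<open>K\<^sub>0''\<close>, and \<open>exp W > 1 + W\<close> for \<open>W \<noteq> 0\<close> shows that the
  saddlepoint is the strict minimiser of \<open>F\<close> in \<open>s\<close> (\<open>K_strict_minimum\<close>). So \<open>h\<close> is a
  partial minimum of \<open>F\<close>: evaluating \<open>F\<close> at the minimiser of its quadratic Taylor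
  polynomial bounds \<open>h\<close> from above, and completing the square bounds it from below by the same
  Schur complement, which is \<open>H\<close> (\<open>partial_minimum_expansion\<close>). The saddlepoint exists and is
  continuous near \<open>\<theta>\<^sub>0\<close> because \<open>F\<close> exceeds its central value on a small sphere around
  \<open>s\<^sub>0\<close> (\<open>saddlepoint_exists_near\<close>).

  For the saddlepoint likelihood \<open>g\<^sub>n\<close> is \<open>(det K\<^sub>0'')\<close> to the power \<open>-1/2\<close> along the
  saddlepoint, a continuous function that does not depend on \<open>n\<close>. For the likelihood itself,
  tilting makes \<open>n y\<^sub>0\<close> the mean of the sum, and Fourier inversion (\<open>fourier_inversion\<close>) gives
  \<open>g\<^sub>n \<theta>\<close> as the integral over \<open>v\<close> of the \<open>n\<close>-th power of the centred tilted characteristic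
  function at \<open>v / \<surd>n\<close> (\<open>likelihood_at_multiple\<close>). The decay condition dominates these powers by
  one integrable function (\<open>decay_power_le_majorant\<close>), and a central limit estimate whose error
  is controlled by third moments gives the pointwise limit \<open>exp (- v K\<^sub>0'' v / 2)\<close>
  (\<open>centred_char_power_limit\<close>).
\<close>

section \<open>Second-order calculus from coordinate derivatives\<close>

lemma has_real_derivative_along_line:
  fixes f :: "'a::real_normed_vector \<Rightarrow> real"
  assumes "((\<lambda>t. f ((x + t0 *\<^sub>R v) + t *\<^sub>R v)) has_real_derivative D) (at 0)"
  shows "((\<lambda>t. f (x + t *\<^sub>R v)) has_real_derivative D) (at t0)"
proof -
  have "((\<lambda>t. (\<lambda>s. f (x + s *\<^sub>R v)) (t + t0)) has_real_derivative D) (at 0)"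
    using assms by (simp add: algebra_simps)
  then show ?thesis
    using DERIV_shift[of "\<lambda>s. f (x + s *\<^sub>R v)" D 0 t0] by simp
qed

text \<open>
  The mean value inequality for \<open>f\<close> minus a linear function; both of the next two lemmas move
  along one direction at a time and pay this price for each move.
\<close>

lemma linearization_bound_on_segment:
  fixes f :: "'a::real_normed_vector \<Rightarrow> real"
  assumes D: "\<And>t. \<bar>t\<bar> \<le> \<bar>c\<bar> \<Longrightarrow> ((\<lambda>u. f ((x + t *\<^sub>R v) + u *\<^sub>R v)) has_real_derivative D (x + t *\<^sub>R v)) (at 0)"
    and bound: "\<And>t. \<bar>t\<bar> \<le> \<bar>c\<bar> \<Longrightarrow> \<bar>D (x + t *\<^sub>R v) - L\<bar> \<le> e"
  shows "\<bar>f (x + c *\<^sub>R v) - f x - c * L\<bar> \<le> e * \<bar>c\<bar>"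
proof -
  let ?g = "\<lambda>t. f (x + t *\<^sub>R v) - t * L"
  have le: "\<bar>t\<bar> \<le> \<bar>c\<bar>" if "t \<in> closed_segment 0 c" for t
    using that by (auto simp: closed_segment_eq_real_ivl split: if_splits)
  have "norm (?g c - ?g 0) \<le> e * norm (c - 0)"
  proof (rule field_differentiable_bound[of "closed_segment 0 c"])
    fix t assume "t \<in> closed_segment 0 c"
    then have t: "\<bar>t\<bar> \<le> \<bar>c\<bar>" by (rule le)
    have "(?g has_field_derivative D (x + t *\<^sub>R v) - 1 * L) (at t)"
      by (rule DERIV_diff[OF has_real_derivative_along_line[OF D[OF t]] DERIV_cmult_right[OF DERIV_ident]])
    then show "(?g has_field_derivative D (x + t *\<^sub>R v) - L) (at t within closed_segment 0 c)"
      by (simp add: has_field_derivative_at_within)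
    show "norm (D (x + t *\<^sub>R v) - L) \<le> e" using bound[OF t] by simp
  qed auto
  then show ?thesis by (simp add: algebra_simps)
qed

text \<open>
  The induction is over the set of coordinate directions along which the increment may move; a new
  direction contributes its own mean value error, proportional to the corresponding coordinate.
\<close>

lemma has_derivative_of_continuous_partials:
  fixes f :: "'a::euclidean_space \<Rightarrow> real"
  assumes A: "open A" "x \<in> A"
    and D: "\<And>b y. b \<in> Basis \<Longrightarrow> y \<in> A \<Longrightarrow>
              ((\<lambda>t. f (y + t *\<^sub>R b)) has_real_derivative D b y) (at 0)"
    and cont: "\<And>b. b \<in> Basis \<Longrightarrow> isCont (D b) x"
  shows "(f has_derivative (\<lambda>h. \<Sum>b\<in>Basis. (h \<bullet> b) * D b x)) (at x)"
proof -
  have claim: "\<exists>r>0. \<forall>h. norm h < r \<and> (\<forall>b\<in>Basis - B. h \<bullet> b = 0) \<longrightarrow>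
      \<bar>f (x + h) - f x - (\<Sum>b\<in>B. (h \<bullet> b) * D b x)\<bar> \<le> e * (\<Sum>b\<in>B. \<bar>h \<bullet> b\<bar>)"
    if "0 < e" "B \<subseteq> Basis" for e B
  proof -
    have "finite B" using that(2) finite_Basis finite_subset by blast
    then show ?thesis using that(2)
    proof (induction B rule: finite_induct)
      case empty
      then show ?case by (intro exI[of _ 1]) (auto simp: euclidean_all_zero_iff)
    next
      case (insert b B)
      then obtain r where r: "0 < r" and IH: "\<And>h. norm h < r \<Longrightarrow> (\<forall>b\<in>Basis - B. h \<bullet> b = 0) \<Longrightarrow>
        \<bar>f (x + h) - f x - (\<Sum>b\<in>B. (h \<bullet> b) * D b x)\<bar> \<le> e * (\<Sum>b\<in>B. \<bar>h \<bullet> b\<bar>)" by auto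
      have b: "b \<in> Basis" using insert by auto
      obtain r1 where r1: "0 < r1" "ball x r1 \<subseteq> A" using A open_contains_ball by blast
      obtain r2 where r2: "0 < r2" "\<And>y. dist y x < r2 \<Longrightarrow> dist (D b y) (D b x) < e"
        using cont[OF b] \<open>0 < e\<close> unfolding continuous_at_eps_delta by blast
      \<comment> \<open>removing one coordinate at most doubles the norm, and moving along it adds at most \<open>|h|\<close>\<close>
      define q where "q = min r (min r1 r2) / 3"
      have q: "0 < q" "3 * q \<le> r" "3 * q \<le> r1" "3 * q \<le> r2" using r r1 r2 by (auto simp: q_def)
      show ?case
      proof (intro exI[of _ q] conjI allI impI)
        show "0 < q" by fact
        fix h assume h: "norm h < q \<and> (\<forall>b\<in>Basis - insert b B. h \<bullet> b = 0)"
        define c where "c = h \<bullet> b"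
        define h' where "h' = h - c *\<^sub>R b"
        have c: "\<bar>c\<bar> \<le> norm h" unfolding c_def using b Basis_le_norm by blast
        have nh': "norm h' \<le> 2 * norm h"
          using norm_triangle_ineq4[of h "c *\<^sub>R b"] c b by (simp add: h'_def)
        have comp: "h' \<bullet> b' = (if b' = b then 0 else h \<bullet> b')" if "b' \<in> Basis" for b'
          using that b by (auto simp: h'_def c_def inner_diff_left inner_Basis)
        have near: "norm (h' + t *\<^sub>R b) < 3 * q" if "\<bar>t\<bar> \<le> \<bar>c\<bar>" for t
          using norm_triangle_ineq[of h' "t *\<^sub>R b"] that c nh' h b by auto
        have 1: "\<bar>f (x + h') - f x - (\<Sum>b\<in>B. (h' \<bullet> b) * D b x)\<bar> \<le> e * (\<Sum>b\<in>B. \<bar>h' \<bullet> b\<bar>)"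
          using near[of 0] q h by (intro IH) (auto simp: comp)
        have sB: "(\<Sum>b\<in>B. (h' \<bullet> b) * D b x) = (\<Sum>b\<in>B. (h \<bullet> b) * D b x)"
             "(\<Sum>b\<in>B. \<bar>h' \<bullet> b\<bar>) = (\<Sum>b\<in>B. \<bar>h \<bullet> b\<bar>)"
          using insert by (auto intro!: sum.cong simp: comp)
        have 2: "\<bar>f ((x + h') + c *\<^sub>R b) - f (x + h') - c * D b x\<bar> \<le> e * \<bar>c\<bar>"
        proof (rule linearization_bound_on_segment)
          fix t :: real assume t: "\<bar>t\<bar> \<le> \<bar>c\<bar>"
          have d: "dist (x + h' + t *\<^sub>R b) x < 3 * q"
            using near[OF t] by (simp add: dist_norm algebra_simps)
          then have "x + h' + t *\<^sub>R b \<in> A" using q r1(2) by (auto simp: dist_commute)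
          then show "((\<lambda>u. f (x + h' + t *\<^sub>R b + u *\<^sub>R b)) has_real_derivative D b (x + h' + t *\<^sub>R b)) (at 0)"
            by (rule D[OF b])
          show "\<bar>D b (x + h' + t *\<^sub>R b) - D b x\<bar> \<le> e"
            using r2(2)[of "x + h' + t *\<^sub>R b"] d q by (auto simp: dist_real_def)
        qed
        have eq: "x + h' + c *\<^sub>R b = x + h" by (simp add: h'_def)
        show "\<bar>f (x + h) - f x - (\<Sum>b\<in>insert b B. (h \<bullet> b) * D b x)\<bar> \<le> e * (\<Sum>b\<in>insert b B. \<bar>h \<bullet> b\<bar>)"
          using 1 2 insert(1,2) unfolding eq sB by (simp add: c_def[symmetric] distrib_left)
      qed
    qed
  qed
  show ?thesis
    unfolding has_derivative_at_alt
  proof (intro conjI allI impI)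
    show "bounded_linear (\<lambda>h. \<Sum>b\<in>Basis. h \<bullet> b * D b x)"
      by (intro bounded_linear_sum bounded_linear_mult_const bounded_linear_inner_left)
    fix e :: real assume e: "0 < e"
    then obtain r where r: "r > 0" "\<And>h. norm h < r \<Longrightarrow>
      \<bar>f (x + h) - f x - (\<Sum>b\<in>Basis. (h \<bullet> b) * D b x)\<bar> \<le> (e / DIM('a)) * (\<Sum>b\<in>Basis. \<bar>h \<bullet> b\<bar>)"
      using claim[of "e / DIM('a)" Basis] by auto
    show "\<exists>d>0. \<forall>y. norm (y - x) < d \<longrightarrow>
      norm (f y - f x - (\<Sum>b\<in>Basis. (y - x) \<bullet> b * D b x)) \<le> e * norm (y - x)"
    proof (intro exI[of _ r] conjI allI impI)
      fix y assume y: "norm (y - x) < r"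
      have "(\<Sum>b\<in>Basis. \<bar>(y - x) \<bullet> b\<bar>) \<le> (\<Sum>b\<in>(Basis::'a set). norm (y - x))"
        by (intro sum_mono) (auto simp: Basis_le_norm)
      then have "(e / DIM('a)) * (\<Sum>b\<in>Basis. \<bar>(y - x) \<bullet> b\<bar>) \<le> (e / DIM('a)) * (DIM('a) * norm (y - x))"
        using e by (intro mult_left_mono) auto
      also have "\<dots> = e * norm (y - x)" by simp
      finally show "norm (f y - f x - (\<Sum>b\<in>Basis. (y - x) \<bullet> b * D b x)) \<le> e * norm (y - x)"
        using r(2)[OF y] by simp
    qed (rule r)
  qed
qed

text \<open>
  Peano's form of the symmetry of mixed derivatives: the derivative in the order \<open>v\<close> after \<open>u\<close>
  produces the one in the opposite order. It bridges a gap between two definitions: the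
  growth condition speaks of derivatives that apply \<open>s\<close> first, whereas \<^const>\<open>mixed_K0\<close> applies
  \<open>\<theta>\<close> first. The second difference of \<open>f\<close> over the parallelogram spanned by \<open>t u\<close> and \<open>s v\<close>
  is \<open>t s fvu x\<close> up to \<open>e |t| |s|\<close>; dividing by \<open>s\<close> and letting \<open>s\<close> tend to \<open>0\<close> leaves
  the increment of \<open>fv\<close>.
\<close>

lemma mixed_partials_commute:
  fixes f :: "'a::real_normed_vector \<Rightarrow> real"
  assumes A: "open A" "x \<in> A"
    and fu: "\<And>y. y \<in> A \<Longrightarrow> ((\<lambda>t. f (y + t *\<^sub>R u)) has_real_derivative fu y) (at 0)"
    and fv: "\<And>y. y \<in> A \<Longrightarrow> ((\<lambda>t. f (y + t *\<^sub>R v)) has_real_derivative fv y) (at 0)"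
    and fvu: "\<And>y. y \<in> A \<Longrightarrow> ((\<lambda>t. fu (y + t *\<^sub>R v)) has_real_derivative fvu y) (at 0)"
    and cont: "isCont fvu x"
  shows "((\<lambda>t. fv (x + t *\<^sub>R u)) has_real_derivative fvu x) (at 0)"
proof -
  have "\<exists>d>0. \<forall>t. \<bar>t\<bar> < d \<longrightarrow> \<bar>fv (x + t *\<^sub>R u) - fv x - t * fvu x\<bar> \<le> e * \<bar>t\<bar>" if e: "0 < e" for e
  proof -
    obtain r1 where r1: "0 < r1" "ball x r1 \<subseteq> A" using A open_contains_ball by blast
    obtain r2 where r2: "0 < r2" "\<And>y. dist y x < r2 \<Longrightarrow> dist (fvu y) (fvu x) < e"
      using cont e unfolding continuous_at_eps_delta by blast
    define r where "r = min r1 r2"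
    \<comment> \<open>small enough for the whole parallelogram to lie in the ball of radius \<open>r\<close>\<close>
    define d where "d = r / (2 * (norm u + norm v + 1))"
    have r: "0 < r" and d: "0 < d" using r1 r2
      by (auto simp: d_def r_def intro!: divide_pos_pos add_nonneg_pos)
    have near: "dist (x + (a *\<^sub>R u + b *\<^sub>R v)) x < r" if "\<bar>a\<bar> < d" "\<bar>b\<bar> < d" for a b
    proof -
      have "dist (x + (a *\<^sub>R u + b *\<^sub>R v)) x \<le> \<bar>a\<bar> * norm u + \<bar>b\<bar> * norm v"
        using norm_triangle_ineq[of "a *\<^sub>R u" "b *\<^sub>R v"] by (simp add: dist_norm)
      also have "\<dots> \<le> d * norm u + d * norm v" using that by (intro add_mono mult_right_mono) auto
      also have "\<dots> < 2 * (d * (norm u + norm v + 1))"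
      proof -
        have "d * norm u \<ge> 0" "d * norm v \<ge> 0" using d by auto
        then show ?thesis using d unfolding distrib_left by linarith
      qed
      also have "\<dots> = r"
      proof -
        have "norm u + norm v + 1 \<noteq> 0" using norm_ge_zero[of u] norm_ge_zero[of v] by linarith
        then show ?thesis unfolding d_def by (simp add: field_simps)
      qed
      finally show ?thesis .
    qed
    have inA: "x + (a *\<^sub>R u + b *\<^sub>R v) \<in> A" if "\<bar>a\<bar> < d" "\<bar>b\<bar> < d" for a b
      using near[OF that] r1(2) by (auto simp: r_def dist_commute)
    have main: "\<bar>(f (x + t *\<^sub>R u + s *\<^sub>R v) - f (x + t *\<^sub>R u)) - (f (x + s *\<^sub>R v) - f x) - t * (s * fvu x)\<bar>
        \<le> (e * \<bar>s\<bar>) * \<bar>t\<bar>" if ts: "\<bar>t\<bar> < d" "\<bar>s\<bar> < d" for t s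
    proof -
      let ?F = "\<lambda>y. f (y + s *\<^sub>R v) - f y"
      have "\<bar>?F (x + t *\<^sub>R u) - ?F x - t * (s * fvu x)\<bar> \<le> (e * \<bar>s\<bar>) * \<bar>t\<bar>"
      proof (rule linearization_bound_on_segment[where D = "\<lambda>y. fu (y + s *\<^sub>R v) - fu y"])
        fix a :: real assume a: "\<bar>a\<bar> \<le> \<bar>t\<bar>"
        have 1: "x + a *\<^sub>R u + s *\<^sub>R v \<in> A" "x + a *\<^sub>R u \<in> A"
          using inA[of a s] inA[of a 0] a ts d by (auto simp: add.assoc)
        have "((\<lambda>w. f (x + a *\<^sub>R u + w *\<^sub>R u + s *\<^sub>R v)) has_real_derivative fu (x + a *\<^sub>R u + s *\<^sub>R v)) (at 0)"
          using fu[OF 1(1)] by (simp add: algebra_simps)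
        then show "((\<lambda>w. ?F (x + a *\<^sub>R u + w *\<^sub>R u)) has_real_derivative
                fu (x + a *\<^sub>R u + s *\<^sub>R v) - fu (x + a *\<^sub>R u)) (at 0)"
          using fu[OF 1(2)] by (intro derivative_intros)
        show "\<bar>fu (x + a *\<^sub>R u + s *\<^sub>R v) - fu (x + a *\<^sub>R u) - s * fvu x\<bar> \<le> e * \<bar>s\<bar>"
        proof (rule linearization_bound_on_segment[where D = fvu])
          fix b :: real assume b: "\<bar>b\<bar> \<le> \<bar>s\<bar>"
          have 2: "x + a *\<^sub>R u + b *\<^sub>R v \<in> A" using inA[of a b] a b ts by (auto simp: add.assoc)
          show "((\<lambda>w. fu (x + a *\<^sub>R u + b *\<^sub>R v + w *\<^sub>R v)) has_real_derivative fvu (x + a *\<^sub>R u + b *\<^sub>R v)) (at 0)"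
            by (rule fvu[OF 2])
          have "dist (x + a *\<^sub>R u + b *\<^sub>R v) x < r2"
            using near[of a b] a b ts by (auto simp: add.assoc r_def)
          then show "\<bar>fvu (x + a *\<^sub>R u + b *\<^sub>R v) - fvu x\<bar> \<le> e"
            using r2(2) by (force simp: dist_real_def)
        qed
      qed
      then show ?thesis .
    qed
    show ?thesis
    proof (intro exI[of _ d] conjI allI impI)
      fix t :: real assume t: "\<bar>t\<bar> < d"
      let ?Q = "\<lambda>s. (f (x + t *\<^sub>R u + s *\<^sub>R v) - f (x + t *\<^sub>R u)) / s - (f (x + s *\<^sub>R v) - f x) / s - t * fvu x"
      have xA: "x + t *\<^sub>R u \<in> A" using inA[of t 0] t d by auto
      have "((\<lambda>s. \<bar>?Q s\<bar>) \<longlongrightarrow> \<bar>fv (x + t *\<^sub>R u) - fv x - t * fvu x\<bar>) (at 0)"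
        using fv[OF xA] fv[OF A(2)] by (intro tendsto_intros) (auto simp: DERIV_def)
      moreover have "\<forall>\<^sub>F s in at 0. \<bar>?Q s\<bar> \<le> e * \<bar>t\<bar>"
        unfolding eventually_at
      proof (intro exI[of _ d] conjI ballI impI)
        fix s :: real assume s: "s \<noteq> 0 \<and> dist s 0 < d"
        have "s * ?Q s = (f (x + t *\<^sub>R u + s *\<^sub>R v) - f (x + t *\<^sub>R u)) - (f (x + s *\<^sub>R v) - f x) - t * (s * fvu x)"
          using s unfolding right_diff_distrib by simp
        then have "\<bar>s\<bar> * \<bar>?Q s\<bar> \<le> \<bar>s\<bar> * (e * \<bar>t\<bar>)"
          using main[OF t, of s] s unfolding abs_mult[symmetric] by (simp add: abs_mult mult_ac)
        then show "\<bar>?Q s\<bar> \<le> e * \<bar>t\<bar>" using s by simp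
      qed (rule d)
      ultimately show "\<bar>fv (x + t *\<^sub>R u) - fv x - t * fvu x\<bar> \<le> e * \<bar>t\<bar>"
        by (rule tendsto_upperbound) simp
    qed (rule d)
  qed
  then show ?thesis
    unfolding has_field_derivative_def has_derivative_at_alt
    by (auto simp: bounded_linear_mult_right mult.commute)
qed

text \<open>
  Since the partial derivatives are differentiable at the centre \<open>x\<close>, their error along the segment
  to \<open>x + h\<close> is \<open>o(|h|)\<close>, and the mean value inequality on that segment multiplies it by \<open>|h|\<close>.
\<close>

lemma second_order_taylor:
  fixes f :: "'a::euclidean_space \<Rightarrow> real"
  assumes A: "open A" "x \<in> A"
    and f: "\<And>y. y \<in> A \<Longrightarrow> (f has_derivative (\<lambda>h. \<Sum>b\<in>Basis. (h \<bullet> b) * g b y)) (at y)"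
    and g: "\<And>b. b \<in> Basis \<Longrightarrow> (g b has_derivative (\<lambda>h. \<Sum>c\<in>Basis. (h \<bullet> c) * G c b)) (at x)"
    and e: "0 < e"
  shows "\<exists>r>0. \<forall>h. norm h < r \<longrightarrow>
    \<bar>f (x + h) - f x - (\<Sum>b\<in>Basis. (h \<bullet> b) * g b x) -
       (\<Sum>b\<in>Basis. \<Sum>c\<in>Basis. (h \<bullet> b) * (h \<bullet> c) * G c b) / 2\<bar> \<le> e * (norm h)\<^sup>2"
proof -
  define e' where "e' = e / DIM('a)"
  have e': "0 < e'" using e by (simp add: e'_def)
  have "\<exists>r>0. \<forall>h. norm h < r \<longrightarrow> \<bar>g b (x + h) - g b x - (\<Sum>c\<in>Basis. (h \<bullet> c) * G c b)\<bar> \<le> e' * norm h"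
    if b: "b \<in> Basis" for b
  proof -
    obtain d where "d > 0" and d: "\<And>y. norm (y - x) < d \<Longrightarrow>
       norm (g b y - g b x - (\<Sum>c\<in>Basis. ((y - x) \<bullet> c) * G c b)) \<le> e' * norm (y - x)"
      using g[OF b, unfolded has_derivative_at_alt] e' by blast
    show ?thesis using \<open>d > 0\<close> d[of "x + _"] by (intro exI[of _ d]) auto
  qed
  then obtain r where r: "\<And>b. b \<in> Basis \<Longrightarrow> r b > 0"
     "\<And>b h. b \<in> Basis \<Longrightarrow> norm h < r b \<Longrightarrow> \<bar>g b (x + h) - g b x - (\<Sum>c\<in>Basis. (h \<bullet> c) * G c b)\<bar> \<le> e' * norm h"
    by metis
  obtain r1 where r1: "0 < r1" "ball x r1 \<subseteq> A" using A open_contains_ball by blast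
  define q where "q = min r1 (Min (r ` Basis))"
  have q: "0 < q" "q \<le> r1" "\<And>b. b \<in> Basis \<Longrightarrow> q \<le> r b"
    using r1 r(1) by (auto simp: q_def min_le_iff_disj)
  show ?thesis
  proof (intro exI[of _ q] conjI allI impI)
    fix h :: 'a assume h: "norm h < q"
    define a where "a = (\<Sum>b\<in>Basis. (h \<bullet> b) * g b x)"
    define Q where "Q = (\<Sum>b\<in>Basis. \<Sum>c\<in>Basis. (h \<bullet> b) * (h \<bullet> c) * G c b)"
    let ?p = "\<lambda>t. f (x + t *\<^sub>R h) - t * a - t\<^sup>2 / 2 * Q"
    let ?p' = "\<lambda>t. (\<Sum>b\<in>Basis. (h \<bullet> b) * g b (x + t *\<^sub>R h)) - a - t * Q"
    have "norm (?p 1 - ?p 0) \<le> (e * (norm h)\<^sup>2) * norm (1 - 0 :: real)"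
    proof (rule field_differentiable_bound[of "{0..1}"])
      fix t :: real assume t: "t \<in> {0..1}"
      have nt: "norm (t *\<^sub>R h) \<le> norm h" using t by (simp add: mult_left_le_one_le)
      have xA: "x + t *\<^sub>R h \<in> A" using nt h q r1(2) by (auto simp: dist_norm)
      have "((\<lambda>t. f (x + t *\<^sub>R h)) has_derivative (\<lambda>s. \<Sum>b\<in>Basis. ((s *\<^sub>R h) \<bullet> b) * g b (x + t *\<^sub>R h))) (at t)"
        by (rule has_derivative_compose[of "\<lambda>t. x + t *\<^sub>R h", OF _ f[OF xA]])
           (auto intro!: derivative_eq_intros)
      moreover have "(\<lambda>s. \<Sum>b\<in>Basis. ((s *\<^sub>R h) \<bullet> b) * g b (x + t *\<^sub>R h)) = (*) (\<Sum>b\<in>Basis. (h \<bullet> b) * g b (x + t *\<^sub>R h))"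
        by (auto simp: sum_distrib_left mult_ac)
      ultimately have "((\<lambda>t. f (x + t *\<^sub>R h)) has_real_derivative (\<Sum>b\<in>Basis. (h \<bullet> b) * g b (x + t *\<^sub>R h))) (at t)"
        by (simp add: has_field_derivative_def)
      then have "(?p has_field_derivative ?p' t) (at t)"
        by (auto intro!: derivative_eq_intros)
      then show "(?p has_field_derivative ?p' t) (at t within {0..1})"
        by (rule has_field_derivative_at_within)
      have Q: "t * Q = (\<Sum>b\<in>Basis. (h \<bullet> b) * (\<Sum>c\<in>Basis. ((t *\<^sub>R h) \<bullet> c) * G c b))"
        by (simp add: Q_def sum_distrib_left mult_ac)
      have "?p' t = (\<Sum>b\<in>Basis. (h \<bullet> b) * (g b (x + t *\<^sub>R h) - g b x - (\<Sum>c\<in>Basis. ((t *\<^sub>R h) \<bullet> c) * G c b)))"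
        unfolding Q a_def by (simp add: right_diff_distrib sum_subtractf)
      also have "norm \<dots> \<le> (\<Sum>b\<in>(Basis::'a set). norm h * (e' * norm h))"
      proof (rule sum_norm_le)
        fix b :: 'a assume b: "b \<in> Basis"
        have "\<bar>g b (x + t *\<^sub>R h) - g b x - (\<Sum>c\<in>Basis. ((t *\<^sub>R h) \<bullet> c) * G c b)\<bar> \<le> e' * norm (t *\<^sub>R h)"
          using r(2)[OF b, of "t *\<^sub>R h"] nt h q(3)[OF b] by linarith
        also have "\<dots> \<le> e' * norm h" using nt e' by (intro mult_left_mono) auto
        finally show "norm ((h \<bullet> b) * (g b (x + t *\<^sub>R h) - g b x - (\<Sum>c\<in>Basis. ((t *\<^sub>R h) \<bullet> c) * G c b)))
            \<le> norm h * (e' * norm h)"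
          using b unfolding norm_mult by (intro mult_mono) (auto simp: Basis_le_norm)
      qed
      also have "\<dots> = e * (norm h)\<^sup>2" by (simp add: e'_def power2_eq_square)
      finally show "norm (?p' t) \<le> e * (norm h)\<^sup>2" .
    qed auto
    then show "\<bar>f (x + h) - f x - (\<Sum>b\<in>Basis. (h \<bullet> b) * g b x) -
       (\<Sum>b\<in>Basis. \<Sum>c\<in>Basis. (h \<bullet> b) * (h \<bullet> c) * G c b) / 2\<bar> \<le> e * (norm h)\<^sup>2"
      by (simp add: a_def Q_def)
  qed (rule q)
qed

section \<open>Positive definite matrices and Gaussian integrals\<close>

lemma symmetric_matrix_inner:
  fixes A :: "real^'n^'n"
  assumes "transpose A = A"
  shows "x \<bullet> (A *v y) = y \<bullet> (A *v x)"
proof -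
  have "x \<bullet> (A *v y) = (x v* A) \<bullet> y" by (simp add: dot_lmul_matrix)
  also have "x v* A = transpose A *v x" by simp
  finally show ?thesis using assms by (simp add: inner_commute)
qed

text \<open>
  Gram-Schmidt for the inner product \<open>x \<bullet> (A *v y)\<close>; the index set grows by one element, and
  the new vector is taken outside the span of the earlier ones.
\<close>

lemma exists_orthonormal_family:
  fixes A :: "real^'n^'n"
  assumes sym: "transpose A = A" and pos: "\<And>v. v \<noteq> 0 \<Longrightarrow> 0 < v \<bullet> (A *v v)"
  shows "\<exists>c :: 'n \<Rightarrow> real^'n. \<forall>i\<in>S. \<forall>j\<in>S. c i \<bullet> (A *v c j) = (if i = j then 1 else 0)"
proof -
  have "finite S" by simp
  then show ?thesis
  proof (induction S rule: finite_induct)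
    case empty
    then show ?case by simp
  next
    case (insert i S)
    then obtain c :: "'n \<Rightarrow> real^'n" where c: "\<And>i j. i \<in> S \<Longrightarrow> j \<in> S \<Longrightarrow> c i \<bullet> (A *v c j) = (if i = j then 1 else 0)"
      by blast
    have "\<not> UNIV \<subseteq> span (c ` S)"
    proof
      assume "UNIV \<subseteq> span (c ` S)"
      then have "dim (UNIV :: (real^'n) set) \<le> card (c ` S)"
        using insert(1) by (intro dim_le_card) auto
      also have "\<dots> \<le> card S" using insert(1) by (rule card_image_le)
      also have "\<dots> < CARD('n)" using insert(2) by (intro psubset_card_mono) auto
      finally show False by simp
    qed
    then obtain v where v: "v \<notin> span (c ` S)" by auto
    \<comment> \<open>the component of \<open>v\<close> orthogonal to the earlier vectors\<close>
    define w where "w = v - (\<Sum>j\<in>S. (c j \<bullet> (A *v v)) *\<^sub>R c j)"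
    have "w \<noteq> 0"
    proof
      assume "w = 0"
      then have "v = (\<Sum>j\<in>S. (c j \<bullet> (A *v v)) *\<^sub>R c j)" by (simp add: w_def)
      also have "\<dots> \<in> span (c ` S)" by (intro span_sum span_scale span_base) auto
      finally show False using v by simp
    qed
    then have q: "0 < w \<bullet> (A *v w)" by (rule pos)
    have orth: "c j \<bullet> (A *v w) = 0" if j: "j \<in> S" for j
    proof -
      have "c j \<bullet> (A *v w) = c j \<bullet> (A *v v) - (\<Sum>k\<in>S. (c k \<bullet> (A *v v)) * (c j \<bullet> (A *v c k)))"
        by (simp add: w_def matrix_vector_mult_diff_distrib inner_diff_right linear_sum[OF matrix_vector_mul_linear]
              matrix_vector_mult_scaleR inner_sum_right o_def)
      also have "(\<Sum>k\<in>S. (c k \<bullet> (A *v v)) * (c j \<bullet> (A *v c k))) = (\<Sum>k\<in>S. if j = k then c k \<bullet> (A *v v) else 0)"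
        using j by (intro sum.cong) (auto simp: c)
      finally show ?thesis using j insert(1) by simp
    qed
    define c' where "c' = c(i := (1 / sqrt (w \<bullet> (A *v w))) *\<^sub>R w)"
    have wii: "c' i \<bullet> (A *v c' i) = 1"
      using q by (simp add: c'_def matrix_vector_mult_scaleR)
    have wij: "c j \<bullet> (A *v c' i) = 0" if "j \<in> S" for j
      using orth[OF that] by (simp add: c'_def matrix_vector_mult_scaleR)
    have c'S: "c' j = c j" if "j \<in> S" for j using that insert(2) by (auto simp: c'_def)
    have "\<forall>k\<in>insert i S. \<forall>j\<in>insert i S. c' k \<bullet> (A *v c' j) = (if k = j then 1 else 0)"
      using insert(2) wii wij c symmetric_matrix_inner[OF sym] by (auto simp: c'S)
    then show ?case by blast
  qed
qed

text \<open>
  This takes the place of diagonalisation: \<open>C\<close> carries the quadratic form of \<open>A\<close> to the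
  Euclidean one, which is enough for the sign of \<open>det A\<close> and for the Gaussian integral.
\<close>

lemma matrix_congruent_identity:
  fixes A :: "real^'n^'n"
  assumes sym: "transpose A = A" and pos: "\<And>v. v \<noteq> 0 \<Longrightarrow> 0 < v \<bullet> (A *v v)"
  obtains C :: "real^'n^'n" where "transpose C ** A ** C = mat 1"
proof -
  obtain c :: "'n \<Rightarrow> real^'n" where c: "\<And>i j. c i \<bullet> (A *v c j) = (if i = j then 1 else 0)"
    using exists_orthonormal_family[OF assms, of UNIV] by auto
  define C :: "real^'n^'n" where "C = (\<chi> k i. c i $ k)"
  have "(transpose C ** (A ** C)) $ i $ j = c i \<bullet> (A *v c j)" for i j
    by (simp add: C_def matrix_matrix_mult_def transpose_def inner_vec_def matrix_vector_mult_def)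
  then have "transpose C ** (A ** C) = mat 1"
    by (simp add: vec_eq_iff c mat_def)
  then show ?thesis using that by (simp add: matrix_mul_assoc)
qed

lemma det_pos_def:
  fixes A :: "real^'n^'n"
  assumes sym: "transpose A = A" and pos: "\<And>v. v \<noteq> 0 \<Longrightarrow> 0 < v \<bullet> (A *v v)"
  shows "0 < det A"
proof -
  obtain C :: "real^'n^'n" where C: "transpose C ** A ** C = mat 1"
    using matrix_congruent_identity[OF assms] .
  have "det (transpose C ** A ** C) = (det C)\<^sup>2 * det A"
    by (simp add: det_mul power2_eq_square)
  then have 1: "(det C)\<^sup>2 * det A = 1" using C by simp
  then have "det C \<noteq> 0" by auto
  then show ?thesis using 1 by (metis zero_less_mult_pos zero_less_power2 zero_less_one)
qed

lemma Basis_cart: "(Basis :: (real^'n) set) = range (\<lambda>i. axis i 1)"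
  by (auto simp: Basis_vec_def)

lemma inj_axis_1: "inj (\<lambda>i::'n::finite. axis i (1::real))"
  by (auto simp: inj_def axis_eq_axis)

text \<open>
  Fubini isolates the coordinate \<open>m\<close>, along which a shear is a translation.
\<close>

lemma nn_integral_lborel_shear:
  fixes f :: "real^'n \<Rightarrow> ennreal"
  assumes mn: "m \<noteq> n" and f[measurable]: "f \<in> borel_measurable borel"
  shows "(\<integral>\<^sup>+x. f (x + (x $ n) *\<^sub>R axis m 1) \<partial>lborel) = (\<integral>\<^sup>+x. f x \<partial>lborel)"
proof -
  interpret product_sigma_finite "\<lambda>_::real^'n. lborel :: real measure" by standard
  define b0 :: "real^'n" where "b0 = axis m 1"
  define bn :: "real^'n" where "bn = axis n 1"
  define I :: "(real^'n) set" where "I = Basis - {b0}"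
  have b0: "b0 \<in> Basis" and bn: "bn \<in> Basis" and bn0: "bn \<noteq> b0"
    using mn by (auto simp: b0_def bn_def axis_eq_axis axis_in_Basis_iff)
  have B: "Basis = insert b0 I" and I: "finite I" "b0 \<notin> I" "bn \<in> I"
    using b0 bn bn0 by (auto simp: I_def)
  have fub: "(\<integral>\<^sup>+x. g x \<partial>lborel) =
      (\<integral>\<^sup>+y. (\<integral>\<^sup>+t. g ((\<Sum>b\<in>I. y b *\<^sub>R b) + t *\<^sub>R b0) \<partial>lborel) \<partial>Pi\<^sub>M I (\<lambda>_. lborel))"
    if [measurable]: "g \<in> borel_measurable borel" for g :: "real^'n \<Rightarrow> ennreal"
  proof -
    have "(\<integral>\<^sup>+x. g x \<partial>lborel) = (\<integral>\<^sup>+y. g (\<Sum>b\<in>Basis. y b *\<^sub>R b) \<partial>Pi\<^sub>M Basis (\<lambda>_. lborel))"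
      by (subst lborel_eq, subst nn_integral_distr) auto
    also have "\<dots> = (\<integral>\<^sup>+y. (\<integral>\<^sup>+t. g (\<Sum>b\<in>insert b0 I. (y(b0 := t)) b *\<^sub>R b) \<partial>lborel) \<partial>Pi\<^sub>M I (\<lambda>_. lborel))"
      unfolding B using I by (intro product_nn_integral_insert) auto
    also have "\<dots> = (\<integral>\<^sup>+y. (\<integral>\<^sup>+t. g ((\<Sum>b\<in>I. y b *\<^sub>R b) + t *\<^sub>R b0) \<partial>lborel) \<partial>Pi\<^sub>M I (\<lambda>_. lborel))"
    proof -
      have "(\<Sum>b\<in>insert b0 I. (y(b0 := t)) b *\<^sub>R b) = (\<Sum>b\<in>I. y b *\<^sub>R b) + t *\<^sub>R b0" for y t
        using I by (subst sum.insert) (auto simp: add.commute intro!: arg_cong2[where f = "(+)"] sum.cong)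
      then show ?thesis by simp
    qed
    finally show ?thesis .
  qed
  have "(\<integral>\<^sup>+x. f (x + (x $ n) *\<^sub>R axis m 1) \<partial>lborel) =
     (\<integral>\<^sup>+y. (\<integral>\<^sup>+t. f ((\<Sum>b\<in>I. y b *\<^sub>R b) + t *\<^sub>R b0
        + (((\<Sum>b\<in>I. y b *\<^sub>R b) + t *\<^sub>R b0) $ n) *\<^sub>R axis m 1) \<partial>lborel) \<partial>Pi\<^sub>M I (\<lambda>_. lborel))"
    by (rule fub) simp
  also have "\<dots> =
     (\<integral>\<^sup>+y. (\<integral>\<^sup>+t. f ((\<Sum>b\<in>I. y b *\<^sub>R b) + (y bn + 1 * t) *\<^sub>R b0) \<partial>lborel) \<partial>Pi\<^sub>M I (\<lambda>_. lborel))"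
  proof (intro nn_integral_cong)
    fix y :: "real^'n \<Rightarrow> real" and t :: real
    have "((\<Sum>b\<in>I. y b *\<^sub>R b) + t *\<^sub>R b0) $ n = ((\<Sum>b\<in>I. y b *\<^sub>R b) + t *\<^sub>R b0) \<bullet> bn"
      by (simp add: bn_def inner_axis)
    also have "\<dots> = (\<Sum>b\<in>I. y b * (b \<bullet> bn)) + t * (b0 \<bullet> bn)"
      by (simp add: inner_add_left inner_sum_left)
    also have "(\<Sum>b\<in>I. y b * (b \<bullet> bn)) = (\<Sum>b\<in>I. if b = bn then y b else 0)"
      using bn by (intro sum.cong) (auto simp: I_def inner_Basis)
    also have "\<dots> = y bn" using I by simp
    also have "b0 \<bullet> bn = 0" using b0 bn bn0 by (simp add: inner_Basis)
    finally show "f ((\<Sum>b\<in>I. y b *\<^sub>R b) + t *\<^sub>R b0 + (((\<Sum>b\<in>I. y b *\<^sub>R b) + t *\<^sub>R b0) $ n) *\<^sub>R axis m 1)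
      = f ((\<Sum>b\<in>I. y b *\<^sub>R b) + (y bn + 1 * t) *\<^sub>R b0)"
      by (simp add: b0_def[symmetric] scaleR_add_left add_ac)
  qed
  also have "\<dots> = (\<integral>\<^sup>+y. (\<integral>\<^sup>+t. f ((\<Sum>b\<in>I. y b *\<^sub>R b) + t *\<^sub>R b0) \<partial>lborel) \<partial>Pi\<^sub>M I (\<lambda>_. lborel))"
  proof (rule nn_integral_cong)
    fix y :: "real^'n \<Rightarrow> real"
    show "(\<integral>\<^sup>+t. f ((\<Sum>b\<in>I. y b *\<^sub>R b) + (y bn + 1 * t) *\<^sub>R b0) \<partial>lborel)
       = (\<integral>\<^sup>+t. f ((\<Sum>b\<in>I. y b *\<^sub>R b) + t *\<^sub>R b0) \<partial>lborel)"
      using nn_integral_real_affine[of "\<lambda>t. f ((\<Sum>b\<in>I. y b *\<^sub>R b) + t *\<^sub>R b0)" 1 "y bn"] by simp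
  qed
  also have "\<dots> = (\<integral>\<^sup>+x. f x \<partial>lborel)" by (simp add: fub)
  finally show ?thesis .
qed

lemma nn_integral_lborel_permute:
  fixes f :: "real^'n \<Rightarrow> ennreal"
  assumes p: "p permutes UNIV" and f[measurable]: "f \<in> borel_measurable borel"
  shows "(\<integral>\<^sup>+x. f (\<chi> i. x $ p i) \<partial>lborel) = (\<integral>\<^sup>+x. f x \<partial>lborel)"
proof -
  have meas[measurable]: "(\<lambda>x::real^'n. (\<chi> i. x $ p i)) \<in> borel_measurable borel"
    by (intro borel_measurable_continuous_onI continuous_intros)
  have bij: "bij p" using p by (rule permutes_bij)
  have prodB: "(\<Prod>b\<in>Basis. (z :: real^'n) \<bullet> b) = (\<Prod>i\<in>UNIV. z $ i)" for z
  proof -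
    show ?thesis by (simp add: Basis_cart prod.reindex[OF inj_axis_1] inner_axis)
  qed
  have "lborel = distr lborel borel (\<lambda>x::real^'n. (\<chi> i. x $ p i))"
  proof (rule lborel_eqI)
    fix l u :: "real^'n" assume "\<And>b. b \<in> Basis \<Longrightarrow> l \<bullet> b \<le> u \<bullet> b"
    then have le: "l $ i \<le> u $ i" for i
      by (metis axis_in_Basis_iff inner_axis' inner_commute one_neq_zero lambda_one inner_real_def insertI1 Basis_real_def mult.left_neutral)
    define l' u' where "l' = (\<chi> i. l $ inv p i)" and "u' = (\<chi> i. u $ inv p i)"
    have eq: "(\<lambda>x::real^'n. (\<chi> i. x $ p i)) -` box l u = box l' u'"
    proof -
      have "(\<forall>i. P (p i) i) \<longleftrightarrow> (\<forall>i. P i (inv p i))" for P :: "'n \<Rightarrow> 'n \<Rightarrow> bool"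
        using bij by (metis bij_inv_eq_iff)
      from this[of "\<lambda>j i. l $ i < _ $ j \<and> _ $ j < u $ i"] show ?thesis
        by (auto simp: mem_box_cart l'_def u'_def)
    qed
    have "emeasure (distr lborel borel (\<lambda>x::real^'n. (\<chi> i. x $ p i))) (box l u) = emeasure lborel (box l' u')"
      by (subst emeasure_distr) (auto simp: eq)
    also have "\<dots> = (\<Prod>b\<in>Basis. (u' - l') \<bullet> b)"
    proof (subst emeasure_lborel_box)
      fix b :: "real^'n" assume "b \<in> Basis"
      then show "l' \<bullet> b \<le> u' \<bullet> b" using le by (auto simp: Basis_vec_def inner_axis l'_def u'_def)
    qed simp
    also have "(\<Prod>b\<in>Basis. (u' - l') \<bullet> b) = (\<Prod>b\<in>Basis. (u - l) \<bullet> b)"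
      unfolding prodB using prod.reindex_bij_betw[OF bij_imp_bij_inv[OF bij], of "\<lambda>i. (u - l) $ i"]
      by (simp add: l'_def u'_def)
    finally show "emeasure (distr lborel borel (\<lambda>x::real^'n. (\<chi> i. x $ p i))) (box l u) = (\<Prod>b\<in>Basis. (u - l) \<bullet> b)" .
  qed simp
  then have "(\<integral>\<^sup>+x. f x \<partial>lborel) = (\<integral>\<^sup>+x. f x \<partial>distr lborel borel (\<lambda>x::real^'n. (\<chi> i. x $ p i)))" by simp
  then show ?thesis by (simp add: nn_integral_distr)
qed

text \<open>
  An invertible linear map is a product of coordinate scalings, transpositions and shears, and the
  formula is multiplicative; singular factors cannot occur in an invertible product.
\<close>

lemma nn_integral_lborel_linear:
  fixes g :: "real^'n \<Rightarrow> real^'n" and f :: "real^'n \<Rightarrow> ennreal"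
  assumes "linear g" "det (matrix g) \<noteq> 0" "f \<in> borel_measurable borel"
  shows "(\<integral>\<^sup>+x. f x \<partial>lborel) = ennreal \<bar>det (matrix g)\<bar> * (\<integral>\<^sup>+x. f (g x) \<partial>lborel)"
proof -
  have "det (matrix g) \<noteq> 0 \<longrightarrow> (\<forall>f\<in>borel_measurable borel.
    (\<integral>\<^sup>+x. f x \<partial>lborel) = ennreal \<bar>det (matrix g)\<bar> * (\<integral>\<^sup>+x. f (g x) \<partial>lborel))"
  proof (rule induct_linear_elementary[OF assms(1)])
    fix h k :: "real^'n \<Rightarrow> real^'n"
    assume lin: "linear h" "linear k"
      and h: "det (matrix h) \<noteq> 0 \<longrightarrow> (\<forall>f\<in>borel_measurable borel.
         (\<integral>\<^sup>+x. f x \<partial>lborel) = ennreal \<bar>det (matrix h)\<bar> * (\<integral>\<^sup>+x. f (h x) \<partial>lborel))"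
      and k: "det (matrix k) \<noteq> 0 \<longrightarrow> (\<forall>f\<in>borel_measurable borel.
         (\<integral>\<^sup>+x. f x \<partial>lborel) = ennreal \<bar>det (matrix k)\<bar> * (\<integral>\<^sup>+x. f (k x) \<partial>lborel))"
    have d: "det (matrix (h \<circ> k)) = det (matrix h) * det (matrix k)"
      using lin by (simp add: matrix_compose det_mul)
    have [measurable]: "h \<in> borel_measurable borel"
      using lin(1) by (intro borel_measurable_continuous_onI linear_continuous_on) (simp add: linear_conv_bounded_linear)
    show "det (matrix (h \<circ> k)) \<noteq> 0 \<longrightarrow> (\<forall>f\<in>borel_measurable borel.
         (\<integral>\<^sup>+x. f x \<partial>lborel) = ennreal \<bar>det (matrix (h \<circ> k))\<bar> * (\<integral>\<^sup>+x. f ((h \<circ> k) x) \<partial>lborel))"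
    proof (intro impI ballI)
      fix f :: "real^'n \<Rightarrow> ennreal" assume nz: "det (matrix (h \<circ> k)) \<noteq> 0" and [measurable]: "f \<in> borel_measurable borel"
      have "(\<integral>\<^sup>+x. f x \<partial>lborel) = ennreal \<bar>det (matrix h)\<bar> * (\<integral>\<^sup>+x. f (h x) \<partial>lborel)"
        by (rule h[rule_format]) (use nz d in simp_all)
      also have "(\<integral>\<^sup>+x. f (h x) \<partial>lborel) = ennreal \<bar>det (matrix k)\<bar> * (\<integral>\<^sup>+x. f (h (k x)) \<partial>lborel)"
        by (rule k[rule_format]) (use nz d in simp_all)
      finally show "(\<integral>\<^sup>+x. f x \<partial>lborel) = ennreal \<bar>det (matrix (h \<circ> k))\<bar> * (\<integral>\<^sup>+x. f ((h \<circ> k) x) \<partial>lborel)"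
        by (simp add: d abs_mult ennreal_mult mult.assoc)
    qed
  next
    fix h :: "real^'n \<Rightarrow> real^'n" and i assume "linear h" "\<And>x. h x $ i = 0"
    then have "row i (matrix h) = 0" by (simp add: row_def matrix_def vec_eq_iff)
    then show "det (matrix h) \<noteq> 0 \<longrightarrow> (\<forall>f\<in>borel_measurable borel.
         (\<integral>\<^sup>+x. f x \<partial>lborel) = ennreal \<bar>det (matrix h)\<bar> * (\<integral>\<^sup>+x. f (h x) \<partial>lborel))"
      by (simp add: det_zero_row(1))
  next
    fix c :: "'n \<Rightarrow> real"
    let ?h = "\<lambda>x. \<chi> i. c i * x $ i"
    have m: "matrix ?h = (\<chi> i j. if i = j then c i else 0)"
      by (simp add: matrix_def vec_eq_iff axis_def)
    have d: "det (matrix ?h) = prod c UNIV"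
      unfolding m by (subst det_diagonal) auto
    show "det (matrix ?h) \<noteq> 0 \<longrightarrow> (\<forall>f\<in>borel_measurable borel.
         (\<integral>\<^sup>+x. f x \<partial>lborel) = ennreal \<bar>det (matrix ?h)\<bar> * (\<integral>\<^sup>+x. f (?h x) \<partial>lborel))"
    proof (intro impI ballI)
      fix f :: "real^'n \<Rightarrow> ennreal" assume nz: "det (matrix ?h) \<noteq> 0" and [measurable]: "f \<in> borel_measurable borel"
      define C :: "real^'n \<Rightarrow> real" where "C b = (\<Sum>i\<in>UNIV. c i * b $ i)" for b
      have C: "C (axis i 1) = c i" for i
        by (simp add: C_def axis_def if_distrib cong: if_cong)
      have T: "0 + (\<Sum>j\<in>Basis. (C j * (x \<bullet> j)) *\<^sub>R j) = ?h x" for x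
      proof -
        have "0 + (\<Sum>j\<in>Basis. (C j * (x \<bullet> j)) *\<^sub>R j) = (\<Sum>i\<in>UNIV. (c i * x $ i) *\<^sub>R axis i 1)"
          by (simp add: Basis_cart sum.reindex[OF inj_axis_1] C inner_axis)
        also have "\<dots> = ?h x"
          by (simp add: vec_eq_iff axis_def if_distrib cong: if_cong)
        finally show ?thesis .
      qed
      have P: "(\<Prod>j\<in>Basis. \<bar>C j\<bar>) = \<bar>prod c UNIV\<bar>"
        by (simp add: Basis_cart prod.reindex[OF inj_axis_1] C abs_prod)
      have "C j \<noteq> 0" if "j \<in> Basis" for j using nz d that by (auto simp: Basis_cart C)
      then have L: "lborel = density (distr lborel borel ?h) (\<lambda>_. \<bar>prod c UNIV\<bar>)"
        using lborel_affine_euclidean[of C 0, unfolded T P] by blast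
      have [measurable]: "?h \<in> borel_measurable borel"
        by (intro borel_measurable_continuous_onI continuous_intros)
      have "(\<integral>\<^sup>+x. f x \<partial>lborel) = (\<integral>\<^sup>+x. f x \<partial>density (distr lborel borel ?h) (\<lambda>_. \<bar>prod c UNIV\<bar>))"
        by (subst L) rule
      also have "\<dots> = ennreal \<bar>det (matrix ?h)\<bar> * (\<integral>\<^sup>+x. f (?h x) \<partial>lborel)"
        by (simp add: nn_integral_density nn_integral_distr nn_integral_cmult d)
      finally show "(\<integral>\<^sup>+x. f x \<partial>lborel) = ennreal \<bar>det (matrix ?h)\<bar> * (\<integral>\<^sup>+x. f (?h x) \<partial>lborel)" .
    qed
  next
    fix m n :: 'n assume mn: "m \<noteq> n"
    let ?p = "Transposition.transpose m n"
    have p: "?p permutes UNIV" by (simp add: permutes_swap_id)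
    have "matrix (\<lambda>x. \<chi> i. x $ ?p i) = (\<chi> i. (mat 1 :: real^'n^'n) $ ?p i)"
      by (auto simp: matrix_def vec_eq_iff mat_def axis_def)
    then have "det (matrix (\<lambda>x::real^'n. \<chi> i. x $ ?p i)) = of_int (sign ?p)"
      by (simp add: det_permute_rows[OF p])
    then have D1: "\<bar>det (matrix (\<lambda>x::real^'n. \<chi> i. x $ ?p i))\<bar> = 1"
      by (simp add: sign_def)
    have sw: "(\<integral>\<^sup>+x. f (\<chi> i. x $ ?p i) \<partial>lborel) = (\<integral>\<^sup>+x. f x \<partial>lborel)"
      if "f \<in> borel_measurable borel" for f :: "real^'n \<Rightarrow> ennreal"
      by (rule nn_integral_lborel_permute[OF p that])
    show "det (matrix (\<lambda>x::real^'n. \<chi> i. x $ ?p i)) \<noteq> 0 \<longrightarrow> (\<forall>f\<in>borel_measurable borel.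
         (\<integral>\<^sup>+(x::real^'n). f x \<partial>lborel) = ennreal \<bar>det (matrix (\<lambda>x::real^'n. \<chi> i. x $ ?p i))\<bar> * (\<integral>\<^sup>+x. f (\<chi> i. x $ ?p i) \<partial>lborel))"
      unfolding D1 ennreal_1 mult_1
    proof (intro impI ballI)
      fix f :: "real^'n \<Rightarrow> ennreal" assume "f \<in> borel_measurable borel"
      then show "(\<integral>\<^sup>+x. f x \<partial>lborel) = (\<integral>\<^sup>+x. f (\<chi> i. x $ ?p i) \<partial>lborel)"
        using sw[of f] by simp
    qed
  next
    fix m n :: 'n assume mn: "m \<noteq> n"
    let ?h = "\<lambda>x::real^'n. \<chi> i. if i = m then x $ m + x $ n else x $ i"
    have "matrix ?h = (\<chi> k. if k = m then row m (mat 1) + 1 *s row n (mat 1) else row k (mat 1))"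
      by (auto simp: matrix_def vec_eq_iff mat_def axis_def row_def)
    then have "det (matrix ?h) = 1"
      using det_row_operation[OF mn, of "mat 1" 1] by simp
    moreover have "?h x = x + (x $ n) *\<^sub>R axis m 1" for x
      by (auto simp: vec_eq_iff axis_def)
    ultimately show "det (matrix ?h) \<noteq> 0 \<longrightarrow> (\<forall>f\<in>borel_measurable borel.
         (\<integral>\<^sup>+x. f x \<partial>lborel) = ennreal \<bar>det (matrix ?h)\<bar> * (\<integral>\<^sup>+x. f (?h x) \<partial>lborel))"
      using nn_integral_lborel_shear[OF mn] by simp
  qed
  then show ?thesis using assms by blast
qed

lemma nn_integral_gaussian_1: "(\<integral>\<^sup>+t. ennreal (exp (- t\<^sup>2 / 2)) \<partial>lborel) = ennreal (sqrt (2 * pi))"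
proof -
  have "(\<integral>\<^sup>+t. ennreal (exp (- t\<^sup>2 / 2)) \<partial>lborel) = (\<integral>\<^sup>+t. ennreal (sqrt (2 * pi)) * ennreal (std_normal_density t) \<partial>lborel)"
    by (intro nn_integral_cong) (simp add: std_normal_density_def ennreal_mult[symmetric])
  also have "\<dots> = ennreal (sqrt (2 * pi)) * (\<integral>\<^sup>+t. ennreal (std_normal_density t) \<partial>lborel)"
    by (rule nn_integral_cmult) simp
  also have "(\<integral>\<^sup>+t. ennreal (std_normal_density t) \<partial>lborel) = 1"
    using prob_space.emeasure_space_1[OF prob_space_normal_density[of 1 0]]
    by (simp add: emeasure_density)
  finally show ?thesis by simp
qed

lemma nn_integral_gaussian_std:
  "(\<integral>\<^sup>+(x::real^'n). ennreal (exp (- (x \<bullet> x) / 2)) \<partial>lborel) = ennreal (sqrt (2 * pi) ^ CARD('n))"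
proof -
  have "(\<integral>\<^sup>+(x::real^'n). ennreal (exp (- (x \<bullet> x) / 2)) \<partial>lborel)
      = (\<integral>\<^sup>+(x::real^'n). (\<Prod>b\<in>Basis. ennreal (exp (- (x \<bullet> b)\<^sup>2 / 2))) \<partial>lborel)"
  proof (intro nn_integral_cong)
    fix x :: "real^'n"
    have "- (x \<bullet> x) / 2 = (\<Sum>b\<in>Basis. - (x \<bullet> b)\<^sup>2 / 2)"
      by (subst (1) euclidean_inner) (simp add: power2_eq_square sum_negf sum_divide_distrib)
    then show "ennreal (exp (- (x \<bullet> x) / 2)) = (\<Prod>b\<in>Basis. ennreal (exp (- (x \<bullet> b)\<^sup>2 / 2)))"
      by (simp add: exp_sum prod_ennreal)
  qed
  also have "\<dots> = (\<Prod>b\<in>(Basis::(real^'n) set). \<integral>\<^sup>+t. ennreal (exp (- t\<^sup>2 / 2)) \<partial>lborel)"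
    by (rule nn_integral_lborel_prod) simp_all
  also have "\<dots> = (\<Prod>b\<in>(Basis::(real^'n) set). ennreal (sqrt (2 * pi)))"
    by (simp only: nn_integral_gaussian_1)
  also have "\<dots> = ennreal (sqrt (2 * pi) ^ CARD('n))"
    by (simp add: ennreal_power)
  finally show ?thesis .
qed

text \<open>
  The substitution \<open>x = C y\<close> with \<open>C\<^sup>T A C = 1\<close> turns the integrand into a product of
  one-dimensional Gaussians, and \<open>|det C| = (det A)\<close> to the power \<open>-1/2\<close>.
\<close>

theorem gaussian_integral_pos_def:
  fixes A :: "real^'n^'n"
  assumes sym: "transpose A = A" and pos: "\<And>v. v \<noteq> 0 \<Longrightarrow> 0 < v \<bullet> (A *v v)"
  shows "integrable lborel (\<lambda>x. exp (- (x \<bullet> (A *v x)) / 2))"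
    and "(LINT x|lborel. exp (- (x \<bullet> (A *v x)) / 2)) = sqrt (2 * pi) ^ CARD('n) / sqrt (det A)"
proof -
  obtain C :: "real^'n^'n" where C: "transpose C ** A ** C = mat 1"
    using matrix_congruent_identity[OF assms] .
  have "det (transpose C ** A ** C) = (det C)\<^sup>2 * det A"
    by (simp add: det_mul power2_eq_square)
  then have 1: "(det C)\<^sup>2 * det A = 1" using C by simp
  have dA: "0 < det A" by (rule det_pos_def[OF assms])
  have dC: "det C \<noteq> 0" using 1 by auto
  have "\<bar>det C\<bar> * sqrt (det A) = 1"
    using arg_cong[OF 1, of sqrt] by (simp add: real_sqrt_mult)
  then have absC: "\<bar>det C\<bar> = 1 / sqrt (det A)" using dA by (simp add: field_simps)
  let ?f = "\<lambda>x::real^'n. exp (- (x \<bullet> (A *v x)) / 2)"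
  have fm: "?f \<in> borel_measurable lborel"
    unfolding measurable_lborel2
    by (intro borel_measurable_continuous_onI continuous_intros) auto
  have q: "(C *v x) \<bullet> (A *v (C *v x)) = x \<bullet> x" for x
  proof -
    have "(C *v x) \<bullet> (A *v (C *v x)) = (A *v (C *v x)) \<bullet> (C *v x)" by (rule inner_commute)
    also have "\<dots> = ((A *v (C *v x)) v* C) \<bullet> x" by (simp add: dot_lmul_matrix)
    also have "(A *v (C *v x)) v* C = transpose C *v (A *v (C *v x))" by simp
    also have "\<dots> = (transpose C ** A ** C) *v x"
      by (simp only: matrix_vector_mul_assoc matrix_mul_assoc)
    finally show ?thesis by (simp add: C)
  qed
  have "(\<integral>\<^sup>+x. ennreal (?f x) \<partial>lborel) = ennreal \<bar>det (matrix ((*v) C))\<bar> * (\<integral>\<^sup>+x. ennreal (?f (C *v x)) \<partial>lborel)"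
  proof (rule nn_integral_lborel_linear[where f = "\<lambda>x. ennreal (?f x)"])
    show "(\<lambda>x. ennreal (?f x)) \<in> borel_measurable borel"
      using measurable_compose[OF fm measurable_ennreal] by simp
  qed (use dC in simp_all)
  also have "\<dots> = ennreal (sqrt (2 * pi) ^ CARD('n) / sqrt (det A))"
    using dA unfolding q nn_integral_gaussian_std by (simp add: absC ennreal_mult[symmetric])
  finally have I: "(\<integral>\<^sup>+x. ennreal (?f x) \<partial>lborel) = ennreal (sqrt (2 * pi) ^ CARD('n) / sqrt (det A))" .
  show "integrable lborel ?f"
    by (rule integrableI_nonneg[OF fm]) (simp_all only: I, simp_all)
  have "(LINT x|lborel. ?f x) = enn2real (\<integral>\<^sup>+x. ennreal (?f x) \<partial>lborel)"
    by (rule integral_eq_nn_integral[OF fm]) simp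
  then show "(LINT x|lborel. ?f x) = sqrt (2 * pi) ^ CARD('n) / sqrt (det A)"
    unfolding I using dA by simp
qed

lemma integrable_gaussian_norm:
  assumes c: "0 < c"
  shows "integrable lborel (\<lambda>x::real^'n. exp (- (c * (norm x)\<^sup>2)))"
proof -
  have s: "((2 * c) *\<^sub>R mat 1 :: real^'n^'n) *v v = (2 * c) *\<^sub>R v" for v
    by (simp add: scaleR_matrix_vector_assoc[symmetric])
  have "integrable lborel (\<lambda>x. exp (- (x \<bullet> (((2 * c) *\<^sub>R mat 1 :: real^'n^'n) *v x)) / 2))"
  proof (rule gaussian_integral_pos_def)
    show "transpose ((2 * c) *\<^sub>R mat 1 :: real^'n^'n) = (2 * c) *\<^sub>R mat 1"
      by (auto simp: transpose_def vec_eq_iff mat_def)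
    show "0 < v \<bullet> (((2 * c) *\<^sub>R mat 1 :: real^'n^'n) *v v)" if "v \<noteq> 0" for v
      using that c by (simp add: s)
  qed
  then show ?thesis by (simp add: s dot_square_norm)
qed

lemma det_scaleR: "det (k *\<^sub>R (B :: real^'n^'n)) = k ^ CARD('n) * det B"
proof -
  have "k *\<^sub>R B = (\<chi> i. k *s B $ i)" by (simp add: vec_eq_iff)
  then show ?thesis by (simp add: det_rows_mul)
qed

text \<open>
  The normal law with covariance \<open>- H\<close> inverse, written through \<open>H\<close> and normalised by its own
  integral: this is the form in which it arises as a limit of posteriors.
\<close>

lemma multivariate_normal_0_eq:
  fixes H :: "real^'n^'n"
  assumes sym: "transpose H = H" and neg: "negative_definite H"
  shows "multivariate_normal 0 (- matrix_inv H) = density lborel (\<lambda>z. ennreal (exp (z \<bullet> (H *v z) / 2) /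
           (LINT z|lborel. exp (z \<bullet> (H *v z) / 2))))"
    and "integrable lborel (\<lambda>z. exp (z \<bullet> (H *v z) / 2))"
    and "0 < (LINT z|lborel. exp (z \<bullet> (H *v z) / 2))"
proof -
  let ?A = "- H"
  have neg_mult: "(- M) *v v = - (M *v v)" for M :: "real^'n^'n" and v
    by (simp add: matrix_vector_mult_def vec_eq_iff sum_negf)
  have symA: "transpose ?A = ?A" using sym by (simp add: transpose_def vec_eq_iff)
  have posA: "0 < v \<bullet> (?A *v v)" if "v \<noteq> 0" for v
    using neg that by (simp add: negative_definite_def neg_mult)
  have dA: "0 < det ?A" by (rule det_pos_def[OF symA posA])
  then have "invertible ?A" by (simp add: invertible_det_nz)
  then obtain B where B: "?A ** B = mat 1" "B ** ?A = mat 1" by (auto simp: invertible_def)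
  have uni: "matrix_inv M = N" if "M ** N = mat 1" "N ** M = mat 1" for M N :: "real^'n^'n"
  proof -
    have "\<exists>N. M ** N = mat 1 \<and> N ** M = mat 1" using that by blast
    then have "M ** matrix_inv M = mat 1 \<and> matrix_inv M ** M = mat 1"
      unfolding matrix_inv_def by (rule someI_ex)
    then show ?thesis by (metis matrix_mul_assoc matrix_mul_lid matrix_mul_rid that(1))
  qed
  have mm: "(- M) ** N = - (M ** N)" "M ** (- N) = - (M ** N)" for M N :: "real^'n^'n"
    by (simp_all add: matrix_matrix_mult_def vec_eq_iff sum_negf)
  have HI: "- matrix_inv H = B" using uni[of H "- B"] B by (simp add: mm)
  have inv: "matrix_inv B = ?A" by (rule uni) (use B in auto)
  have dB: "det B = 1 / det ?A"
  proof -
    have "det ?A * det B = 1" using arg_cong[OF B(1), of det] by (simp add: det_mul)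
    then show ?thesis using dA by (simp add: field_simps)
  qed
  have det: "sqrt (det ((2 * pi) *\<^sub>R B)) = sqrt (2 * pi) ^ CARD('n) / sqrt (det ?A)"
    by (simp add: det_scaleR dB real_sqrt_divide real_sqrt_power real_sqrt_mult power_mult_distrib)
  have I: "(LINT z|lborel. exp (z \<bullet> (H *v z) / 2)) = sqrt (2 * pi) ^ CARD('n) / sqrt (det ?A)"
    using gaussian_integral_pos_def(2)[OF symA posA] by (simp add: neg_mult)
  show "integrable lborel (\<lambda>z. exp (z \<bullet> (H *v z) / 2))"
    using gaussian_integral_pos_def(1)[OF symA posA] by (simp add: neg_mult)
  show "0 < (LINT z|lborel. exp (z \<bullet> (H *v z) / 2))"
    unfolding I using dA by simp
  show "multivariate_normal 0 (- matrix_inv H) = density lborel (\<lambda>z. ennreal (exp (z \<bullet> (H *v z) / 2) /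
           (LINT z|lborel. exp (z \<bullet> (H *v z) / 2))))"
    unfolding multivariate_normal_def HI inv det I by (simp add: neg_mult)
qed

section \<open>Fourier inversion for probability measures\<close>

lemma integral_lborel_affine:
  fixes F :: "'a::euclidean_space \<Rightarrow> 'b::{banach, second_countable_topology}"
  assumes c: "c \<noteq> 0" and F[measurable]: "F \<in> borel_measurable borel"
  shows "(LINT x|lborel. F x) = \<bar>c\<bar> ^ DIM('a) *\<^sub>R (LINT x|lborel. F (t + c *\<^sub>R x))"
proof -
  have "(LINT x|lborel. F x) = (LINT x|density (distr lborel borel (\<lambda>x. t + c *\<^sub>R x)) (\<lambda>_. \<bar>c\<bar> ^ DIM('a)). F x)"
    by (subst lborel_affine[OF c, of t]) rule
  also have "\<dots> = (LINT x|distr lborel borel (\<lambda>x. t + c *\<^sub>R x). \<bar>c\<bar> ^ DIM('a) *\<^sub>R F x)"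
    by (subst integral_density) auto
  also have "\<dots> = (LINT x|lborel. \<bar>c\<bar> ^ DIM('a) *\<^sub>R F (t + c *\<^sub>R x))"
    by (rule integral_distr) auto
  finally show ?thesis by simp
qed

lemma integrable_lborel_affine:
  fixes F :: "'a::euclidean_space \<Rightarrow> 'b::{banach, second_countable_topology}"
  assumes c: "c \<noteq> 0" and F: "integrable lborel F"
  shows "integrable lborel (\<lambda>x. F (t + c *\<^sub>R x))"
proof -
  have [measurable]: "F \<in> borel_measurable borel" using F by auto
  have "integrable (density (distr lborel borel (\<lambda>x. t + c *\<^sub>R x)) (\<lambda>_. \<bar>c\<bar> ^ DIM('a))) F"
    using F by (subst (asm) lborel_affine[OF c, of t])
  then have "integrable (distr lborel borel (\<lambda>x. t + c *\<^sub>R x)) (\<lambda>x. \<bar>c\<bar> ^ DIM('a) *\<^sub>R F x)"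
    by (subst (asm) integrable_density) auto
  then have "integrable lborel (\<lambda>x. \<bar>c\<bar> ^ DIM('a) *\<^sub>R F (t + c *\<^sub>R x))"
    by (subst (asm) integrable_distr_eq) auto
  then have "integrable lborel (\<lambda>x. inverse (\<bar>c\<bar> ^ DIM('a)) *\<^sub>R (\<bar>c\<bar> ^ DIM('a) *\<^sub>R F (t + c *\<^sub>R x)))"
    by (rule integrable_scaleR_right)
  then show ?thesis using c by simp
qed

lemma
  fixes f :: "'a::euclidean_space \<Rightarrow> real \<Rightarrow> 'b::{real_normed_field, banach, second_countable_topology}"
  assumes f: "\<And>b. b \<in> Basis \<Longrightarrow> integrable lborel (f b)"
  shows integrable_lborel_prod: "integrable lborel (\<lambda>x::'a. \<Prod>b\<in>Basis. f b (x \<bullet> b))"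
    and integral_lborel_prod: "(LINT x|lborel. (\<Prod>b\<in>Basis. f b (x \<bullet> b))) = (\<Prod>b\<in>Basis. (LINT t|lborel. f b t))"
proof -
  interpret product_sigma_finite "\<lambda>_::'a. lborel :: real measure" by standard
  have [measurable]: "f b \<in> borel_measurable borel" if "b \<in> Basis" for b
    using f[OF that] by auto
  let ?T = "\<lambda>y::'a \<Rightarrow> real. \<Sum>b\<in>Basis. y b *\<^sub>R b"
  have eq: "(\<Prod>b\<in>Basis. f b (?T y \<bullet> b)) = (\<Prod>b\<in>Basis. f b (y b))" for y
    by (intro prod.cong refl) (simp add: inner_sum_left_Basis)
  have m: "(\<lambda>x::'a. \<Prod>b\<in>Basis. f b (x \<bullet> b)) \<in> borel_measurable borel" by measurable
  have T: "?T \<in> measurable (Pi\<^sub>M Basis (\<lambda>_. lborel)) borel" by measurable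
  show "integrable lborel (\<lambda>x::'a. \<Prod>b\<in>Basis. f b (x \<bullet> b))"
    unfolding lborel_eq[where 'a='a]
    by (subst integrable_distr_eq[OF T m]) (simp add: eq product_integrable_prod f)
  show "(LINT x|lborel. (\<Prod>b\<in>Basis. f b (x \<bullet> b))) = (\<Prod>b\<in>Basis. (LINT t|lborel. f b t))"
    unfolding lborel_eq[where 'a='a]
    by (subst integral_distr[OF T m]) (simp add: eq product_integral_prod f)
qed

lemma integrable_exp_square:
  fixes e :: real
  assumes "0 < e" shows "integrable lborel (\<lambda>t. exp (- (e * t)\<^sup>2 / 2))"
proof -
  have "integrable lborel (\<lambda>t. sqrt (2 * pi) / e * normal_density 0 (1 / e) t)"
    using assms by (intro integrable_mult_right integrable_normal_density) auto
  moreover have "sqrt (2 * pi) / e * normal_density 0 (1 / e) t = exp (- (e * t)\<^sup>2 / 2)" for t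
    using assms by (simp add: normal_density_def real_sqrt_mult real_sqrt_divide field_simps power2_eq_square)
  ultimately show ?thesis by simp
qed

lemma fourier_gaussian_1:
  assumes e: "0 < e"
  shows "(CLINT t|lborel. complex_of_real (exp (- (e * t)\<^sup>2 / 2)) * iexp (- (t * z)))
     = complex_of_real (2 * pi * normal_density 0 e z)"
proof -
  have "(CLINT t|lborel. complex_of_real (exp (- (e * t)\<^sup>2 / 2)) * iexp (- (t * z)))
     = \<bar>1 / e\<bar> *\<^sub>R (CLINT t|lborel. complex_of_real (exp (- (e * (0 + 1 / e * t))\<^sup>2 / 2)) * iexp (- ((0 + 1 / e * t) * z)))"
    using e by (intro lborel_integral_real_affine) auto
  also have "(CLINT t|lborel. complex_of_real (exp (- (e * (0 + 1 / e * t))\<^sup>2 / 2)) * iexp (- ((0 + 1 / e * t) * z)))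
     = (CLINT t|lborel. sqrt (2 * pi) *\<^sub>R (std_normal_density t *\<^sub>R iexp ((- z / e) * t)))"
    using e by (intro Bochner_Integration.integral_cong refl) (simp add: std_normal_density_def scaleR_conv_of_real mult_ac)
  also have "\<dots> = sqrt (2 * pi) *\<^sub>R (CLINT t|lborel. std_normal_density t *\<^sub>R iexp ((- z / e) * t))"
    by (rule integral_scaleR_right)
  also have "(CLINT t|lborel. std_normal_density t *\<^sub>R iexp ((- z / e) * t)) = char std_normal_distribution (- z / e)"
    unfolding char_def by (rule integral_density[symmetric]) auto
  also have "char std_normal_distribution (- z / e) = complex_of_real (exp (- (z / e)\<^sup>2 / 2))"
    by (simp add: char_std_normal_distribution)
  also have "\<bar>1 / e\<bar> *\<^sub>R (sqrt (2 * pi) *\<^sub>R complex_of_real (exp (- (z / e)\<^sup>2 / 2))) = complex_of_real (2 * pi * normal_density 0 e z)"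
  proof -
    have "sqrt (2 * pi * e\<^sup>2) = sqrt (2 * pi) * e" using e by (simp add: real_sqrt_mult)
    moreover have "sqrt (2 * pi) * sqrt (2 * pi) = 2 * pi" by simp
    ultimately have "1 / e * (sqrt (2 * pi) * exp (- (z / e)\<^sup>2 / 2)) = 2 * pi * normal_density 0 e z"
      using e unfolding normal_density_def
      by (simp only: power_divide) (simp add: field_simps)
    moreover have "\<bar>1 / e\<bar> *\<^sub>R (sqrt (2 * pi) *\<^sub>R complex_of_real (exp (- (z / e)\<^sup>2 / 2)))
        = complex_of_real (1 / e * (sqrt (2 * pi) * exp (- (z / e)\<^sup>2 / 2)))"
      using e by (simp add: scaleR_conv_of_real)
    ultimately show ?thesis by (simp only:)
  qed
  finally show ?thesis .
qed

definition gauss_kernel :: "real \<Rightarrow> 'a::euclidean_space \<Rightarrow> real" where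
  "gauss_kernel e z = (\<Prod>b\<in>Basis. normal_density 0 e (z \<bullet> b))"

lemma gauss_kernel_nonneg: "0 \<le> gauss_kernel e z"
  unfolding gauss_kernel_def by (intro prod_nonneg) auto

lemma gauss_kernel_measurable[measurable]: "gauss_kernel e \<in> borel_measurable borel"
  unfolding gauss_kernel_def[abs_def] by measurable

lemma
  assumes "0 < e"
  shows integrable_gauss_kernel: "integrable lborel (gauss_kernel e :: 'a::euclidean_space \<Rightarrow> real)"
    and integral_gauss_kernel: "(LINT z|lborel. gauss_kernel e (z :: 'a)) = 1"
proof -
  show "integrable lborel (gauss_kernel e :: 'a \<Rightarrow> real)"
    unfolding gauss_kernel_def[abs_def] using assms by (auto intro!: integrable_lborel_prod)
  show "(LINT z|lborel. gauss_kernel e (z :: 'a)) = 1"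
    unfolding gauss_kernel_def using assms
    by (subst integral_lborel_prod[where f = "\<lambda>_. normal_density 0 e"]) auto
qed

lemma gauss_kernel_scale:
  assumes e: "0 < e"
  shows "e ^ DIM('a) * gauss_kernel e (e *\<^sub>R w) = gauss_kernel 1 (w :: 'a::euclidean_space)"
proof -
  have "e * normal_density 0 e (e * t) = normal_density 0 1 t" for t
    using e by (simp add: normal_density_def real_sqrt_mult power_mult_distrib)
  then have "(\<Prod>b\<in>(Basis::'a set). e * normal_density 0 e ((e *\<^sub>R w) \<bullet> b)) = gauss_kernel 1 w"
    by (simp add: gauss_kernel_def)
  then show ?thesis by (simp add: gauss_kernel_def prod.distrib)
qed

lemma
  fixes z :: "'a::euclidean_space"
  assumes e: "0 < e"
  shows integrable_exp_norm_square: "integrable lborel (\<lambda>v::'a. exp (- (e * norm v)\<^sup>2 / 2))"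
    and fourier_gaussian: "(CLINT v|lborel. complex_of_real (exp (- (e * norm v)\<^sup>2 / 2)) * iexp (- (v \<bullet> z)))
     = complex_of_real ((2 * pi) ^ DIM('a) * gauss_kernel e z)"
proof -
  have s: "- (e * norm v)\<^sup>2 / 2 = (\<Sum>b\<in>Basis. - (e * (v \<bullet> b))\<^sup>2 / 2)" for v :: 'a
  proof -
    have "(norm v)\<^sup>2 = (\<Sum>b\<in>Basis. (v \<bullet> b)\<^sup>2)"
      by (subst power2_norm_eq_inner, subst euclidean_inner) (simp add: power2_eq_square)
    then show ?thesis by (simp add: power_mult_distrib sum_negf sum_divide_distrib sum_distrib_left)
  qed
  have p: "exp (- (e * norm v)\<^sup>2 / 2) = (\<Prod>b\<in>Basis. exp (- (e * (v \<bullet> b))\<^sup>2 / 2))" for v :: 'a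
    unfolding s by (simp add: exp_sum)
  show "integrable lborel (\<lambda>v::'a. exp (- (e * norm v)\<^sup>2 / 2))"
    unfolding p by (intro integrable_lborel_prod integrable_exp_square e)
  have "iexp (- (v \<bullet> z)) = (\<Prod>b\<in>Basis. iexp (- ((v \<bullet> b) * (z \<bullet> b))))" for v
    by (subst euclidean_inner) (simp add: exp_sum[symmetric] sum_negf sum_distrib_left)
  then have "(CLINT v|lborel. complex_of_real (exp (- (e * norm v)\<^sup>2 / 2)) * iexp (- (v \<bullet> z)))
     = (CLINT v|lborel. (\<Prod>b\<in>Basis. complex_of_real (exp (- (e * (v \<bullet> b))\<^sup>2 / 2)) * iexp (- ((v \<bullet> b) * (z \<bullet> b)))))"
    unfolding p by (simp add: prod.distrib)
  also have "\<dots> = (\<Prod>b\<in>Basis. complex_of_real (2 * pi * normal_density 0 e (z \<bullet> b)))"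
  proof (subst integral_lborel_prod[where f = "\<lambda>b t. complex_of_real (exp (- (e * t)\<^sup>2 / 2)) * iexp (- (t * (z \<bullet> b)))"])
    fix b :: 'a
    show "integrable lborel (\<lambda>t. complex_of_real (exp (- (e * t)\<^sup>2 / 2)) * iexp (- (t * (z \<bullet> b))))"
      by (rule Bochner_Integration.integrable_bound[OF integrable_exp_square[OF e]]) (auto simp: norm_mult)
  qed (simp only: fourier_gaussian_1[OF e])
  also have "\<dots> = complex_of_real ((2 * pi) ^ DIM('a) * gauss_kernel e z)"
    by (simp add: gauss_kernel_def prod.distrib)
  finally show "(CLINT v|lborel. complex_of_real (exp (- (e * norm v)\<^sup>2 / 2)) * iexp (- (v \<bullet> z)))
     = complex_of_real ((2 * pi) ^ DIM('a) * gauss_kernel e z)" .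
qed

definition mchar :: "'a::euclidean_space measure \<Rightarrow> 'a \<Rightarrow> complex" where
  "mchar M v = (CLINT x|M. iexp (v \<bullet> x))"

text \<open>
  The real part turns the inversion integral, which is real for the characteristic function of a
  measure, into a real-valued density.
\<close>

definition inverse_fourier :: "('a::euclidean_space \<Rightarrow> complex) \<Rightarrow> 'a \<Rightarrow> real" where
  "inverse_fourier g x = Re (CLINT v|lborel. iexp (- (v \<bullet> x)) * g v) / (2 * pi) ^ DIM('a)"

lemma continuous_inverse_fourier:
  fixes g :: "'a::euclidean_space \<Rightarrow> complex"
  assumes g: "integrable lborel g"
  shows "continuous_on UNIV (inverse_fourier g)"
proof -
  have [measurable]: "g \<in> borel_measurable borel" using g by auto
  have "(\<lambda>i. CLINT v|lborel. iexp (- (v \<bullet> u i)) * g v) \<longlonglongrightarrow> (CLINT v|lborel. iexp (- (v \<bullet> x)) * g v)"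
    if "u \<longlonglongrightarrow> x" for u x
  proof (rule integral_dominated_convergence[where w = "\<lambda>v. norm (g v)"])
    show "AE v in lborel. (\<lambda>i. iexp (- (v \<bullet> u i)) * g v) \<longlonglongrightarrow> iexp (- (v \<bullet> x)) * g v"
      using that by (intro AE_I2 tendsto_intros)
  qed (use g in \<open>auto simp: norm_mult\<close>)
  then have "isCont (inverse_fourier g) x" for x
    unfolding continuous_at_sequentially inverse_fourier_def[abs_def] comp_def
    by (auto intro!: tendsto_intros)
  then show ?thesis by (simp add: continuous_at_imp_continuous_on)
qed

text \<open>
  A Gaussian factor makes inversion an instance of Fubini; it corresponds to convolution of \<open>M\<close>
  with a normal law of standard deviation \<open>e\<close>.
\<close>

lemma inverse_fourier_smoothed:
  fixes M :: "'a::euclidean_space measure"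
  assumes M: "prob_space M" "sets M = sets borel" and e: "0 < e"
  shows "inverse_fourier (\<lambda>v. complex_of_real (exp (- (e * norm v)\<^sup>2 / 2)) * mchar M v) x
     = (LINT y|M. gauss_kernel e (x - y))"
proof -
  interpret prob_space M by fact
  interpret pair_sigma_finite lborel M ..
  have [measurable_cong]: "sets M = sets borel" by fact
  let ?g = "\<lambda>v. complex_of_real (exp (- (e * norm v)\<^sup>2 / 2))"
  have sub: "iexp (- (v \<bullet> x)) * (?g v * iexp (v \<bullet> y)) = ?g v * iexp (- (v \<bullet> (x - y)))" for v y
    by (simp add: inner_diff_right exp_add[symmetric] algebra_simps)
  have int: "integrable (lborel \<Otimes>\<^sub>M M) (\<lambda>(v, y). ?g v * iexp (- (v \<bullet> (x - y))))"
  proof (rule Fubini_integrable)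
    show "(\<lambda>(v, y). ?g v * iexp (- (v \<bullet> (x - y)))) \<in> borel_measurable (lborel \<Otimes>\<^sub>M M)" by measurable
    show "integrable lborel (\<lambda>v. LINT y|M. norm (case (v, y) of (v, y) \<Rightarrow> ?g v * iexp (- (v \<bullet> (x - y)))))"
      using integrable_exp_norm_square[OF e, where 'a='a] by (simp add: norm_mult prob_space)
    show "AE v in lborel. integrable M (\<lambda>y. case (v, y) of (v, y) \<Rightarrow> ?g v * iexp (- (v \<bullet> (x - y))))"
    proof (rule AE_I2)
      fix v :: 'a
      show "integrable M (\<lambda>y. case (v, y) of (v, y) \<Rightarrow> ?g v * iexp (- (v \<bullet> (x - y))))"
        by (rule integrable_const_bound[where B = "exp (- (e * norm v)\<^sup>2 / 2)"]) (auto simp: norm_mult)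
    qed
  qed
  have "(CLINT v|lborel. iexp (- (v \<bullet> x)) * (?g v * mchar M v))
    = (CLINT v|lborel. CLINT y|M. ?g v * iexp (- (v \<bullet> (x - y))))"
    unfolding sub[symmetric] mchar_def by simp
  also have "\<dots> = (CLINT y|M. CLINT v|lborel. ?g v * iexp (- (v \<bullet> (x - y))))"
    using Fubini_integral[OF int] by simp
  also have "\<dots> = (CLINT y|M. complex_of_real ((2 * pi) ^ DIM('a) * gauss_kernel e (x - y)))"
    by (simp only: fourier_gaussian[OF e])
  also have "\<dots> = complex_of_real ((2 * pi) ^ DIM('a) * (LINT y|M. gauss_kernel e (x - y)))"
    by (simp only: integral_complex_of_real integral_mult_right_zero)
  finally show ?thesis by (simp add: inverse_fourier_def)
qed

text \<open>
  After exchanging the integrals and substituting \<open>x = y + e w\<close> the kernel no longer depends on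
  \<open>e\<close>, so dominated convergence applies twice.
\<close>

lemma gauss_kernel_approximates_identity:
  fixes k :: "'a::euclidean_space \<Rightarrow> real"
  assumes M: "prob_space M" "sets M = sets borel"
    and k: "continuous_on UNIV k" "\<And>x. \<bar>k x\<bar> \<le> B" "integrable lborel k"
    and e: "\<And>m. 0 < e m" "e \<longlonglongrightarrow> 0"
  shows "(\<lambda>m. LINT x|lborel. k x * (LINT y|M. gauss_kernel (e m) (x - y))) \<longlonglongrightarrow> (LINT y|M. k y)"
proof -
  interpret prob_space M by fact
  interpret pair_sigma_finite lborel M ..
  have [measurable_cong]: "sets M = sets borel" by fact
  have [measurable]: "k \<in> borel_measurable borel" by (rule borel_measurable_continuous_onI) fact
  have eq: "(LINT x|lborel. k x * (LINT y|M. gauss_kernel (e m) (x - y)))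
      = (LINT y|M. LINT w|lborel. k (y + e m *\<^sub>R w) * gauss_kernel 1 w)" for m
  proof -
    have aff: "(LINT x|lborel. g x * gauss_kernel (e m) (x - y)) = (LINT w|lborel. g (y + e m *\<^sub>R w) * gauss_kernel 1 w)"
      if [measurable]: "g \<in> borel_measurable borel" for g :: "'a \<Rightarrow> real" and y
    proof -
      have "(LINT x|lborel. g x * gauss_kernel (e m) (x - y))
         = \<bar>e m\<bar> ^ DIM('a) *\<^sub>R (LINT w|lborel. g (y + e m *\<^sub>R w) * gauss_kernel (e m) (y + e m *\<^sub>R w - y))"
        using e(1)[of m] by (intro integral_lborel_affine) auto
      also have "\<dots> = (LINT w|lborel. g (y + e m *\<^sub>R w) * (e m ^ DIM('a) * gauss_kernel (e m) (e m *\<^sub>R w)))"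
        using e(1)[of m] unfolding integral_scaleR_right[symmetric] by (simp add: mult_ac)
      finally show ?thesis by (simp only: gauss_kernel_scale[OF e(1)])
    qed
    have int1: "(LINT x|lborel. gauss_kernel (e m) (x - y)) = 1" for y :: 'a
      using aff[of "\<lambda>_. 1" y] integral_gauss_kernel[where 'a='a, of 1] by simp
    have intk: "integrable lborel (\<lambda>x. gauss_kernel (e m) (x - y))" for y :: 'a
      using integrable_lborel_affine[of 1 "gauss_kernel (e m)" "- y"] integrable_gauss_kernel[where 'a='a, OF e(1)[of m]] by simp
    have int: "integrable (lborel \<Otimes>\<^sub>M M) (\<lambda>(x, y). k x * gauss_kernel (e m) (x - y))"
    proof -
      interpret swap: pair_sigma_finite M lborel ..
      have "integrable (M \<Otimes>\<^sub>M lborel) (\<lambda>(y, x). k x * gauss_kernel (e m) (x - y))"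
      proof (rule swap.Fubini_integrable)
        have bd: "integrable lborel (\<lambda>x. k x * gauss_kernel (e m) (x - y))" for y
          by (rule Bochner_Integration.integrable_bound[OF integrable_mult_right[OF intk[of y], of B]])
             (use k(2) in \<open>auto simp: abs_mult gauss_kernel_nonneg intro!: AE_I2 mult_right_mono order_trans[OF k(2)]\<close>)
        show "(\<lambda>(y, x). k x * gauss_kernel (e m) (x - y)) \<in> borel_measurable (M \<Otimes>\<^sub>M lborel)" by measurable
        show "AE y in M. integrable lborel (\<lambda>x. case (y, x) of (y, x) \<Rightarrow> k x * gauss_kernel (e m) (x - y))"
          using bd by auto
        show "integrable M (\<lambda>y. LINT x|lborel. norm (case (y, x) of (y, x) \<Rightarrow> k x * gauss_kernel (e m) (x - y)))"
        proof (rule integrable_const_bound[where B = B])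
          show "AE y in M. norm (LINT x|lborel. norm (case (y, x) of (y, x) \<Rightarrow> k x * gauss_kernel (e m) (x - y))) \<le> B"
          proof (rule AE_I2)
            fix y
            have "(LINT x|lborel. norm (k x * gauss_kernel (e m) (x - y))) \<le> (LINT x|lborel. B * gauss_kernel (e m) (x - y))"
              by (intro integral_mono integrable_norm bd integrable_mult_right intk)
                 (use k(2) in \<open>auto simp: abs_mult gauss_kernel_nonneg intro!: mult_right_mono\<close>)
            then show "norm (LINT x|lborel. norm (case (y, x) of (y, x) \<Rightarrow> k x * gauss_kernel (e m) (x - y))) \<le> B"
              by (simp add: int1)
          qed
        qed measurable
      qed
      then show ?thesis by (rule swap.integrable_product_swap[THEN Bochner_Integration.integrable_cong[THEN iffD1, rotated -1]]) auto
    qed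
    have "(LINT x|lborel. k x * (LINT y|M. gauss_kernel (e m) (x - y))) = (LINT x|lborel. LINT y|M. k x * gauss_kernel (e m) (x - y))"
      by simp
    also have "\<dots> = (LINT y|M. LINT x|lborel. k x * gauss_kernel (e m) (x - y))"
      using Fubini_integral[OF int] by simp
    also have "\<dots> = (LINT y|M. LINT w|lborel. k (y + e m *\<^sub>R w) * gauss_kernel 1 w)"
      by (simp add: aff)
    finally show ?thesis .
  qed
  have B: "0 \<le> B" using k(2)[of 0] by simp
  have bdw: "integrable lborel (\<lambda>w. B * gauss_kernel 1 (w::'a))" "(LINT w|lborel. B * gauss_kernel 1 (w::'a)) = B"
    using integrable_gauss_kernel[where 'a='a, of 1] integral_gauss_kernel[where 'a='a, of 1] by simp_all
  have ptw: "norm (k (y + e m *\<^sub>R w) * gauss_kernel 1 w) \<le> B * gauss_kernel 1 w" for y w m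
    using k(2) by (auto simp: abs_mult gauss_kernel_nonneg intro!: mult_right_mono)
  have inner: "(\<lambda>m. LINT w|lborel. k (y + e m *\<^sub>R w) * gauss_kernel 1 w) \<longlonglongrightarrow> k y" for y
  proof -
    have "(\<lambda>m. LINT w|lborel. k (y + e m *\<^sub>R w) * gauss_kernel 1 w) \<longlonglongrightarrow> (LINT w|lborel. k y * gauss_kernel 1 (w::'a))"
    proof (rule integral_dominated_convergence[where w = "\<lambda>w. B * gauss_kernel 1 (w::'a)"])
      show "AE w in lborel. (\<lambda>m. k (y + e m *\<^sub>R w) * gauss_kernel 1 w) \<longlonglongrightarrow> k y * gauss_kernel 1 w"
      proof (rule AE_I2)
        fix w
        have "(\<lambda>m. y + e m *\<^sub>R w) \<longlonglongrightarrow> y + 0 *\<^sub>R w" by (intro tendsto_intros e)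
        then have "(\<lambda>m. k (y + e m *\<^sub>R w)) \<longlonglongrightarrow> k y"
          using k(1) by (intro isCont_tendsto_compose[of y k]) (auto simp: continuous_on_eq_continuous_at)
        then show "(\<lambda>m. k (y + e m *\<^sub>R w) * gauss_kernel 1 w) \<longlonglongrightarrow> k y * gauss_kernel 1 w"
          by (intro tendsto_intros)
      qed
    qed (use bdw ptw in auto)
    then show ?thesis using integral_gauss_kernel[where 'a='a, of 1] by simp
  qed
  show ?thesis unfolding eq
  proof (rule integral_dominated_convergence[where w = "\<lambda>_. B"])
    show "AE y in M. norm (LINT w|lborel. k (y + e m *\<^sub>R w) * gauss_kernel 1 w) \<le> B" for m
    proof (rule AE_I2)
      fix y
      have "norm (LINT w|lborel. k (y + e m *\<^sub>R w) * gauss_kernel 1 w) \<le> (LINT w|lborel. B * gauss_kernel 1 (w::'a))"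
      proof (rule Bochner_Integration.integral_norm_bound_integral)
        show "integrable lborel (\<lambda>w. k (y + e m *\<^sub>R w) * gauss_kernel 1 w)"
          by (rule Bochner_Integration.integrable_bound[OF bdw(1)]) (use ptw in \<open>auto simp: B gauss_kernel_nonneg\<close>)
      qed (use bdw ptw in auto)
      then show "norm (LINT w|lborel. k (y + e m *\<^sub>R w) * gauss_kernel 1 w) \<le> B" by (simp only: bdw(2))
    qed
  qed (use inner in auto)
qed

text \<open>
  As the Gaussian smoothing is removed, the smoothed densities converge boundedly to
  \<open>inverse_fourier (mchar M)\<close>, while the smoothed measures converge weakly to \<open>M\<close>. Hence both
  measures give the same integral to every bounded continuous integrable function, and such
  functions increase to the indicator of a box.
\<close>

theorem fourier_inversion:
  fixes M :: "'a::euclidean_space measure"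
  assumes M: "prob_space M" "sets M = sets borel"
    and int: "integrable lborel (mchar M)"
  shows "0 \<le> inverse_fourier (mchar M) x"
    and "M = density lborel (\<lambda>x. ennreal (inverse_fourier (mchar M) x))"
proof -
  interpret prob_space M by fact
  have [measurable_cong]: "sets M = sets borel" by fact
  have [measurable]: "mchar M \<in> borel_measurable borel" using int by auto
  define e where "e m = 1 / real (Suc m)" for m
  have e: "0 < e m" "e \<longlonglongrightarrow> 0" for m
    unfolding e_def using LIMSEQ_inverse_real_of_nat by (auto simp: inverse_eq_divide)
  define p where "p = inverse_fourier (mchar M)"
  define pe where "pe m x = (LINT y|M. gauss_kernel (e m) (x - y))" for m x
  define C where "C = (LINT v|lborel. norm (mchar M v)) / (2 * pi) ^ DIM('a)"
  let ?g = "\<lambda>m v. complex_of_real (exp (- (e m * norm v)\<^sup>2 / 2)) * mchar M v"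
  have pe: "pe m x = inverse_fourier (?g m) x" for m x
    unfolding pe_def using inverse_fourier_smoothed[OF M e(1)] by simp
  have g_le: "norm (iexp (- (v \<bullet> x)) * ?g m v) \<le> norm (mchar M v)" for m x v
    by (simp add: norm_mult mult_left_le_one_le)
  have gint: "integrable lborel (\<lambda>v. iexp (- (v \<bullet> x)) * ?g m v)" for m x
    by (rule Bochner_Integration.integrable_bound[OF int]) (use g_le in auto)
  have lim: "(\<lambda>m. pe m x) \<longlonglongrightarrow> p x" for x
  proof -
    have "(\<lambda>m. CLINT v|lborel. iexp (- (v \<bullet> x)) * ?g m v) \<longlonglongrightarrow> (CLINT v|lborel. iexp (- (v \<bullet> x)) * mchar M v)"
    proof (rule integral_dominated_convergence[where w = "\<lambda>v. norm (mchar M v)"])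
      show "AE v in lborel. (\<lambda>m. iexp (- (v \<bullet> x)) * ?g m v) \<longlonglongrightarrow> iexp (- (v \<bullet> x)) * mchar M v"
      proof (rule AE_I2)
        fix v :: 'a
        have "(\<lambda>m. iexp (- (v \<bullet> x)) * ?g m v) \<longlonglongrightarrow> iexp (- (v \<bullet> x)) * (complex_of_real (exp (- (0 * norm v)\<^sup>2 / 2)) * mchar M v)"
          by (intro tendsto_intros e) auto
        then show "(\<lambda>m. iexp (- (v \<bullet> x)) * ?g m v) \<longlonglongrightarrow> iexp (- (v \<bullet> x)) * mchar M v" by simp
      qed
    qed (use int g_le in auto)
    then show ?thesis unfolding pe p_def inverse_fourier_def by (intro tendsto_intros) auto
  qed
  have pe_nn: "0 \<le> pe m x" for m x unfolding pe_def by (simp add: gauss_kernel_nonneg)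
  have pe_le: "pe m x \<le> C" for m x
  proof -
    have "Re (CLINT v|lborel. iexp (- (v \<bullet> x)) * ?g m v) \<le> norm (CLINT v|lborel. iexp (- (v \<bullet> x)) * ?g m v)"
      by (rule complex_Re_le_cmod)
    also have "\<dots> \<le> (LINT v|lborel. norm (mchar M v))"
      by (rule Bochner_Integration.integral_norm_bound_integral) (use gint int g_le in auto)
    finally show ?thesis unfolding pe inverse_fourier_def C_def by (intro divide_right_mono) auto
  qed
  have p_nn: "0 \<le> p x" for x by (rule LIMSEQ_le_const[OF lim]) (use pe_nn in auto)
  have p_le: "p x \<le> C" for x by (rule LIMSEQ_le_const2[OF lim]) (use pe_le in auto)
  show "0 \<le> inverse_fourier (mchar M) x" using p_nn by (simp add: p_def)
  have contp: "continuous_on UNIV p" unfolding p_def by (rule continuous_inverse_fourier[OF int])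
  have [measurable]: "p \<in> borel_measurable borel"
    by (rule borel_measurable_continuous_onI[OF contp])
  have [measurable]: "pe m \<in> borel_measurable borel" for m
    unfolding pe_def[abs_def] by measurable
  have test: "(LINT y|M. k y) = (LINT x|lborel. k x * p x)"
    if k: "continuous_on UNIV k" "\<And>x. \<bar>k x\<bar> \<le> B" "integrable lborel k" for k B
  proof (rule LIMSEQ_unique)
    show "(\<lambda>m. LINT x|lborel. k x * pe m x) \<longlonglongrightarrow> (LINT y|M. k y)"
      unfolding pe_def by (rule gauss_kernel_approximates_identity[OF M k e])
    have [measurable]: "k \<in> borel_measurable borel" using k(3) by auto
    show "(\<lambda>m. LINT x|lborel. k x * pe m x) \<longlonglongrightarrow> (LINT x|lborel. k x * p x)"
    proof (rule integral_dominated_convergence[where w = "\<lambda>x. norm (k x) * C"])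
      show "AE x in lborel. norm (k x * pe m x) \<le> norm (k x) * C" for m
        using pe_nn pe_le by (auto simp: abs_mult intro!: mult_left_mono AE_I2)
    qed (use k(3) lim in \<open>auto intro!: tendsto_intros\<close>)
  qed
  have box: "emeasure M (box a b) = emeasure (density lborel (\<lambda>x. ennreal (p x))) (box a b)" for a b
  proof -
    let ?B = "box a b"
    \<comment> \<open>continuous functions supported in the box and increasing to its indicator\<close>
    define k where "k m x = min 1 (real m * infdist x (- ?B))" for m x
    have ne: "- ?B \<noteq> {}" using bounded_box[of a b] by (metis Compl_eq_Diff_UNIV Diff_eq_empty_iff bounded_subset not_bounded_UNIV)
    have k01: "0 \<le> k m x" "k m x \<le> 1" for m x by (auto simp: k_def infdist_nonneg)
    have k0: "k m x = 0" if "x \<notin> ?B" for m x using that by (simp add: k_def)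
    have kind: "\<bar>k m x\<bar> \<le> indicator ?B x" for m x using k01 k0 by (auto simp: indicator_def)
    have kcont: "continuous_on UNIV (k m)" for m unfolding k_def by (intro continuous_intros)
    have [measurable]: "k m \<in> borel_measurable borel" for m by (rule borel_measurable_continuous_onI[OF kcont])
    have indint: "integrable lborel (indicator ?B :: 'a \<Rightarrow> real)"
      by (rule integrable_real_indicator) (use emeasure_lborel_box_finite[of a b] in auto)
    have kint: "integrable lborel (k m)" for m
      by (rule Bochner_Integration.integrable_bound[OF indint]) (use kind in auto)
    have klim: "(\<lambda>m. k m x) \<longlonglongrightarrow> indicator ?B x" for x
    proof (cases "x \<in> ?B")
      case True
      then have "infdist x (- ?B) \<noteq> 0"
        using in_closed_iff_infdist_zero[of "- ?B" x] ne by (auto simp: closed_def)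
      then have pos: "infdist x (- ?B) > 0" using infdist_nonneg[of x "- ?B"] by linarith
      obtain m0 where "1 / infdist x (- ?B) < real m0" using reals_Archimedean2 by blast
      then have "1 \<le> real m * infdist x (- ?B)" if "m \<ge> m0" for m
      proof -
        have "1 \<le> real m0 * infdist x (- ?B)" using \<open>1 / infdist x (- ?B) < real m0\<close> pos by (simp add: field_simps)
        also have "\<dots> \<le> real m * infdist x (- ?B)" using that pos by (intro mult_right_mono) auto
        finally show ?thesis .
      qed
      then have "\<forall>\<^sub>F m in sequentially. k m x = indicator ?B x"
        using True unfolding eventually_sequentially k_def by (intro exI[of _ m0]) auto
      then show ?thesis by (rule tendsto_eventually)
    qed (simp add: k0)
    have testk: "(LINT y|M. k m y) = (LINT x|lborel. k m x * p x)" for m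
    proof (rule test[OF kcont _ kint])
      show "\<bar>k m x\<bar> \<le> 1" for x using k01[of m x] by simp
    qed
    have "(\<lambda>m. LINT y|M. k m y) \<longlonglongrightarrow> (LINT y|M. indicator ?B y)"
      by (rule integral_dominated_convergence[where w = "\<lambda>_. 1"]) (use klim k01 in auto)
    moreover have "(\<lambda>m. LINT x|lborel. k m x * p x) \<longlonglongrightarrow> (LINT x|lborel. indicator ?B x * p x)"
    proof (rule integral_dominated_convergence[where w = "\<lambda>x. indicator ?B x * C"])
      show "AE x in lborel. norm (k m x * p x) \<le> indicator ?B x * C" for m
        using kind p_nn p_le by (auto simp: abs_mult intro!: mult_mono AE_I2)
    qed (use klim indint in \<open>auto intro!: tendsto_intros\<close>)
    ultimately have "(LINT y|M. indicator ?B y) = (LINT x|lborel. indicator ?B x * p x)"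
      unfolding testk by (rule LIMSEQ_unique)
    moreover have "(\<integral>\<^sup>+x. ennreal (indicator ?B x * p x) \<partial>lborel) = ennreal (LINT x|lborel. indicator ?B x * p x)"
    proof (rule nn_integral_eq_integral)
      show "integrable lborel (\<lambda>x. indicator ?B x * p x)"
        by (rule Bochner_Integration.integrable_bound[OF integrable_mult_left[OF indint, of C]])
           (use p_nn p_le in \<open>auto intro!: AE_I2 mult_left_mono simp: abs_mult order_trans[OF p_le]\<close>)
    qed (simp add: p_nn)
    ultimately have "ennreal (measure M ?B) = (\<integral>\<^sup>+x. ennreal (indicator ?B x * p x) \<partial>lborel)"
      by (simp add: M)
    also have "\<dots> = emeasure (density lborel (\<lambda>x. ennreal (p x))) ?B"
      by (auto simp: emeasure_density intro!: nn_integral_cong split: split_indicator)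
    finally show ?thesis by (simp add: emeasure_eq_measure)
  qed
  show "M = density lborel (\<lambda>x. ennreal (inverse_fourier (mchar M) x))"
    unfolding p_def[symmetric]
  proof (rule measure_eqI_generator_eq)
    let ?E = "range (\<lambda>(a, b). box a b::'a set)"
    show "Int_stable ?E" by (auto simp: Int_stable_def box_Int_box)
    show "?E \<subseteq> Pow UNIV" "sets M = sigma_sets UNIV ?E"
      "sets (density lborel (\<lambda>x. ennreal (p x))) = sigma_sets UNIV ?E"
      by (simp_all add: borel_eq_box M)
    let ?A = "\<lambda>n::nat. box (- (real n *\<^sub>R One)) (real n *\<^sub>R One) :: 'a set"
    show "range ?A \<subseteq> ?E" "(\<Union>i. ?A i) = UNIV" unfolding UN_box_eq_UNIV by auto
    show "emeasure M (?A i) \<noteq> \<infinity>" for i by simp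
    show "emeasure M X = emeasure (density lborel (\<lambda>x. ennreal (p x))) X" if "X \<in> ?E" for X
      using that box by auto
  qed
qed

section \<open>Exponential tilting\<close>

lemma abs_power_le_exp: "\<bar>x::real\<bar> ^ k \<le> fact k * (exp x + exp (- x))"
proof -
  obtain t where t: "exp \<bar>x\<bar> = (\<Sum>m<Suc k. \<bar>x\<bar> ^ m / fact m) + (exp t / fact (Suc k)) * \<bar>x\<bar> ^ Suc k"
    using Maclaurin_exp_le[of "\<bar>x\<bar>" "Suc k"] by blast
  have "\<bar>x\<bar> ^ k / fact k \<le> (\<Sum>m<Suc k. \<bar>x\<bar> ^ m / fact m)"
    by (simp add: sum_nonneg)
  also have "\<dots> \<le> exp \<bar>x\<bar>" unfolding t by simp
  also have "\<dots> \<le> exp x + exp (- x)" by (auto simp: abs_if)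
  finally show ?thesis by (simp add: field_simps)
qed

lemma exp_second_order:
  fixes x :: real
  shows "\<bar>exp x - 1 - x\<bar> \<le> x\<^sup>2 * exp \<bar>x\<bar>" and "x \<noteq> 0 \<Longrightarrow> 1 + x < exp x"
proof -
  have "\<exists>t. \<bar>t\<bar> \<le> \<bar>x\<bar> \<and> exp x = 1 + x + exp t / 2 * x\<^sup>2"
    using Maclaurin_exp_le[of x 2] by (auto simp: numeral_2_eq_2)
  then obtain t where t: "\<bar>t\<bar> \<le> \<bar>x\<bar>" "exp x = 1 + x + exp t / 2 * x\<^sup>2" by blast
  have "\<bar>exp x - 1 - x\<bar> = x\<^sup>2 * (exp t / 2)" unfolding t(2) by simp
  also have "\<dots> \<le> x\<^sup>2 * exp \<bar>x\<bar>"
  proof -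
    have "exp t \<le> exp \<bar>x\<bar>" using t(1) by simp
    then have "exp t / 2 \<le> exp \<bar>x\<bar>" using exp_gt_zero[of t] by linarith
    then show ?thesis by (intro mult_left_mono) auto
  qed
  finally show "\<bar>exp x - 1 - x\<bar> \<le> x\<^sup>2 * exp \<bar>x\<bar>" .
  assume "x \<noteq> 0"
  then have "exp t / 2 * x\<^sup>2 > 0" by simp
  then show "1 + x < exp x" unfolding t(2) by linarith
qed

text \<open>
  A small change \<open>h\<close> of the exponent absorbs the power, because
  \<open>|X|\<^sup>k \<le> k! h\<^sup>-\<^sup>k (exp (h X) + exp (- h X))\<close>.
\<close>

lemma integrable_power_exp:
  fixes w X :: "'a \<Rightarrow> real"
  assumes [measurable]: "w \<in> borel_measurable M" "X \<in> borel_measurable M"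
    and w: "\<And>x. 0 \<le> w x" and e: "0 < e"
    and int: "\<And>t. \<bar>t\<bar> < e \<Longrightarrow> integrable M (\<lambda>x. w x * exp (t * X x))"
    and t: "\<bar>t\<bar> < e"
  shows "integrable M (\<lambda>x. w x * \<bar>X x\<bar> ^ k * exp (t * X x))"
proof -
  define h where "h = (e - \<bar>t\<bar>) / 2"
  have h: "0 < h" "\<bar>t + h\<bar> < e" "\<bar>t - h\<bar> < e" using t unfolding h_def by (simp_all add: abs_if field_simps split: if_splits)
  have "integrable M (\<lambda>x. fact k / h ^ k * (w x * exp ((t + h) * X x) + w x * exp ((t - h) * X x)))"
    using int h by (intro integrable_mult_right Bochner_Integration.integrable_add) auto
  then show ?thesis
  proof (rule Bochner_Integration.integrable_bound)
    show "AE x in M. norm (w x * \<bar>X x\<bar> ^ k * exp (t * X x))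
       \<le> norm (fact k / h ^ k * (w x * exp ((t + h) * X x) + w x * exp ((t - h) * X x)))"
    proof (rule AE_I2)
      fix x
      have "h ^ k * \<bar>X x\<bar> ^ k \<le> fact k * (exp (h * X x) + exp (- (h * X x)))"
        using abs_power_le_exp[of "h * X x" k] h by (simp add: abs_mult power_mult_distrib)
      then have "\<bar>X x\<bar> ^ k \<le> fact k / h ^ k * (exp (h * X x) + exp (- (h * X x)))"
        using h by (simp add: field_simps)
      then have "w x * exp (t * X x) * \<bar>X x\<bar> ^ k \<le> w x * exp (t * X x) * (fact k / h ^ k * (exp (h * X x) + exp (- (h * X x))))"
        using w by (intro mult_left_mono) auto
      also have "\<dots> = fact k / h ^ k * (w x * exp ((t + h) * X x) + w x * exp ((t - h) * X x))"
        by (simp add: algebra_simps exp_add exp_diff exp_minus field_simps)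
      finally show "norm (w x * \<bar>X x\<bar> ^ k * exp (t * X x))
       \<le> norm (fact k / h ^ k * (w x * exp ((t + h) * X x) + w x * exp ((t - h) * X x)))"
        using w h by (simp add: abs_mult mult_ac)
    qed
  qed measurable
qed

lemma has_real_derivative_of_quadratic_error:
  fixes f :: "real \<Rightarrow> real"
  assumes "0 < e" and bd: "\<And>h. \<bar>h\<bar> < e \<Longrightarrow> \<bar>f (t + h) - f t - h * D\<bar> \<le> C * h\<^sup>2"
  shows "(f has_real_derivative D) (at t)"
proof -
  have "((\<lambda>h. (f (t + h) - f t) / h - D) \<longlongrightarrow> 0) (at 0)"
  proof (rule Lim_null_comparison)
    show "\<forall>\<^sub>F h in at 0. norm ((f (t + h) - f t) / h - D) \<le> \<bar>C\<bar> * \<bar>h\<bar>"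
      unfolding eventually_at
    proof (intro exI[of _ e] conjI ballI impI)
      fix h :: real assume h: "h \<noteq> 0 \<and> dist h 0 < e"
      then have "\<bar>f (t + h) - f t - h * D\<bar> \<le> \<bar>C\<bar> * h\<^sup>2"
        using order_trans[OF bd[of h] mult_right_mono[of C "\<bar>C\<bar>" "h\<^sup>2"]] by simp
      moreover have "f (t + h) - f t - h * D = h * ((f (t + h) - f t) / h - D)"
        using h unfolding right_diff_distrib by simp
      ultimately have "\<bar>h\<bar> * \<bar>(f (t + h) - f t) / h - D\<bar> \<le> \<bar>h\<bar> * (\<bar>C\<bar> * \<bar>h\<bar>)"
        by (simp add: abs_mult power2_eq_square mult_ac)
      then show "norm ((f (t + h) - f t) / h - D) \<le> \<bar>C\<bar> * \<bar>h\<bar>" using h by simp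
    qed (rule assms)
    show "((\<lambda>h. \<bar>C\<bar> * \<bar>h\<bar>) \<longlongrightarrow> 0) (at 0)"
      by (auto intro!: tendsto_eq_intros)
  qed
  then show ?thesis unfolding DERIV_def by (simp add: LIM_zero_iff)
qed

text \<open>
  Differentiation under the integral: by \<open>|exp x - 1 - x| \<le> x\<^sup>2 exp |x|\<close> the error of the
  linear approximation is at most \<open>u\<^sup>2\<close> times a fixed integral. The weight \<open>w\<close> will be
  \<open>exp (s \<bullet> y)\<close>, so that the lemma can be used along lines through \<open>s\<close>.
\<close>

lemma mgf_has_derivative:
  fixes w X :: "'a \<Rightarrow> real"
  assumes [measurable]: "w \<in> borel_measurable M" "X \<in> borel_measurable M"
    and w: "\<And>x. 0 \<le> w x" and e: "0 < e"
    and int: "\<And>t. \<bar>t\<bar> < e \<Longrightarrow> integrable M (\<lambda>x. w x * exp (t * X x))"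
    and t: "\<bar>t\<bar> < e"
  shows "((\<lambda>t. LINT x|M. w x * X x ^ k * exp (t * X x)) has_real_derivative
           (LINT x|M. w x * X x ^ Suc k * exp (t * X x))) (at t)"
proof -
  have intk: "integrable M (\<lambda>x. w x * \<bar>X x\<bar> ^ j * exp (u * X x))" if "\<bar>u\<bar> < e" for j u
    by (rule integrable_power_exp[OF assms(1-4) int that])
  have ints: "integrable M (\<lambda>x. w x * X x ^ j * exp (u * X x))" if "\<bar>u\<bar> < e" for j u
    by (rule Bochner_Integration.integrable_bound[OF intk[OF that, of j]]) (auto simp: abs_mult power_abs w)
  define h where "h = (e - \<bar>t\<bar>) / 2"
  have h: "0 < h" "\<bar>t + h\<bar> < e" "\<bar>t - h\<bar> < e" using t unfolding h_def by (simp_all add: abs_if field_simps split: if_splits)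
  \<comment> \<open>an integrable majorant of the second-order remainder, uniform for increments below \<open>h\<close>\<close>
  let ?G = "\<lambda>x. w x * \<bar>X x\<bar> ^ (k + 2) * exp ((t + h) * X x) + w x * \<bar>X x\<bar> ^ (k + 2) * exp ((t - h) * X x)"
  define C where "C = (LINT x|M. ?G x)"
  have G: "integrable M ?G" by (rule Bochner_Integration.integrable_add[OF intk[OF h(2)] intk[OF h(3)]])
  show ?thesis
  proof (rule has_real_derivative_of_quadratic_error[OF h(1), where C = C])
    fix u :: real assume u: "\<bar>u\<bar> < h"
    then have tu: "\<bar>t + u\<bar> < e" using h by (auto simp: h_def)
    let ?F = "\<lambda>x. w x * X x ^ k * exp ((t + u) * X x) - w x * X x ^ k * exp (t * X x) - u * (w x * X x ^ Suc k * exp (t * X x))"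
    have Fint: "integrable M ?F"
      by (rule Bochner_Integration.integrable_diff[OF
            Bochner_Integration.integrable_diff[OF ints[OF tu] ints[OF t]] integrable_mult_right[OF ints[OF t]]])
    have eq: "(LINT x|M. w x * X x ^ k * exp ((t + u) * X x)) - (LINT x|M. w x * X x ^ k * exp (t * X x))
       - u * (LINT x|M. w x * X x ^ Suc k * exp (t * X x)) = (LINT x|M. ?F x)"
    proof -
      have "(LINT x|M. F x) - (LINT x|M. G x) - u * (LINT x|M. K x) = (LINT x|M. F x - G x - u * K x)"
        if "integrable M F" "integrable M G" "integrable M K" for F G K :: "'a \<Rightarrow> real"
        using that by simp
      from this[OF ints[OF tu] ints[OF t] ints[OF t]] show ?thesis .
    qed
    have "\<bar>LINT x|M. ?F x\<bar> \<le> (LINT x|M. \<bar>?F x\<bar>)" by (rule integral_abs_bound)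
    also have "\<dots> \<le> (LINT x|M. u\<^sup>2 * ?G x)"
    proof (rule integral_mono)
      fix x
      have "?F x = w x * X x ^ k * exp (t * X x) * (exp (u * X x) - 1 - u * X x)"
        by (simp add: algebra_simps exp_add)
      then have "\<bar>?F x\<bar> = w x * \<bar>X x\<bar> ^ k * exp (t * X x) * \<bar>exp (u * X x) - 1 - u * X x\<bar>"
        by (simp add: abs_mult power_abs w)
      also have "\<dots> \<le> w x * \<bar>X x\<bar> ^ k * exp (t * X x) * ((u * X x)\<^sup>2 * exp \<bar>u * X x\<bar>)"
        using exp_second_order(1)[of "u * X x"] w by (intro mult_left_mono) auto
      also have "\<dots> \<le> w x * \<bar>X x\<bar> ^ k * exp (t * X x) * ((u * X x)\<^sup>2 * (exp (h * X x) + exp (- (h * X x))))"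
      proof -
        have "\<bar>u * X x\<bar> \<le> \<bar>h * X x\<bar>" using u h by (auto simp: abs_mult intro!: mult_right_mono)
        then have "exp \<bar>u * X x\<bar> \<le> exp \<bar>h * X x\<bar>" by simp
        also have "\<dots> \<le> exp (h * X x) + exp (- (h * X x))" by (auto simp: abs_if)
        finally show ?thesis using w by (intro mult_left_mono) auto
      qed
      also have "\<dots> = u\<^sup>2 * ?G x"
      proof -
        have E: "exp ((t + h) * X x) = exp (t * X x) * exp (h * X x)" "exp ((t - h) * X x) = exp (t * X x) * exp (- (h * X x))"
          by (simp_all add: exp_add[symmetric] algebra_simps)
        have K: "\<bar>X x\<bar> ^ (k + 2) = \<bar>X x\<bar> ^ k * (X x)\<^sup>2" by (simp add: power_add power2_eq_square)
        show ?thesis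
          unfolding E K by (simp only: power_mult_distrib distrib_left distrib_right mult_ac)
      qed
      finally show "\<bar>?F x\<bar> \<le> u\<^sup>2 * ?G x" .
    qed (use Fint G in auto)
    also have "\<dots> = C * u\<^sup>2" by (simp add: C_def)
    finally show "\<bar>(LINT x|M. w x * X x ^ k * exp ((t + u) * X x)) - (LINT x|M. w x * X x ^ k * exp (t * X x))
       - u * (LINT x|M. w x * X x ^ Suc k * exp (t * X x))\<bar> \<le> C * u\<^sup>2" unfolding eq .
  qed
qed

definition mgf_domain :: "'a::euclidean_space measure \<Rightarrow> 'a set" where
  "mgf_domain M = {s. integrable M (\<lambda>y. exp (s \<bullet> y))}"

definition mgf :: "'a::euclidean_space measure \<Rightarrow> 'a \<Rightarrow> real" where
  "mgf M s = (LINT y|M. exp (s \<bullet> y))"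

definition tilt :: "'a::euclidean_space measure \<Rightarrow> 'a \<Rightarrow> 'a measure" where
  "tilt M s = density M (\<lambda>y. ennreal (exp (s \<bullet> y) / mgf M s))"

locale euclidean_law = prob_space M for M :: "'a::euclidean_space measure" +
  assumes sets_M[measurable_cong]: "sets M = sets borel"
begin

lemma mgf_pos: "s \<in> mgf_domain M \<Longrightarrow> 0 < mgf M s"
proof -
  assume "s \<in> mgf_domain M"
  then have int: "integrable M (\<lambda>y. exp (s \<bullet> y))" by (simp add: mgf_domain_def)
  have "mgf M s \<noteq> 0"
    using integral_nonneg_eq_0_iff_AE[OF int] by (auto simp: mgf_def emeasure_space_1 AE_False)
  moreover have "0 \<le> mgf M s" unfolding mgf_def by simp
  ultimately show ?thesis by simp
qed

lemma sets_tilt[measurable_cong]: "sets (tilt M s) = sets borel"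
  by (simp add: tilt_def sets_M)

lemma
  fixes g :: "'a \<Rightarrow> 'b::{banach, second_countable_topology}"
  assumes s: "s \<in> mgf_domain M" and [measurable]: "g \<in> borel_measurable borel"
  shows integrable_tilt: "integrable (tilt M s) g \<longleftrightarrow> integrable M (\<lambda>y. exp (s \<bullet> y) *\<^sub>R g y)"
    and integral_tilt: "(LINT y|tilt M s. g y) = (LINT y|M. exp (s \<bullet> y) *\<^sub>R g y) /\<^sub>R mgf M s"
proof -
  have m: "0 < mgf M s" by (rule mgf_pos[OF s])
  have eq: "(exp (s \<bullet> y) / mgf M s) *\<^sub>R g y = inverse (mgf M s) *\<^sub>R (exp (s \<bullet> y) *\<^sub>R g y)" for y
    by (simp add: divide_inverse)
  have "integrable (tilt M s) g \<longleftrightarrow> integrable M (\<lambda>y. inverse (mgf M s) *\<^sub>R (exp (s \<bullet> y) *\<^sub>R g y))"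
    unfolding tilt_def eq[symmetric] using m by (intro integrable_density) auto
  also have "\<dots> \<longleftrightarrow> integrable M (\<lambda>y. exp (s \<bullet> y) *\<^sub>R g y)"
  proof
    assume "integrable M (\<lambda>y. inverse (mgf M s) *\<^sub>R (exp (s \<bullet> y) *\<^sub>R g y))"
    then have "integrable M (\<lambda>y. mgf M s *\<^sub>R (inverse (mgf M s) *\<^sub>R (exp (s \<bullet> y) *\<^sub>R g y)))"
      by (rule integrable_scaleR_right)
    then show "integrable M (\<lambda>y. exp (s \<bullet> y) *\<^sub>R g y)" using m by (simp add: mult.assoc[symmetric])
  qed (rule integrable_scaleR_right)
  finally show "integrable (tilt M s) g \<longleftrightarrow> integrable M (\<lambda>y. exp (s \<bullet> y) *\<^sub>R g y)" .
  have "(LINT y|tilt M s. g y) = (LINT y|M. inverse (mgf M s) *\<^sub>R (exp (s \<bullet> y) *\<^sub>R g y))"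
    unfolding tilt_def eq[symmetric] using m by (intro integral_density) auto
  then show "(LINT y|tilt M s. g y) = (LINT y|M. exp (s \<bullet> y) *\<^sub>R g y) /\<^sub>R mgf M s"
    by (simp only: integral_scaleR_right)
qed

lemma euclidean_law_tilt:
  assumes s: "s \<in> mgf_domain M"
  shows "euclidean_law (tilt M s)"
proof -
  have m: "0 < mgf M s" by (rule mgf_pos[OF s])
  have int: "integrable M (\<lambda>y. exp (s \<bullet> y) / mgf M s)" using s by (simp add: mgf_domain_def)
  have "emeasure (tilt M s) (space (tilt M s)) = (\<integral>\<^sup>+y. ennreal (exp (s \<bullet> y) / mgf M s) \<partial>M)"
    by (simp add: tilt_def emeasure_density cong: nn_integral_cong)
  also have "\<dots> = ennreal (LINT y|M. exp (s \<bullet> y) / mgf M s)"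
    using m by (intro nn_integral_eq_integral[OF int]) auto
  also have "\<dots> = 1" using m by (simp add: mgf_def)
  finally have "prob_space (tilt M s)" by (rule prob_spaceI)
  then show ?thesis by (simp add: euclidean_law_def euclidean_law_axioms_def sets_tilt)
qed

lemma mchar_tilt:
  assumes "s \<in> mgf_domain M"
  shows "mchar (tilt M s) v = (CLINT y|M. exp (s \<bullet> y) *\<^sub>R iexp (v \<bullet> y)) / complex_of_real (mgf M s)"
  unfolding mchar_def by (subst integral_tilt[OF assms]) (auto simp: scaleR_conv_of_real divide_inverse)

lemma mgf_domain_line:
  assumes s: "s \<in> interior (mgf_domain M)"
  obtains e where "0 < e" "\<And>t. \<bar>t\<bar> < e \<Longrightarrow> s + t *\<^sub>R v \<in> mgf_domain M"
proof -
  obtain r where r: "0 < r" "ball s r \<subseteq> mgf_domain M"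
    using s by (auto simp: mem_interior)
  show ?thesis
  proof (rule that[of "r / (norm v + 1)"])
    show "0 < r / (norm v + 1)" using r by (intro divide_pos_pos) (auto intro: add_nonneg_pos)
    fix t :: real assume "\<bar>t\<bar> < r / (norm v + 1)"
    moreover have "0 < norm v + 1" using norm_ge_zero[of v] by linarith
    ultimately have "\<bar>t\<bar> * (norm v + 1) < r" by (simp only: pos_less_divide_eq)
    then have "norm (t *\<^sub>R v) < r" using abs_ge_zero[of t] by (simp add: distrib_left)
    then show "s + t *\<^sub>R v \<in> mgf_domain M" using r(2) by (auto simp: dist_norm)
  qed
qed

lemma
  assumes s: "s \<in> interior (mgf_domain M)"
  shows integrable_inner_power: "integrable M (\<lambda>y. exp (s \<bullet> y) * (v \<bullet> y) ^ k)"
    and mgf_line_derivative: "((\<lambda>t. LINT y|M. exp ((s + t *\<^sub>R v) \<bullet> y) * (v \<bullet> y) ^ k) has_real_derivative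
           (LINT y|M. exp (s \<bullet> y) * (v \<bullet> y) ^ Suc k)) (at 0)"
proof -
  obtain e where e: "0 < e" "\<And>t. \<bar>t\<bar> < e \<Longrightarrow> s + t *\<^sub>R v \<in> mgf_domain M"
    using mgf_domain_line[OF s] by blast
  have eq: "exp ((s + t *\<^sub>R v) \<bullet> y) = exp (s \<bullet> y) * exp (t * (v \<bullet> y))" for t y
    by (simp add: inner_add_left exp_add)
  have int: "integrable M (\<lambda>y. exp (s \<bullet> y) * exp (t * (v \<bullet> y)))" if "\<bar>t\<bar> < e" for t
    using e(2)[OF that] by (simp add: mgf_domain_def eq)
  have [measurable]: "(\<lambda>y. exp (s \<bullet> y)) \<in> borel_measurable M" "(\<lambda>y. v \<bullet> y) \<in> borel_measurable M"
    by measurable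
  have "integrable M (\<lambda>y. exp (s \<bullet> y) * \<bar>v \<bullet> y\<bar> ^ k * exp (0 * (v \<bullet> y)))"
    using e(1) int by (intro integrable_power_exp) auto
  then show "integrable M (\<lambda>y. exp (s \<bullet> y) * (v \<bullet> y) ^ k)"
    by (rule Bochner_Integration.integrable_bound) (auto simp: abs_mult power_abs)
  have "((\<lambda>t. LINT y|M. exp (s \<bullet> y) * (v \<bullet> y) ^ k * exp (t * (v \<bullet> y))) has_real_derivative
           (LINT y|M. exp (s \<bullet> y) * (v \<bullet> y) ^ Suc k * exp (0 * (v \<bullet> y)))) (at 0)"
    using e(1) int by (intro mgf_has_derivative) auto
  then show "((\<lambda>t. LINT y|M. exp ((s + t *\<^sub>R v) \<bullet> y) * (v \<bullet> y) ^ k) has_real_derivative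
           (LINT y|M. exp (s \<bullet> y) * (v \<bullet> y) ^ Suc k)) (at 0)"
    by (simp add: eq mult_ac)
qed

text \<open>
  If \<open>v \<bullet> y\<close> is almost surely constant, the characteristic function has modulus \<open>1\<close> at \<open>v\<close>.
  Through this remark the decay condition supplies strict convexity of the cumulant generating
  function.
\<close>

lemma not_AE_degenerate:
  assumes char: "norm (mchar M v) < 1"
  shows "\<not> (AE y in M. v \<bullet> (y - c) = 0)"
proof
  assume "AE y in M. v \<bullet> (y - c) = 0"
  then have ae: "AE y in M. v \<bullet> y = v \<bullet> c" by (simp add: inner_diff_right)
  have "mchar M v = (CLINT y|M. iexp (v \<bullet> c))"
    unfolding mchar_def using ae by (intro integral_cong_AE) auto
  also have "\<dots> = iexp (v \<bullet> c)" by (simp add: prob_space)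
  finally show False using char by simp
qed

lemma variance_pos:
  assumes "norm (mchar M v) < 1" and int: "integrable M (\<lambda>y. (v \<bullet> (y - c))\<^sup>2)"
  shows "0 < (LINT y|M. (v \<bullet> (y - c))\<^sup>2)"
proof -
  have "(LINT y|M. (v \<bullet> (y - c))\<^sup>2) \<noteq> 0"
    using integral_nonneg_eq_0_iff_AE[OF int] not_AE_degenerate[OF assms(1), of c] by auto
  then show ?thesis by (simp add: less_le)
qed

text \<open>
  Under the law tilted by \<open>s\<close> the variable \<open>W = (u - s) \<bullet> (y - c)\<close> has mean \<open>0\<close> and is not
  almost surely \<open>0\<close>. Hence the expectation of \<open>exp W - 1 - W\<close> is positive, and the expectation of
  \<open>exp W\<close> is \<open>exp (- (u - s) \<bullet> c) mgf u / mgf s\<close>.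
\<close>

lemma tilted_mean_strict_minimum:
  assumes s: "s \<in> mgf_domain M" and u: "u \<in> mgf_domain M" "u \<noteq> s"
    and mean: "integrable M (\<lambda>y. exp (s \<bullet> y) * ((u - s) \<bullet> y))"
              "(LINT y|M. exp (s \<bullet> y) * ((u - s) \<bullet> y)) = mgf M s * ((u - s) \<bullet> c)"
    and char: "norm (mchar (tilt M s) (u - s)) < 1"
  shows "ln (mgf M s) - s \<bullet> c < ln (mgf M u) - u \<bullet> c"
proof -
  interpret Q: euclidean_law "tilt M s" by (rule euclidean_law_tilt[OF s])
  have ms: "0 < mgf M s" and mu: "0 < mgf M u" using mgf_pos s u by auto
  define W where "W y = (u - s) \<bullet> (y - c)" for y
  have [measurable]: "W \<in> borel_measurable borel" unfolding W_def by measurable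
  have expW: "exp (s \<bullet> y) * exp (W y) = exp (- ((u - s) \<bullet> c)) * exp (u \<bullet> y)" for y
    by (simp add: W_def inner_diff_left inner_diff_right exp_add[symmetric])
  have ie: "integrable M (\<lambda>y. exp (s \<bullet> y))" "integrable M (\<lambda>y. exp (u \<bullet> y))"
    using s u by (auto simp: mgf_domain_def)
  have I1: "integrable (tilt M s) (\<lambda>y. exp (W y))"
    using ie by (subst integrable_tilt[OF s]) (auto simp: expW)
  have E1: "(LINT y|tilt M s. exp (W y)) = exp (- ((u - s) \<bullet> c)) * mgf M u / mgf M s"
  proof (subst integral_tilt[OF s])
    have "(LINT y|M. exp (s \<bullet> y) *\<^sub>R exp (W y)) = exp (- ((u - s) \<bullet> c)) * mgf M u"
      by (simp add: expW mgf_def)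
    then show "(LINT y|M. exp (s \<bullet> y) *\<^sub>R exp (W y)) /\<^sub>R mgf M s = exp (- ((u - s) \<bullet> c)) * mgf M u / mgf M s"
      by (simp add: divide_inverse mult.commute)
  qed measurable
  have sW: "exp (s \<bullet> y) * W y = exp (s \<bullet> y) * ((u - s) \<bullet> y) - exp (s \<bullet> y) * ((u - s) \<bullet> c)" for y
    by (simp add: W_def inner_diff_right right_diff_distrib)
  have I2: "integrable (tilt M s) W"
    using ie mean(1) by (subst integrable_tilt[OF s]) (auto simp: sW intro!: Bochner_Integration.integrable_diff)
  have "(LINT y|M. exp (s \<bullet> y) * W y) = mgf M s * ((u - s) \<bullet> c) - mgf M s * ((u - s) \<bullet> c)"
    unfolding sW using ie mean by (subst Bochner_Integration.integral_diff) (auto simp: mgf_def)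
  then have E2: "(LINT y|tilt M s. W y) = 0"
    by (subst integral_tilt[OF s]) auto
  have I: "integrable (tilt M s) (\<lambda>y. exp (W y) - 1 - W y)"
    using I1 I2 by (intro Bochner_Integration.integrable_diff) auto
  have nn: "0 \<le> exp (W y) - 1 - W y" for y using exp_ge_add_one_self[of "W y"] by linarith
  have "(LINT y|tilt M s. exp (W y) - 1 - W y) \<noteq> 0"
  proof
    assume "(LINT y|tilt M s. exp (W y) - 1 - W y) = 0"
    then have "AE y in tilt M s. exp (W y) - 1 - W y = 0"
      using integral_nonneg_eq_0_iff_AE[OF I] nn by auto
    then have "AE y in tilt M s. (u - s) \<bullet> (y - c) = 0"
    proof (rule AE_mp, intro AE_I2 impI)
      fix y assume "exp (W y) - 1 - W y = 0"
      then show "(u - s) \<bullet> (y - c) = 0" using exp_second_order(2)[of "W y"] by (cases "W y = 0") (auto simp: W_def)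
    qed
    then show False using Q.not_AE_degenerate[OF char] by blast
  qed
  moreover have "0 \<le> (LINT y|tilt M s. exp (W y) - 1 - W y)" by (rule Bochner_Integration.integral_nonneg) (rule nn)
  moreover have "(LINT y|tilt M s. exp (W y) - 1 - W y) = (LINT y|tilt M s. exp (W y)) - 1"
    using I1 I2 E2 Q.prob_space by simp
  ultimately have "1 < exp (- ((u - s) \<bullet> c)) * mgf M u / mgf M s" unfolding E1 by linarith
  then have "mgf M s < exp (- ((u - s) \<bullet> c)) * mgf M u" using ms by (simp add: field_simps)
  then have "ln (mgf M s) < ln (exp (- ((u - s) \<bullet> c)) * mgf M u)" using ms mu by simp
  also have "\<dots> = - ((u - s) \<bullet> c) + ln (mgf M u)" using mu by (simp add: ln_mult)
  finally show ?thesis by (simp add: inner_diff_left)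
qed

text \<open>
  Bounding the moment by the moment generating function at the two points \<open>s \<plusminus> h v\<close> makes the
  bound continuous in all parameters, hence uniform along a convergent sequence of tilts.
\<close>

lemma tilted_third_moment:
  assumes s: "s \<in> mgf_domain M" and h: "0 < h"
    and dom: "s + h *\<^sub>R v \<in> mgf_domain M" "s - h *\<^sub>R v \<in> mgf_domain M"
  shows "integrable (tilt M s) (\<lambda>y. \<bar>v \<bullet> (y - c)\<bar> ^ 3)"
    and "(LINT y|tilt M s. \<bar>v \<bullet> (y - c)\<bar> ^ 3) \<le>
      6 / h ^ 3 * (mgf M (s + h *\<^sub>R v) * exp (- (h * (v \<bullet> c))) + mgf M (s - h *\<^sub>R v) * exp (h * (v \<bullet> c))) / mgf M s"
proof -
  have ms: "0 < mgf M s" using mgf_pos s by auto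
  let ?G = "\<lambda>y. 6 / h ^ 3 * (exp ((s + h *\<^sub>R v) \<bullet> y) * exp (- (h * (v \<bullet> c))) + exp ((s - h *\<^sub>R v) \<bullet> y) * exp (h * (v \<bullet> c)))"
  have G: "integrable M ?G"
    using dom by (intro integrable_mult_right Bochner_Integration.integrable_add integrable_mult_left) (auto simp: mgf_domain_def)
  have le: "exp (s \<bullet> y) * \<bar>v \<bullet> (y - c)\<bar> ^ 3 \<le> ?G y" for y
  proof -
    let ?w = "v \<bullet> (y - c)"
    have "h ^ 3 * \<bar>?w\<bar> ^ 3 \<le> 6 * (exp (h * ?w) + exp (- (h * ?w)))"
      using abs_power_le_exp[of "h * ?w" 3] h by (simp add: abs_mult power_mult_distrib fact_numeral)
    then have "\<bar>?w\<bar> ^ 3 \<le> 6 / h ^ 3 * (exp (h * ?w) + exp (- (h * ?w)))"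
      using h by (simp add: field_simps)
    then have "exp (s \<bullet> y) * \<bar>?w\<bar> ^ 3 \<le> exp (s \<bullet> y) * (6 / h ^ 3 * (exp (h * ?w) + exp (- (h * ?w))))"
      by (intro mult_left_mono) auto
    also have "\<dots> = 6 / h ^ 3 * (exp (s \<bullet> y) * exp (h * ?w) + exp (s \<bullet> y) * exp (- (h * ?w)))"
      by (simp only: distrib_left mult_ac)
    also have "\<dots> = ?G y"
      unfolding exp_add[symmetric] by (simp add: inner_add_left inner_diff_left inner_diff_right algebra_simps)
    finally show ?thesis .
  qed
  have int: "integrable M (\<lambda>y. exp (s \<bullet> y) * \<bar>v \<bullet> (y - c)\<bar> ^ 3)"
    by (rule Bochner_Integration.integrable_bound[OF G]) (use le h in \<open>auto simp: abs_mult abs_of_nonneg\<close>)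
  then show "integrable (tilt M s) (\<lambda>y. \<bar>v \<bullet> (y - c)\<bar> ^ 3)"
    by (subst integrable_tilt[OF s]) auto
  have "(LINT y|tilt M s. \<bar>v \<bullet> (y - c)\<bar> ^ 3) = (LINT y|M. exp (s \<bullet> y) * \<bar>v \<bullet> (y - c)\<bar> ^ 3) / mgf M s"
    by (subst integral_tilt[OF s]) (auto simp: divide_inverse mult.commute)
  also have "\<dots> \<le> (LINT y|M. ?G y) / mgf M s"
    using ms by (intro divide_right_mono integral_mono int G le) auto
  also have "(LINT y|M. ?G y) = 6 / h ^ 3 * (mgf M (s + h *\<^sub>R v) * exp (- (h * (v \<bullet> c))) + mgf M (s - h *\<^sub>R v) * exp (h * (v \<bullet> c)))"
    unfolding mgf_def using dom by (simp add: mgf_domain_def)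
  finally show "(LINT y|tilt M s. \<bar>v \<bullet> (y - c)\<bar> ^ 3) \<le>
      6 / h ^ 3 * (mgf M (s + h *\<^sub>R v) * exp (- (h * (v \<bullet> c))) + mgf M (s - h *\<^sub>R v) * exp (h * (v \<bullet> c))) / mgf M s" .
qed

end

text \<open>
  The central limit theorem for characteristic functions with an explicit error, so that it can be
  applied to laws that change with \<open>n\<close>. Comparing with \<open>exp (- \<sigma> / (2 n))\<close> rather than
  \<open>1 - \<sigma> / (2 n)\<close> makes the \<open>n\<close>-th power of the approximation exact.
\<close>

lemma char_power_estimate:
  fixes W :: "'a \<Rightarrow> real"
  assumes "prob_space Q" and W[measurable]: "W \<in> borel_measurable Q"
    and int3: "integrable Q (\<lambda>x. \<bar>W x\<bar> ^ 3)" and mean: "(LINT x|Q. W x) = 0" and n: "0 < n"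
  shows "norm ((CLINT x|Q. iexp (W x / sqrt (real n))) ^ n - complex_of_real (exp (- (LINT x|Q. (W x)\<^sup>2) / 2)))
     \<le> (LINT x|Q. \<bar>W x\<bar> ^ 3) / sqrt (real n) + (LINT x|Q. (W x)\<^sup>2)\<^sup>2 / real n"
proof -
  interpret prob_space Q by fact
  define \<sigma> where "\<sigma> = (LINT x|Q. (W x)\<^sup>2)"
  define R where "R = (LINT x|Q. \<bar>W x\<bar> ^ 3)"
  have I: "integrable Q (\<lambda>x. 1 + \<bar>W x\<bar> ^ 3)" using int3 by simp
  have le1: "\<bar>a\<bar> \<le> 1 + \<bar>a\<bar> ^ 3" and le2: "a\<^sup>2 \<le> 1 + \<bar>a\<bar> ^ 3" for a :: real
  proof -
    show "\<bar>a\<bar> \<le> 1 + \<bar>a\<bar> ^ 3"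
    proof (cases "\<bar>a\<bar> \<le> 1")
      case False then have "\<bar>a\<bar> ^ 1 \<le> \<bar>a\<bar> ^ 3" by (intro power_increasing) auto
      then show ?thesis by simp
    qed (simp add: add_increasing2)
    have "\<bar>a\<bar>\<^sup>2 \<le> 1 + \<bar>a\<bar> ^ 3"
    proof (cases "\<bar>a\<bar> \<le> 1")
      case False then have "\<bar>a\<bar> ^ 2 \<le> \<bar>a\<bar> ^ 3" by (intro power_increasing) auto
      then show ?thesis by simp
    next
      case True
      then have "\<bar>a\<bar>\<^sup>2 \<le> 1" by (intro power_le_one) auto
      then show ?thesis by (simp add: add_increasing2)
    qed
    then show "a\<^sup>2 \<le> 1 + \<bar>a\<bar> ^ 3" by simp
  qed
  have i1: "integrable Q W" by (rule Bochner_Integration.integrable_bound[OF I]) (use le1 in \<open>auto simp: abs_of_nonneg\<close>)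
  have i2: "integrable Q (\<lambda>x. (W x)\<^sup>2)" by (rule Bochner_Integration.integrable_bound[OF I]) (use le2 in \<open>auto simp: abs_of_nonneg\<close>)
  have var: "variance W = \<sigma>" by (simp add: mean \<sigma>_def)
  define t where "t = 1 / sqrt (real n)"
  have t: "0 < t" "t\<^sup>2 = 1 / real n" using n by (auto simp: t_def power_divide)
  define z where "z = char (distr Q borel W) t"
  have z: "z = (CLINT x|Q. iexp (W x / sqrt (real n)))"
    unfolding z_def char_def t_def by (subst integral_distr) auto
  define w where "w = complex_of_real (exp (- (\<sigma> / (2 * real n))))"
  have \<sigma>: "0 \<le> \<sigma>" by (simp add: \<sigma>_def)
  have "cmod (z - (1 - t\<^sup>2 * \<sigma> / 2)) \<le> (t\<^sup>2 / 6) * expectation (\<lambda>x. min (6 * (W x)\<^sup>2) (\<bar>t\<bar> * \<bar>W x\<bar> ^ 3))"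
    unfolding z_def by (rule char_approx3'[OF W i1 i2 mean var refl])
  also have "expectation (\<lambda>x. min (6 * (W x)\<^sup>2) (\<bar>t\<bar> * \<bar>W x\<bar> ^ 3)) \<le> expectation (\<lambda>x. \<bar>t\<bar> * \<bar>W x\<bar> ^ 3)"
    using i2 int3 by (intro integral_mono integrable_min) auto
  also have "\<dots> = t * R" using t by (simp add: R_def)
  finally have 1: "cmod (z - (1 - t\<^sup>2 * \<sigma> / 2)) \<le> t\<^sup>2 / 6 * (t * R)" by (simp add: divide_right_mono mult_left_mono)
  define a where "a = \<sigma> / (2 * real n)"
  have a: "0 \<le> a" "t\<^sup>2 * \<sigma> / 2 = a" using \<sigma> t by (auto simp: a_def)
  have 2: "\<bar>exp (- a) - (1 - a)\<bar> \<le> a\<^sup>2"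
  proof -
    have ge: "0 \<le> exp (- a) - (1 - a)" using exp_ge_add_one_self[of "- a"] by simp
    have "exp (- a) * (1 + a) \<le> exp (- a) * exp a" by (intro mult_left_mono) auto
    then have "exp (- a) * (1 + a) \<le> 1" by (simp add: exp_minus)
    moreover have "(1 - a + a\<^sup>2) * (1 + a) = 1 + a ^ 3" by (simp add: power2_eq_square power3_eq_cube algebra_simps)
    moreover have "0 \<le> a ^ 3" using a(1) by simp
    ultimately have "exp (- a) * (1 + a) \<le> (1 - a + a\<^sup>2) * (1 + a)" by linarith
    then have "exp (- a) \<le> 1 - a + a\<^sup>2" using a(1) by (simp add: mult_le_cancel_right)
    then show ?thesis using ge by simp
  qed
  have "cmod (z - w) \<le> cmod (z - (1 - t\<^sup>2 * \<sigma> / 2)) + cmod (complex_of_real (1 - t\<^sup>2 * \<sigma> / 2 - exp (- a)))"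
    using norm_triangle_ineq[of "z - (1 - t\<^sup>2 * \<sigma> / 2)" "complex_of_real (1 - t\<^sup>2 * \<sigma> / 2 - exp (- a))"]
    by (simp add: w_def a_def)
  also have "\<dots> \<le> t\<^sup>2 / 6 * (t * R) + a\<^sup>2"
    using 1 2 unfolding norm_of_real a(2) by linarith
  finally have zw: "cmod (z - w) \<le> t\<^sup>2 / 6 * (t * R) + a\<^sup>2" .
  have R: "0 \<le> R" by (simp add: R_def)
  interpret D: real_distribution "distr Q borel W" by (rule real_distribution_distr) simp
  have "norm (z ^ n - w ^ n) \<le> n * norm (z - w)"
    unfolding w_def using \<sigma> D.cmod_char_le_1[of t] by (intro norm_power_diff) (auto simp: z_def)
  also have "\<dots> \<le> n * (t\<^sup>2 / 6 * (t * R) + a\<^sup>2)" by (intro mult_left_mono zw) auto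
  also have "\<dots> = R / sqrt (real n) / 6 + \<sigma>\<^sup>2 / real n / 4"
    using n by (simp add: t(2) a_def distrib_left power_divide) (simp add: t_def power2_eq_square)
  also have "\<dots> \<le> R / sqrt (real n) + \<sigma>\<^sup>2 / real n"
  proof -
    have pq: "p / 6 + q / 4 \<le> p + q" if "0 \<le> p" "0 \<le> q" for p q :: real using that by linarith
    show ?thesis by (rule pq) (use R in simp_all)
  qed
  finally have "norm (z ^ n - w ^ n) \<le> R / sqrt (real n) + \<sigma>\<^sup>2 / real n" .
  moreover have "w ^ n = complex_of_real (exp (- \<sigma> / 2))"
    unfolding w_def of_real_power[symmetric] exp_of_nat_mult[symmetric] using n by simp
  ultimately show ?thesis by (simp add: z \<sigma>_def R_def)
qed

text \<open>
  Bernoulli's inequality applied to the quotient \<open>1 + a\<close> of two consecutive bases.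
\<close>

lemma mono_one_plus_divide_power:
  fixes x :: real
  assumes x: "0 \<le> x" and N: "0 < N" "N \<le> n"
  shows "(1 + x / real N) ^ N \<le> (1 + x / real n) ^ n"
  using N(2)
proof (induction n rule: dec_induct)
  case (step n)
  then have n: "0 < real n" using N(1) by simp
  define a where "a = - x / (real (Suc n) * (real n + x))"
  have nx: "0 < real n + x" using n x by simp
  have a1: "-1 \<le> a"
  proof -
    have "0 \<le> real n * (real n + x)" using n nx by simp
    then have "x \<le> real (Suc n) * (real n + x)" using n by (simp add: distrib_right)
    moreover have "0 < real (Suc n) * (real n + x)" using nx by simp
    ultimately have "x / (real (Suc n) * (real n + x)) \<le> 1" by (simp only: pos_divide_le_eq mult_1)
    then show ?thesis by (simp add: a_def)
  qed
  have "1 + real (Suc n) * a \<le> (1 + a) ^ Suc n" by (rule Bernoulli_inequality[OF a1])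
  moreover have "1 + real (Suc n) * a = real n / (real n + x)"
  proof -
    have "m * (c / (m * b)) = c / b" if "m \<noteq> 0" for b c m :: real using that by simp
    from this[of "real (Suc n)"] have "real (Suc n) * a = - x / (real n + x)"
      unfolding a_def using of_nat_neq_0 by blast
    then show ?thesis using nx by (simp add: field_simps)
  qed
  ultimately have 1: "real n / (real n + x) \<le> (1 + a) ^ Suc n" by simp
  have 2: "(1 + x / real n) * (1 + a) = 1 + x / real (Suc n)"
  proof -
    have "b * (c / (m * b)) = c / m" if "b \<noteq> 0" for b c m :: real using that by simp
    from this[of "real n + x"] have "(real n + x) * a = - x / real (Suc n)" using nx unfolding a_def by auto
    then have "(real n + x) * (1 + a) = real n + x - x / real (Suc n)" by (simp add: distrib_left)
    also have "\<dots> = real n * (1 + x / real (Suc n))" by (simp add: field_simps)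
    finally have "(real n + x) * (1 + a) / real n = 1 + x / real (Suc n)" using n by simp
    then show ?thesis using n by (simp add: field_simps)
  qed
  have "(1 + x / real n) ^ n = (1 + x / real n) ^ Suc n * (real n / (real n + x))"
  proof -
    have "(1 + x / real n) * (real n / (real n + x)) = 1"
    proof -
      have "1 + x / real n = (real n + x) / real n" using n by (simp add: add_divide_distrib)
      then show ?thesis using n nx by simp
    qed
    then have "(1 + x / real n) ^ n * ((1 + x / real n) * (real n / (real n + x))) = (1 + x / real n) ^ n"
      by (simp only: mult_1_right)
    then show ?thesis by (simp only: power_Suc mult_ac)
  qed
  also have "\<dots> \<le> (1 + x / real n) ^ Suc n * (1 + a) ^ Suc n"
    using 1 x by (intro mult_left_mono) auto
  also have "\<dots> = (1 + x / real (Suc n)) ^ Suc n"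
    unfolding power_mult_distrib[symmetric] 2 ..
  finally show ?case using step by linarith
qed simp

definition decay_majorant :: "real \<Rightarrow> 'a::euclidean_space \<Rightarrow> real" where
  "decay_majorant q v = (\<Prod>b\<in>Basis. inverse (1 + q * (v \<bullet> b)\<^sup>2))"

lemma integrable_decay_majorant:
  assumes q: "0 < q" shows "integrable lborel (decay_majorant q :: 'a::euclidean_space \<Rightarrow> real)"
  unfolding decay_majorant_def[abs_def]
proof (rule integrable_lborel_prod)
  have "integrable lborel (\<lambda>x::real. inverse (1 + x\<^sup>2))"
    using integrable_inverse_1_plus_square by (simp add: set_integrable_def einterval_def)
  then have "integrable lborel (\<lambda>x::real. inverse (1 + (0 + sqrt q *\<^sub>R x)\<^sup>2))"
    using q by (intro integrable_lborel_affine) auto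
  then show "integrable lborel (\<lambda>x::real. inverse (1 + q * x\<^sup>2))"
    using q by (simp add: power_mult_distrib)
qed

text \<open>
  The base \<open>(1 + d |v|\<^sup>2 / n)\<^sup>n\<close> increases with \<open>n\<close>, so the bound for \<open>n\<close> is at most the one
  for \<open>N\<close>, where the total exponent \<open>d N\<close> has reached the dimension; one factor is then
  available for every coordinate, and the product is integrable by Fubini.
\<close>

lemma decay_power_le_majorant:
  fixes v :: "'a::euclidean_space"
  assumes d: "0 < d" and N: "0 < N" "real DIM('a) \<le> d * real N" "N \<le> n"
  shows "((1 + d * (norm (v /\<^sub>R sqrt (real n)))\<^sup>2) powr (- d)) ^ n \<le> decay_majorant (d / real N) v"
proof -
  have n: "0 < n" using N by simp
  define x where "x = d * (norm v)\<^sup>2"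
  have x: "0 \<le> x" using d by (simp add: x_def)
  have base: "1 \<le> 1 + x / real k" for k using x by simp
  have "d * (norm (v /\<^sub>R sqrt (real n)))\<^sup>2 = x / real n"
    using n by (simp add: x_def power_mult_distrib divide_inverse power_inverse)
  then have "((1 + d * (norm (v /\<^sub>R sqrt (real n)))\<^sup>2) powr (- d)) ^ n = ((1 + x / real n) ^ n) powr (- d)"
    using base[of n] by (simp add: powr_power powr_realpow[symmetric] powr_powr mult_ac del: powr_realpow')
  also have "\<dots> \<le> ((1 + x / real N) ^ N) powr (- d)"
    using mono_one_plus_divide_power[OF x N(1,3)] d base[of N] by (intro powr_mono2') (auto intro!: zero_less_power)
  also have "\<dots> = (1 + x / real N) powr (- (d * real N))"
    using base[of N] by (simp add: powr_realpow[symmetric] powr_powr mult_ac)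
  also have "\<dots> \<le> (1 + x / real N) powr (- real DIM('a))"
    using N base[of N] by (intro powr_mono) auto
  also have "\<dots> = (\<Prod>b\<in>(Basis::'a set). inverse (1 + x / real N))"
    using base[of N] by (simp add: powr_minus powr_realpow power_inverse)
  also have "\<dots> \<le> decay_majorant (d / real N) v"
    unfolding decay_majorant_def
  proof (rule prod_mono)
    fix b :: 'a assume b: "b \<in> Basis"
    have "(v \<bullet> b)\<^sup>2 \<le> (norm v)\<^sup>2" using Basis_le_norm[OF b, of v] by (simp add: abs_le_square_iff[symmetric])
    then have "d / real N * (v \<bullet> b)\<^sup>2 \<le> x / real N" using d by (simp add: x_def divide_right_mono)
    then show "0 \<le> inverse (1 + x / real N) \<and> inverse (1 + x / real N) \<le> inverse (1 + d / real N * (v \<bullet> b)\<^sup>2)"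
      using base[of N] d by (auto intro!: le_imp_inverse_le add_pos_nonneg)
  qed
  finally show ?thesis .
qed

section \<open>Partial minimisation and Laplace asymptotics\<close>

lemma pos_def_coercive:
  fixes A :: "real^'n^'n"
  assumes pos: "\<And>v. v \<noteq> 0 \<Longrightarrow> 0 < v \<bullet> (A *v v)"
  obtains \<alpha> where "0 < \<alpha>" "\<And>v. \<alpha> * (norm v)\<^sup>2 \<le> v \<bullet> (A *v v)"
proof -
  have "compact (sphere (0 :: real^'n) 1)" by simp
  moreover have "axis undefined 1 \<in> sphere (0 :: real^'n) 1" by simp
  then have "sphere (0 :: real^'n) 1 \<noteq> {}" by blast
  moreover have "continuous_on (sphere 0 1) (\<lambda>v. v \<bullet> (A *v v))" by (intro continuous_intros)
  ultimately obtain x where x: "x \<in> sphere 0 1" "\<And>y. y \<in> sphere 0 1 \<Longrightarrow> x \<bullet> (A *v x) \<le> y \<bullet> (A *v y)"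
    using continuous_attains_inf[of "sphere (0 :: real^'n) 1" "\<lambda>v. v \<bullet> (A *v v)"] by blast
  show ?thesis
  proof (rule that)
    show "0 < x \<bullet> (A *v x)" using x(1) by (intro pos) auto
    show "x \<bullet> (A *v x) * (norm v)\<^sup>2 \<le> v \<bullet> (A *v v)" for v
    proof (cases "v = 0")
      case False
      let ?u = "v /\<^sub>R norm v"
      have "x \<bullet> (A *v x) * (norm v)\<^sup>2 \<le> ?u \<bullet> (A *v ?u) * (norm v)\<^sup>2"
        using False by (intro mult_right_mono x(2)) auto
      also have "\<dots> = v \<bullet> (A *v v)"
        using False by (simp add: matrix_vector_mult_scaleR power2_eq_square field_simps)
      finally show ?thesis .
    qed simp
  qed
qed

lemma pos_def_matrix_inv:
  fixes A :: "real^'n^'n"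
  assumes sym: "transpose A = A" and pos: "\<And>v. v \<noteq> 0 \<Longrightarrow> 0 < v \<bullet> (A *v v)"
  shows "A ** matrix_inv A = mat 1"
proof -
  have "invertible A" using det_pos_def[OF assms] by (simp add: invertible_det_nz)
  then have "\<exists>B. A ** B = mat 1 \<and> B ** A = mat 1" by (simp add: invertible_def)
  then have "A ** matrix_inv A = mat 1 \<and> matrix_inv A ** A = mat 1"
    unfolding matrix_inv_def by (rule someI_ex)
  then show ?thesis by blast
qed

text \<open>
  The quadratic form in \<open>a\<close> is minimal at \<open>- N B w\<close>, and its minimum is the Schur complement.
\<close>

lemma complete_the_square:
  fixes A :: "real^'d^'d" and B :: "real^'p^'d" and D :: "real^'p^'p"
  assumes sym: "transpose A = A" and inv: "A ** N = mat 1"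
  shows "a \<bullet> (A *v a) + 2 * (a \<bullet> (B *v w)) + w \<bullet> (D *v w)
       = (a + N *v (B *v w)) \<bullet> (A *v (a + N *v (B *v w))) + w \<bullet> ((D - transpose B ** N ** B) *v w)"
proof -
  let ?b = "B *v w"
  have AN: "A *v (N *v ?b) = ?b" using matrix_vector_mul_assoc[of A N "B *v w"] by (simp only: inv matrix_vector_mul_lid)
  have 1: "(N *v ?b) \<bullet> (A *v a) = a \<bullet> ?b"
    using symmetric_matrix_inner[OF sym, of "N *v ?b" a] by (simp add: AN)
  have "(transpose B ** N ** B) *v w = transpose B *v (N *v ?b)"
    by (simp only: matrix_vector_mul_assoc matrix_mul_assoc)
  then have "w \<bullet> ((transpose B ** N ** B) *v w) = w \<bullet> ((N *v ?b) v* B)" by simp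
  also have "\<dots> = ((N *v ?b) v* B) \<bullet> w" by (rule inner_commute)
  also have "\<dots> = (N *v ?b) \<bullet> ?b" by (rule dot_lmul_matrix)
  finally have 2: "w \<bullet> ((transpose B ** N ** B) *v w) = (N *v ?b) \<bullet> ?b" .
  have 3: "(D - transpose B ** N ** B) *v w = D *v w - (transpose B ** N ** B) *v w"
    by (simp add: matrix_vector_mult_diff_rdistrib)
  show ?thesis
    unfolding matrix_vector_right_distrib AN 3 inner_diff_right 2
    by (simp add: inner_add_left inner_add_right 1)
qed

text \<open>
  The argument compares values of \<open>F\<close> instead of differentiating \<open>\<sigma>\<close>. Let \<open>b = - A\<close> inverse \<open>B w\<close> and
  \<open>v = \<sigma> (\<theta>0 + w) - s0 - b\<close>. Comparing with \<open>F (s0 + b, \<theta>0 + w)\<close> gives the upper bound.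
  By Taylor's formula and completion of the square the same comparison bounds \<open>\<alpha> |v|\<^sup>2\<close> by a small
  multiple of \<open>|v|\<^sup>2 + |w|\<^sup>2\<close>, whence \<open>|v| = O(|w|)\<close>; the Taylor error at the minimiser
  is therefore \<open>o(|w|\<^sup>2)\<close> too, and dropping the nonnegative square gives the lower bound.
\<close>

theorem partial_minimum_expansion:
  fixes F :: "(real^'d) \<times> (real^'p) \<Rightarrow> real" and A :: "real^'d^'d" and B :: "real^'p^'d" and D :: "real^'p^'p"
  assumes sym: "transpose A = A" and pos: "\<And>v. v \<noteq> 0 \<Longrightarrow> 0 < v \<bullet> (A *v v)"
    and taylor: "\<And>e. 0 < e \<Longrightarrow> \<exists>r>0. \<forall>a w. norm (a, w) < r \<longrightarrow>
      \<bar>F (s0 + a, \<theta>0 + w) - F (s0, \<theta>0) - (a \<bullet> (A *v a) + 2 * (a \<bullet> (B *v w)) + w \<bullet> (D *v w)) / 2\<bar>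
        \<le> e * ((norm a)\<^sup>2 + (norm w)\<^sup>2)"
    and cont: "(\<sigma> \<longlongrightarrow> s0) (nhds \<theta>0)"
    and r0: "0 < r0" and min: "\<And>s \<theta>. norm (s - s0, \<theta> - \<theta>0) < r0 \<Longrightarrow> F (\<sigma> \<theta>, \<theta>) \<le> F (s, \<theta>)"
    and e: "0 < e"
  shows "\<exists>r>0. \<forall>w. norm w < r \<longrightarrow>
     \<bar>F (\<sigma> (\<theta>0 + w), \<theta>0 + w) - F (s0, \<theta>0) - w \<bullet> ((D - transpose B ** matrix_inv A ** B) *v w) / 2\<bar> \<le> e * (norm w)\<^sup>2"
proof -
  let ?N = "matrix_inv A" and ?H = "D - transpose B ** matrix_inv A ** B"
  have inv: "A ** ?N = mat 1" by (rule pos_def_matrix_inv[OF sym pos])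
  obtain \<alpha> where \<alpha>: "0 < \<alpha>" "\<And>v. \<alpha> * (norm v)\<^sup>2 \<le> v \<bullet> (A *v v)" using pos_def_coercive[OF pos] by blast
  obtain l where l: "0 \<le> l" "\<And>w. norm (?N *v (B *v w)) \<le> l * norm w"
  proof -
    have "bounded_linear (\<lambda>w. ?N *v (B *v w))"
      by (intro bounded_linear_compose[OF matrix_vector_mul_bounded_linear matrix_vector_mul_bounded_linear])
    then obtain K where "0 \<le> K" "\<And>w. norm (?N *v (B *v w)) \<le> norm w * K"
      using bounded_linear.nonneg_bounded by blast
    then show ?thesis using that[of K] by (simp add: mult.commute)
  qed
  \<comment> \<open>\<open>\<alpha> / 8\<close> lets the error be absorbed by \<open>\<alpha> |v|\<^sup>2 / 2\<close>; the factor \<open>5 l\<^sup>2 + 3\<close>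
    is the bound for \<open>|a|\<^sup>2 + |w|\<^sup>2\<close> relative to \<open>|w|\<^sup>2\<close> that results\<close>
  define \<epsilon> where "\<epsilon> = min (\<alpha> / 8) (e / (5 * l\<^sup>2 + 3))"
  have l3: "0 < 5 * l\<^sup>2 + 3" by (intro add_nonneg_pos) auto
  have \<epsilon>: "0 < \<epsilon>" "\<epsilon> \<le> \<alpha> / 8" "\<epsilon> * (5 * l\<^sup>2 + 3) \<le> e"
  proof -
    have "\<epsilon> \<le> e / (5 * l\<^sup>2 + 3)" by (simp add: \<epsilon>_def)
    then show "\<epsilon> * (5 * l\<^sup>2 + 3) \<le> e" using l3 by (simp only: pos_le_divide_eq)
    show "0 < \<epsilon>" using \<alpha> e l3 by (simp add: \<epsilon>_def)
    show "\<epsilon> \<le> \<alpha> / 8" unfolding \<epsilon>_def by (rule min.cobounded1)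
  qed
  obtain r1 where r1: "0 < r1" and T: "\<And>a w. norm (a, w) < r1 \<Longrightarrow>
      \<bar>F (s0 + a, \<theta>0 + w) - F (s0, \<theta>0) - (a \<bullet> (A *v a) + 2 * (a \<bullet> (B *v w)) + w \<bullet> (D *v w)) / 2\<bar>
        \<le> \<epsilon> * ((norm a)\<^sup>2 + (norm w)\<^sup>2)"
    using taylor[OF \<epsilon>(1)] by blast
  have "\<forall>\<^sub>F \<theta> in nhds \<theta>0. dist (\<sigma> \<theta>) s0 < r1 / 2" using tendstoD[OF cont, of "r1 / 2"] r1 by simp
  then obtain r2 where r2: "0 < r2" "\<And>\<theta>. dist \<theta> \<theta>0 < r2 \<Longrightarrow> dist (\<sigma> \<theta>) s0 < r1 / 2"
    unfolding eventually_nhds_metric by blast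
  \<comment> \<open>the last term keeps the comparison point \<open>(b, w)\<close> within reach of Taylor's formula and of minimality\<close>
  define r where "r = min (min r2 (r1 / 2)) (min r0 r1 / (l + 1))"
  have "0 < min r0 r1 / (l + 1)" using r0 r1 l by (intro divide_pos_pos) auto
  then have rpos: "0 < r" using r1 r2 by (auto simp: r_def)
  show ?thesis
  proof (intro exI[of _ r] conjI allI impI rpos)
    fix w :: "real^'p" assume w: "norm w < r"
    define a where "a = \<sigma> (\<theta>0 + w) - s0"
    define b where "b = - (?N *v (B *v w))"
    define v where "v = a - b"
    define W where "W = (norm w)\<^sup>2"
    have nb: "norm b \<le> l * norm w" using l(2) by (simp add: b_def)
    have "norm w * (l + 1) < min r0 r1" using w l by (simp add: r_def pos_less_divide_eq)
    then have lw: "norm w + l * norm w < min r0 r1" by (simp add: algebra_simps)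
    have nbw: "norm (b, w) < min r0 r1"
      using order_trans[OF norm_Pair_le add_right_mono[OF nb, of "norm w"]] lw by linarith
    have na: "norm a < r1 / 2" using r2(2)[of "\<theta>0 + w"] w by (simp add: a_def dist_norm r_def)
    have naw: "norm (a, w) < r1"
      using norm_Pair_le[of a w] na w by (simp add: r_def)
    let ?f = "F (\<sigma> (\<theta>0 + w), \<theta>0 + w) - F (s0, \<theta>0)"
    let ?q = "w \<bullet> (?H *v w)"
    have sq_a: "a \<bullet> (A *v a) + 2 * (a \<bullet> (B *v w)) + w \<bullet> (D *v w) = v \<bullet> (A *v v) + ?q"
      using complete_the_square[OF sym inv, of a B w D] by (simp add: v_def b_def)
    have sq_b: "b \<bullet> (A *v b) + 2 * (b \<bullet> (B *v w)) + w \<bullet> (D *v w) = ?q"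
      using complete_the_square[OF sym inv, of b B w D] by (simp add: b_def)
    have b2: "(norm b)\<^sup>2 \<le> l\<^sup>2 * W"
      using power_mono[OF nb, of 2] by (simp add: W_def power_mult_distrib)
    have a2: "(norm a)\<^sup>2 \<le> 2 * (norm v)\<^sup>2 + 2 * l\<^sup>2 * W"
    proof -
      have "norm a \<le> norm v + norm b" using norm_triangle_ineq[of v b] by (simp add: v_def)
      then have "(norm a)\<^sup>2 \<le> (norm v + norm b)\<^sup>2" by (intro power_mono) auto
      also have "\<dots> \<le> 2 * (norm v)\<^sup>2 + 2 * (norm b)\<^sup>2"
        using sum_squares_bound[of "norm v" "norm b"] by (simp add: power2_sum)
      finally show ?thesis using b2 by simp
    qed
    have "F (\<sigma> (\<theta>0 + w), \<theta>0 + w) \<le> F (s0 + b, \<theta>0 + w)"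
      using nbw by (intro min) auto
    moreover have "\<bar>F (s0 + b, \<theta>0 + w) - F (s0, \<theta>0) - ?q / 2\<bar> \<le> \<epsilon> * ((norm b)\<^sup>2 + W)"
      using T[of b w] nbw unfolding sq_b W_def by simp
    ultimately have up: "?f - ?q / 2 \<le> \<epsilon> * ((norm b)\<^sup>2 + W)" by linarith
    also have "\<dots> \<le> \<epsilon> * ((l\<^sup>2 + 1) * W)"
      using b2 \<epsilon> by (intro mult_left_mono) (auto simp: algebra_simps)
    finally have up': "?f - ?q / 2 \<le> \<epsilon> * ((l\<^sup>2 + 1) * W)" .
    have low: "\<bar>?f - (v \<bullet> (A *v v) + ?q) / 2\<bar> \<le> \<epsilon> * ((norm a)\<^sup>2 + W)"
      using T[OF naw] unfolding sq_a W_def by (simp add: a_def)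
    have W: "0 \<le> W" by (simp add: W_def)
    have aW: "\<epsilon> * ((norm a)\<^sup>2 + W) \<le> \<epsilon> * (2 * (norm v)\<^sup>2 + (2 * l\<^sup>2 + 1) * W)"
      using a2 \<epsilon> by (intro mult_left_mono) (auto simp: algebra_simps)
    have "\<alpha> * (norm v)\<^sup>2 / 2 \<le> \<epsilon> * (2 * (norm v)\<^sup>2 + (2 * l\<^sup>2 + 1) * W) + \<epsilon> * ((l\<^sup>2 + 1) * W)"
    proof -
      have "k / 2 \<le> A' + C" if "\<bar>x - (p + q) / 2\<bar> \<le> A" "x - q / 2 \<le> C" "A \<le> A'" "k \<le> p" for k A A' C x p q :: real
        using that by (simp add: abs_le_iff field_simps)
      from this[OF low up' aW \<alpha>(2)[of v]] show ?thesis .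
    qed
    also have "\<dots> = 2 * \<epsilon> * (norm v)\<^sup>2 + \<epsilon> * ((3 * l\<^sup>2 + 2) * W)" by (simp add: algebra_simps)
    also have "\<dots> \<le> \<alpha> / 4 * (norm v)\<^sup>2 + \<alpha> / 8 * ((3 * l\<^sup>2 + 2) * W)"
      using \<epsilon> W by (intro add_mono mult_right_mono) auto
    finally have "\<alpha> * (2 * (norm v)\<^sup>2) \<le> \<alpha> * ((3 * l\<^sup>2 + 2) * W)" by (simp add: algebra_simps)
    then have v2: "2 * (norm v)\<^sup>2 \<le> (3 * l\<^sup>2 + 2) * W" using \<alpha>(1) by simp
    have aW': "\<epsilon> * ((norm a)\<^sup>2 + W) \<le> \<epsilon> * ((5 * l\<^sup>2 + 3) * W)"
      using a2 v2 \<epsilon> by (intro mult_left_mono) (auto simp: algebra_simps)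
    have vAv: "0 \<le> v \<bullet> (A *v v)" using \<alpha>(2)[of v] \<alpha>(1) by (meson less_imp_le mult_nonneg_nonneg order_trans zero_le_power2)
    have lo: "- (\<epsilon> * ((5 * l\<^sup>2 + 3) * W)) \<le> ?f - ?q / 2"
    proof -
      have "- A' \<le> x - q / 2" if "\<bar>x - (p + q) / 2\<bar> \<le> A" "0 \<le> p" "A \<le> A'" for A A' x p q :: real
        using that by (simp add: abs_le_iff field_simps)
      from this[OF low vAv aW'] show ?thesis .
    qed
    have "(l\<^sup>2 + 1) * W \<le> (5 * l\<^sup>2 + 3) * W" using W by (intro mult_right_mono) auto
    then have "\<epsilon> * ((l\<^sup>2 + 1) * W) \<le> \<epsilon> * ((5 * l\<^sup>2 + 3) * W)" using \<epsilon> by (intro mult_left_mono) auto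
    then have "\<bar>?f - ?q / 2\<bar> \<le> \<epsilon> * ((5 * l\<^sup>2 + 3) * W)" using lo up' by linarith
    also have "\<dots> \<le> e * W" using mult_right_mono[OF \<epsilon>(3) W] by (simp add: mult_ac)
    finally show "\<bar>?f - ?q / 2\<bar> \<le> e * (norm w)\<^sup>2" by (simp add: W_def)
  qed
qed

lemma quadratic_expansion_scaled_limit:
  fixes h :: "real^'p \<Rightarrow> real" and H :: "real^'p^'p"
  assumes exp: "\<And>e. 0 < e \<Longrightarrow> \<exists>r>0. \<forall>w. norm w < r \<longrightarrow> \<bar>h (\<theta>0 + w) - h \<theta>0 - w \<bullet> (H *v w) / 2\<bar> \<le> e * (norm w)\<^sup>2"
  shows "(\<lambda>n. real n * (h (\<theta>0 + u /\<^sub>R sqrt (real n)) - h \<theta>0)) \<longlonglongrightarrow> u \<bullet> (H *v u) / 2"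
proof (rule LIMSEQ_I)
  fix e :: real assume e: "0 < e"
  define e' where "e' = e / (2 * ((norm u)\<^sup>2 + 1))"
  have u1: "0 < (norm u)\<^sup>2 + 1" by (intro add_nonneg_pos) auto
  have e': "0 < e'" "e' * (norm u)\<^sup>2 < e"
  proof -
    show "0 < e'" using e u1 by (simp add: e'_def)
    then have "e' * (norm u)\<^sup>2 \<le> e' * ((norm u)\<^sup>2 + 1)" by (intro mult_left_mono) auto
    also have "\<dots> = e / 2"
    proof -
      have "e / (2 * k) * k = e / 2" if "0 < k" for k :: real using that by simp
      then show ?thesis unfolding e'_def using u1 by blast
    qed
    finally show "e' * (norm u)\<^sup>2 < e" using e by simp
  qed
  obtain r where r: "0 < r" "\<And>w. norm w < r \<Longrightarrow> \<bar>h (\<theta>0 + w) - h \<theta>0 - w \<bullet> (H *v w) / 2\<bar> \<le> e' * (norm w)\<^sup>2"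
    using exp[OF e'(1)] by blast
  obtain N :: nat where N: "(norm u / r)\<^sup>2 < real N" using reals_Archimedean2 by blast
  show "\<exists>N. \<forall>n\<ge>N. norm (real n * (h (\<theta>0 + u /\<^sub>R sqrt (real n)) - h \<theta>0) - u \<bullet> (H *v u) / 2) < e"
  proof (intro exI[of _ "max 1 N"] allI impI)
    fix n assume n: "max 1 N \<le> n"
    then have n0: "0 < real n" and nN: "(norm u / r)\<^sup>2 < real n" using N by auto
    define w where "w = u /\<^sub>R sqrt (real n)"
    have w2: "(norm w)\<^sup>2 = (norm u)\<^sup>2 / real n"
      using n0 by (simp add: w_def power_mult_distrib divide_inverse power_inverse mult.commute)
    have "norm u / r < sqrt (real n)"
      using nN by (metis abs_ge_self order.strict_trans1 real_sqrt_abs real_sqrt_less_iff)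
    then have "norm w < r" using n0 r(1) by (simp add: w_def field_simps)
    then have "\<bar>h (\<theta>0 + w) - h \<theta>0 - w \<bullet> (H *v w) / 2\<bar> \<le> e' * (norm w)\<^sup>2" by (rule r(2))
    then have "real n * \<bar>h (\<theta>0 + w) - h \<theta>0 - w \<bullet> (H *v w) / 2\<bar> \<le> real n * (e' * (norm w)\<^sup>2)"
      using n0 by (intro mult_left_mono) auto
    also have "\<dots> = e' * (norm u)\<^sup>2" using n0 by (simp add: w2)
    finally have 1: "real n * \<bar>h (\<theta>0 + w) - h \<theta>0 - w \<bullet> (H *v w) / 2\<bar> < e" using e'(2) by simp
    have "real n * (w \<bullet> (H *v w)) = u \<bullet> (H *v u)"
    proof -
      have "real n * (inverse (sqrt (real n)) * inverse (sqrt (real n))) = 1"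
        unfolding inverse_mult_distrib[symmetric] using n0 by simp
      moreover have "real n * (w \<bullet> (H *v w)) = (real n * (inverse (sqrt (real n)) * inverse (sqrt (real n)))) * (u \<bullet> (H *v u))"
        by (simp add: w_def matrix_vector_mult_scaleR)
      ultimately show ?thesis by simp
    qed
    then have "real n * (h (\<theta>0 + w) - h \<theta>0) - u \<bullet> (H *v u) / 2 = real n * (h (\<theta>0 + w) - h \<theta>0 - w \<bullet> (H *v w) / 2)"
      by (simp add: right_diff_distrib)
    then show "norm (real n * (h (\<theta>0 + u /\<^sub>R sqrt (real n)) - h \<theta>0) - u \<bullet> (H *v u) / 2) < e"
      using 1 n0 by (simp add: w_def abs_mult)
  qed
qed

lemma rescaled_point_tendsto:
  fixes x u :: "'a::real_normed_vector"
  shows "(\<lambda>n. x + u /\<^sub>R sqrt (real n)) \<longlonglongrightarrow> x"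
proof -
  have "(\<lambda>n. inverse (sqrt (real n))) \<longlonglongrightarrow> 0"
    by (intro tendsto_inverse_0_at_top filterlim_compose[OF sqrt_at_top] filterlim_real_sequentially)
  then have "(\<lambda>n. x + inverse (sqrt (real n)) *\<^sub>R u) \<longlonglongrightarrow> x + 0 *\<^sub>R u" by (intro tendsto_intros)
  then show ?thesis by simp
qed

text \<open>
  After the substitution \<open>\<theta> = \<theta>0 + u / \<surd>n\<close> the unnormalised posterior density becomes
  \<open>E n u\<close>, up to a factor that cancels in the posterior. The function \<open>E n\<close> converges pointwise to
  \<open>exp (u \<bullet> (H *v u) / 2) gl f \<theta>0\<close> and is dominated by a multiple of \<open>exp (- \<kappa> |u|\<^sup>2)\<close>.
\<close>

theorem laplace_posterior:
  fixes \<theta>0 :: "real^'p" and H :: "real^'p^'p" and h f :: "real^'p \<Rightarrow> real"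
    and L g :: "nat \<Rightarrow> real^'p \<Rightarrow> real" and c :: "nat \<Rightarrow> real"
  assumes U: "open U" "\<theta>0 \<in> U"
    and H: "transpose H = H" "negative_definite H"
    and Leq: "\<And>n \<theta>. N \<le> n \<Longrightarrow> \<theta> \<in> U \<Longrightarrow> L n \<theta> = c n * exp (real n * (h \<theta> - h \<theta>0)) * g n \<theta>"
    and c: "\<And>n. N \<le> n \<Longrightarrow> 0 < c n" and N: "0 < N"
    and Lmeas: "\<And>n. N \<le> n \<Longrightarrow> (\<lambda>\<theta>. L n \<theta> * indicator U \<theta>) \<in> borel_measurable borel"
    and \<kappa>: "0 < \<kappa>" "\<And>\<theta>. \<theta> \<in> U \<Longrightarrow> h \<theta> - h \<theta>0 \<le> - (\<kappa> * (norm (\<theta> - \<theta>0))\<^sup>2)"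
    and hlim: "\<And>u. (\<lambda>n. real n * (h (\<theta>0 + u /\<^sub>R sqrt (real n)) - h \<theta>0)) \<longlonglongrightarrow> u \<bullet> (H *v u) / 2"
    and g: "\<And>n \<theta>. N \<le> n \<Longrightarrow> \<theta> \<in> U \<Longrightarrow> 0 \<le> g n \<theta> \<and> g n \<theta> \<le> Cg"
    and glim: "\<And>u. (\<lambda>n. g n (\<theta>0 + u /\<^sub>R sqrt (real n))) \<longlonglongrightarrow> gl" and ginf: "0 < gl"
    and prior: "prior = density lborel (\<lambda>\<theta>. ennreal (f \<theta>))"
    and fmeas[measurable]: "f \<in> borel_measurable borel" and fnn: "\<And>\<theta>. 0 \<le> f \<theta>"
    and fcont: "isCont f \<theta>0" and fpos: "0 < f \<theta>0"
    and fbd: "\<And>\<theta>. \<theta> \<in> U \<Longrightarrow> f \<theta> \<le> Cf"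
  shows "\<forall>\<^sub>F n in sequentially. prob_space (posterior prior U (L n))"
    and "weakly_converges (\<lambda>n. distr (posterior prior U (L n)) borel (\<lambda>\<theta>. sqrt (real n) *\<^sub>R (\<theta> - \<theta>0)))
           (multivariate_normal 0 (- matrix_inv H))"
proof -
  define E where "E n u = indicator U (\<theta>0 + u /\<^sub>R sqrt (real n)) *
     (exp (real n * (h (\<theta>0 + u /\<^sub>R sqrt (real n)) - h \<theta>0)) * g n (\<theta>0 + u /\<^sub>R sqrt (real n)) * f (\<theta>0 + u /\<^sub>R sqrt (real n)))" for n u
  define El where "El u = exp (u \<bullet> (H *v u) / 2) * gl * f \<theta>0" for u
  define J where "J n \<phi> = (LINT u|lborel. \<phi> u * E n u)" for n and \<phi> :: "real^'p \<Rightarrow> real"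
  define G where "G n \<theta> = L n \<theta> * indicator U \<theta> * f \<theta>" for n \<theta>
  define a where "a n = c n * (1 / sqrt (real n)) ^ CARD('p)" for n
  note gauss = multivariate_normal_0_eq[OF H]
  note tend = rescaled_point_tendsto[of \<theta>0]
  have GE: "G n (\<theta>0 + u /\<^sub>R sqrt (real n)) = c n * E n u" if "N \<le> n" for n u
    using Leq[OF that] by (auto simp: G_def E_def indicator_def)
  have EG: "E n u = G n (\<theta>0 + (1 / sqrt (real n)) *\<^sub>R u) / c n" if "N \<le> n" for n u
    using GE[OF that, of u] c[OF that] by (simp add: divide_inverse)
  have Gmeas[measurable]: "G n \<in> borel_measurable borel" if "N \<le> n" for n
    unfolding G_def[abs_def] using Lmeas[OF that] by measurable
  have Emeas: "E n \<in> borel_measurable borel" if "N \<le> n" for n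
  proof -
    have "(\<lambda>u. G n (\<theta>0 + (1 / sqrt (real n)) *\<^sub>R u) / c n) \<in> borel_measurable borel"
      using Gmeas[OF that] by measurable
    then show ?thesis using EG[OF that] by (simp add: fun_eq_iff[symmetric] cong: measurable_cong)
  qed
  have Cg: "0 \<le> Cg" and Cf: "0 \<le> Cf" using g[OF order_refl U(2)] fbd[OF U(2)] fnn[of \<theta>0] by auto
  have E_nn: "0 \<le> E n u" if "N \<le> n" for n u
    using g[OF that] fnn by (auto simp: E_def indicator_def)
  have E_bd: "E n u \<le> Cg * Cf * exp (- (\<kappa> * (norm u)\<^sup>2))" if n: "N \<le> n" for n u
  proof (cases "\<theta>0 + u /\<^sub>R sqrt (real n) \<in> U")
    case True
    let ?\<theta> = "\<theta>0 + u /\<^sub>R sqrt (real n)"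
    have n0: "0 < real n" using n N by simp
    have "(norm (?\<theta> - \<theta>0))\<^sup>2 = (norm u)\<^sup>2 / real n"
      using n0 by (simp add: power_mult_distrib divide_inverse power_inverse mult.commute)
    then have "real n * (h ?\<theta> - h \<theta>0) \<le> real n * (- (\<kappa> * ((norm u)\<^sup>2 / real n)))"
      using \<kappa>(2)[OF True] n0 by (intro mult_left_mono) auto
    also have "\<dots> = - (\<kappa> * (norm u)\<^sup>2)" using n0 by simp
    finally have "exp (real n * (h ?\<theta> - h \<theta>0)) \<le> exp (- (\<kappa> * (norm u)\<^sup>2))" by simp
    then have "exp (real n * (h ?\<theta> - h \<theta>0)) * g n ?\<theta> * f ?\<theta> \<le> exp (- (\<kappa> * (norm u)\<^sup>2)) * Cg * Cf"
      using g[OF n True] fbd[OF True] fnn Cg by (intro mult_mono) auto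
    then show ?thesis using True by (simp add: E_def mult_ac)
  qed (use Cg Cf in \<open>auto simp: E_def\<close>)
  have dom_int: "integrable lborel (\<lambda>u::real^'p. Cg * Cf * exp (- (\<kappa> * (norm u)\<^sup>2)))"
    using integrable_gaussian_norm[OF \<kappa>(1)] by (rule integrable_mult_right)
  have E_int: "integrable lborel (\<lambda>u. \<phi> u * E n u)"
    if n: "N \<le> n" and \<phi>: "\<phi> \<in> borel_measurable borel" "\<And>u. \<bar>\<phi> u\<bar> \<le> B" for n \<phi> B
  proof (rule Bochner_Integration.integrable_bound[OF integrable_mult_right[OF dom_int, of B]])
    show "(\<lambda>u. \<phi> u * E n u) \<in> borel_measurable lborel" using \<phi>(1) Emeas[OF n] by measurable
    show "AE u in lborel. norm (\<phi> u * E n u) \<le> norm (B * (Cg * Cf * exp (- (\<kappa> * (norm u)\<^sup>2))))"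
    proof (rule AE_I2)
      fix u :: "real^'p"
      have B: "0 \<le> B" using \<phi>(2)[of u] by linarith
      have "norm (\<phi> u * E n u) = \<bar>\<phi> u\<bar> * E n u" using E_nn[OF n] by (simp add: abs_mult)
      also have "\<dots> \<le> B * (Cg * Cf * exp (- (\<kappa> * (norm u)\<^sup>2)))"
        using \<phi>(2) E_bd[OF n] E_nn[OF n] B by (intro mult_mono) auto
      finally show "norm (\<phi> u * E n u) \<le> norm (B * (Cg * Cf * exp (- (\<kappa> * (norm u)\<^sup>2))))" by simp
    qed
  qed
  have E_lim: "(\<lambda>n. E n u) \<longlonglongrightarrow> El u" for u
  proof -
    have "\<forall>\<^sub>F n in sequentially. \<theta>0 + u /\<^sub>R sqrt (real n) \<in> U"
      using tend U by (rule topological_tendstoD)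
    then have "\<forall>\<^sub>F n in sequentially. exp (real n * (h (\<theta>0 + u /\<^sub>R sqrt (real n)) - h \<theta>0)) * g n (\<theta>0 + u /\<^sub>R sqrt (real n))
         * f (\<theta>0 + u /\<^sub>R sqrt (real n)) = E n u"
      by eventually_elim (simp add: E_def)
    moreover have "(\<lambda>n. exp (real n * (h (\<theta>0 + u /\<^sub>R sqrt (real n)) - h \<theta>0)) * g n (\<theta>0 + u /\<^sub>R sqrt (real n))
         * f (\<theta>0 + u /\<^sub>R sqrt (real n))) \<longlonglongrightarrow> El u"
      unfolding El_def by (intro tendsto_intros hlim glim isCont_tendsto_compose[OF fcont] tend)
    ultimately show ?thesis by (rule Lim_transform_eventually[rotated])
  qed
  have J_lim: "(\<lambda>n. J n \<phi>) \<longlonglongrightarrow> (LINT u|lborel. \<phi> u * El u)"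
    if \<phi>: "\<phi> \<in> borel_measurable borel" "\<And>u. \<bar>\<phi> u\<bar> \<le> B" for \<phi> B
  proof -
    have "(\<lambda>n. J (n + N) \<phi>) \<longlonglongrightarrow> (LINT u|lborel. \<phi> u * El u)"
      unfolding J_def
    proof (rule integral_dominated_convergence[where w = "\<lambda>u. B * (Cg * Cf * exp (- (\<kappa> * (norm u)\<^sup>2)))"])
      have "continuous_on UNIV El" unfolding El_def by (intro continuous_intros) auto
      then have "El \<in> borel_measurable borel" by (rule borel_measurable_continuous_onI)
      then show "(\<lambda>u. \<phi> u * El u) \<in> borel_measurable lborel" using \<phi>(1) by measurable
      show "(\<lambda>u. \<phi> u * E (n + N) u) \<in> borel_measurable lborel" for n
        using E_int[OF _ \<phi>, of "n + N"] by auto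
      show "AE u in lborel. (\<lambda>n. \<phi> u * E (n + N) u) \<longlonglongrightarrow> \<phi> u * El u"
        by (intro AE_I2 tendsto_intros LIMSEQ_ignore_initial_segment E_lim)
      show "AE u in lborel. norm (\<phi> u * E (n + N) u) \<le> B * (Cg * Cf * exp (- (\<kappa> * (norm u)\<^sup>2)))" for n
      proof (rule AE_I2)
        fix u :: "real^'p"
        have B: "0 \<le> B" using \<phi>(2)[of u] by linarith
        have "norm (\<phi> u * E (n + N) u) = \<bar>\<phi> u\<bar> * E (n + N) u" using E_nn[of "n + N"] by (simp add: abs_mult)
        also have "\<dots> \<le> B * (Cg * Cf * exp (- (\<kappa> * (norm u)\<^sup>2)))"
          using \<phi>(2) E_bd[of "n + N"] E_nn[of "n + N"] B by (intro mult_mono) auto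
        finally show "norm (\<phi> u * E (n + N) u) \<le> B * (Cg * Cf * exp (- (\<kappa> * (norm u)\<^sup>2)))" .
      qed
    qed (rule integrable_mult_right[OF dom_int])
    then show ?thesis by (rule LIMSEQ_offset)
  qed
  have Jinf: "(LINT u|lborel. \<phi> u * El u) = gl * f \<theta>0 * (LINT u|lborel. \<phi> u * exp (u \<bullet> (H *v u) / 2))" for \<phi>
    unfolding El_def integral_mult_right_zero[symmetric] by (simp add: mult_ac)
  have one: "(\<lambda>_::real^'p. 1 :: real) \<in> borel_measurable borel" "\<And>u. \<bar>(\<lambda>_::real^'p. 1 :: real) u\<bar> \<le> 1" by auto
  have J1_lim: "(\<lambda>n. J n (\<lambda>_. 1)) \<longlonglongrightarrow> gl * f \<theta>0 * (LINT u|lborel. exp (u \<bullet> (H *v u) / 2))"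
    using J_lim[OF one] Jinf[of "\<lambda>_. 1"] by simp
  have Jpos: "\<forall>\<^sub>F n in sequentially. 0 < J n (\<lambda>_. 1)"
    using J1_lim by (rule order_tendstoD) (intro mult_pos_pos ginf fpos gauss(3))
  have apos: "0 < a n" if "N \<le> n" for n using c[OF that] that N by (simp add: a_def)
  have aff: "(LINT \<theta>|lborel. \<phi> (sqrt (real n) *\<^sub>R (\<theta> - \<theta>0)) * G n \<theta>) = a n * J n \<phi>"
    and affi: "integrable lborel (\<lambda>\<theta>. \<phi> (sqrt (real n) *\<^sub>R (\<theta> - \<theta>0)) * G n \<theta>)"
    if n: "N \<le> n" and \<phi>: "\<phi> \<in> borel_measurable borel" "\<And>u. \<bar>\<phi> u\<bar> \<le> B" for n \<phi> B
  proof -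
    have n0: "0 < real n" using n N by simp
    have [measurable]: "\<phi> \<in> borel_measurable borel" "G n \<in> borel_measurable borel" using \<phi> Gmeas[OF n] by auto
    have eq: "\<phi> (sqrt (real n) *\<^sub>R (\<theta>0 + (1 / sqrt (real n)) *\<^sub>R u - \<theta>0)) * G n (\<theta>0 + (1 / sqrt (real n)) *\<^sub>R u) = c n * (\<phi> u * E n u)" for u
      using n0 GE[OF n, of u] by (simp add: divide_inverse)
    have "(LINT \<theta>|lborel. \<phi> (sqrt (real n) *\<^sub>R (\<theta> - \<theta>0)) * G n \<theta>) = \<bar>1 / sqrt (real n)\<bar> ^ DIM(real^'p) *\<^sub>R
        (LINT u|lborel. \<phi> (sqrt (real n) *\<^sub>R (\<theta>0 + (1 / sqrt (real n)) *\<^sub>R u - \<theta>0)) * G n (\<theta>0 + (1 / sqrt (real n)) *\<^sub>R u))"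
      using n0 by (intro integral_lborel_affine) auto
    also have "\<dots> = a n * J n \<phi>" unfolding eq by (simp add: a_def J_def)
    finally show "(LINT \<theta>|lborel. \<phi> (sqrt (real n) *\<^sub>R (\<theta> - \<theta>0)) * G n \<theta>) = a n * J n \<phi>" .
    have "integrable lborel (\<lambda>\<theta>. (\<lambda>u. c n * (\<phi> u * E n u)) (- sqrt (real n) *\<^sub>R \<theta>0 + sqrt (real n) *\<^sub>R \<theta>))"
      using n0 E_int[OF n \<phi>] by (intro integrable_lborel_affine integrable_mult_right) auto
    moreover have eq2: "c n * (\<phi> (- sqrt (real n) *\<^sub>R \<theta>0 + sqrt (real n) *\<^sub>R \<theta>) * E n (- sqrt (real n) *\<^sub>R \<theta>0 + sqrt (real n) *\<^sub>R \<theta>))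
       = \<phi> (sqrt (real n) *\<^sub>R (\<theta> - \<theta>0)) * G n \<theta>" for \<theta>
      using n0 GE[OF n, of "sqrt (real n) *\<^sub>R (\<theta> - \<theta>0)"] by (simp add: algebra_simps)
    ultimately show "integrable lborel (\<lambda>\<theta>. \<phi> (sqrt (real n) *\<^sub>R (\<theta> - \<theta>0)) * G n \<theta>)" by (simp only: eq2)
  qed
  have Z: "(LINT \<theta>':U|prior. L n \<theta>') = a n * J n (\<lambda>_. 1)" if n: "N \<le> n" for n
  proof -
    have "(LINT \<theta>':U|prior. L n \<theta>') = (LINT \<theta>|prior. L n \<theta> * indicator U \<theta>)"
      unfolding set_lebesgue_integral_def by (simp add: mult.commute)
    also have "\<dots> = (LINT \<theta>|lborel. f \<theta> *\<^sub>R (L n \<theta> * indicator U \<theta>))"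
      unfolding prior using Lmeas[OF n] fnn by (intro integral_density) auto
    also have "\<dots> = a n * J n (\<lambda>_. 1)" using aff[OF n one] by (simp add: G_def mult_ac)
    finally show ?thesis .
  qed
  have L_nn: "0 \<le> L n \<theta> * indicator U \<theta>" if "N \<le> n" for n \<theta>
    using Leq[OF that] c[OF that] g[OF that] by (auto simp: indicator_def)
  have main: "prob_space (posterior prior U (L n)) \<and>
     (\<forall>\<phi> B. \<phi> \<in> borel_measurable borel \<longrightarrow> (\<forall>u. \<bar>\<phi> u\<bar> \<le> B) \<longrightarrow>
       (LINT x|distr (posterior prior U (L n)) borel (\<lambda>\<theta>. sqrt (real n) *\<^sub>R (\<theta> - \<theta>0)). \<phi> x) = J n \<phi> / J n (\<lambda>_. 1))"
    if n: "N \<le> n" and J: "0 < J n (\<lambda>_. 1)" for n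
  proof (intro conjI allI impI)
    define z where "z = a n * J n (\<lambda>_. 1)"
    have z: "0 < z" using apos[OF n] J by (simp add: z_def)
    have [measurable]: "(\<lambda>\<theta>. L n \<theta> * indicator U \<theta>) \<in> borel_measurable borel" by (rule Lmeas[OF n])
    have [measurable_cong]: "sets prior = sets borel" by (simp add: prior)
    have post: "posterior prior U (L n) = density prior (\<lambda>\<theta>. ennreal (L n \<theta> * indicator U \<theta> / z))"
      unfolding posterior_def Z[OF n] z_def ..
    have sets_post[measurable_cong]: "sets (posterior prior U (L n)) = sets borel" unfolding post by (simp add: \<open>sets prior = sets borel\<close>)
    have "emeasure (posterior prior U (L n)) (space (posterior prior U (L n)))
       = (\<integral>\<^sup>+\<theta>. ennreal (L n \<theta> * indicator U \<theta> / z) \<partial>prior)"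
      unfolding post by (simp add: emeasure_density cong: nn_integral_cong)
    also have "\<dots> = (\<integral>\<^sup>+\<theta>. ennreal (f \<theta>) * ennreal (L n \<theta> * indicator U \<theta> / z) \<partial>lborel)"
      unfolding prior by (rule nn_integral_density) auto
    also have "\<dots> = (\<integral>\<^sup>+\<theta>. ennreal (G n \<theta> / z) \<partial>lborel)"
      using fnn L_nn[OF n] z by (intro nn_integral_cong) (simp add: G_def ennreal_mult[symmetric] mult_ac)
    also have "\<dots> = ennreal (LINT \<theta>|lborel. G n \<theta> / z)"
    proof (rule nn_integral_eq_integral)
      show "integrable lborel (\<lambda>\<theta>. G n \<theta> / z)" using affi[OF n one] by simp
      show "AE \<theta> in lborel. 0 \<le> G n \<theta> / z" using L_nn[OF n] fnn z by (intro AE_I2) (simp add: G_def)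
    qed
    also have "(LINT \<theta>|lborel. G n \<theta> / z) = 1" using aff[OF n one] z apos[OF n] J by (simp add: z_def)
    finally show "prob_space (posterior prior U (L n))" by (intro prob_spaceI) simp
    fix \<phi> :: "real^'p \<Rightarrow> real" and B assume \<phi>[measurable]: "\<phi> \<in> borel_measurable borel" and B: "\<forall>u. \<bar>\<phi> u\<bar> \<le> B"
    have "(LINT x|distr (posterior prior U (L n)) borel (\<lambda>\<theta>. sqrt (real n) *\<^sub>R (\<theta> - \<theta>0)). \<phi> x)
       = (LINT \<theta>|posterior prior U (L n). \<phi> (sqrt (real n) *\<^sub>R (\<theta> - \<theta>0)))"
      by (rule integral_distr) auto
    also have "\<dots> = (LINT \<theta>|prior. (L n \<theta> * indicator U \<theta> / z) *\<^sub>R \<phi> (sqrt (real n) *\<^sub>R (\<theta> - \<theta>0)))"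
      unfolding post using L_nn[OF n] z by (intro integral_density) auto
    also have "\<dots> = (LINT \<theta>|lborel. f \<theta> *\<^sub>R ((L n \<theta> * indicator U \<theta> / z) *\<^sub>R \<phi> (sqrt (real n) *\<^sub>R (\<theta> - \<theta>0))))"
      unfolding prior using fnn by (intro integral_density) auto
    also have "\<dots> = (LINT \<theta>|lborel. \<phi> (sqrt (real n) *\<^sub>R (\<theta> - \<theta>0)) * G n \<theta>) / z"
      unfolding integral_divide_zero[symmetric] by (simp add: G_def mult_ac)
    also have "\<dots> = J n \<phi> / J n (\<lambda>_. 1)"
      using aff[OF n \<phi>, of B] B apos[OF n] by (simp add: z_def)
    finally show "(LINT x|distr (posterior prior U (L n)) borel (\<lambda>\<theta>. sqrt (real n) *\<^sub>R (\<theta> - \<theta>0)). \<phi> x) = J n \<phi> / J n (\<lambda>_. 1)" .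
  qed
  have ev: "\<forall>\<^sub>F n in sequentially. N \<le> n" by (rule eventually_ge_at_top)
  show "\<forall>\<^sub>F n in sequentially. prob_space (posterior prior U (L n))"
    using ev Jpos by eventually_elim (use main in blast)
  show "weakly_converges (\<lambda>n. distr (posterior prior U (L n)) borel (\<lambda>\<theta>. sqrt (real n) *\<^sub>R (\<theta> - \<theta>0)))
           (multivariate_normal 0 (- matrix_inv H))"
    unfolding weakly_converges_def
  proof (intro allI impI)
    fix \<phi> :: "real^'p \<Rightarrow> real" assume "continuous_on UNIV \<phi>" and "bounded (range \<phi>)"
    then obtain B where B: "\<And>u. \<bar>\<phi> u\<bar> \<le> B" by (auto simp: bounded_iff)
    have \<phi>[measurable]: "\<phi> \<in> borel_measurable borel" by (rule borel_measurable_continuous_onI) fact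
    let ?I = "LINT u|lborel. exp (u \<bullet> (H *v u) / 2)"
    have expm: "(\<lambda>u. exp (u \<bullet> (H *v u) / 2)) \<in> borel_measurable lborel" using gauss(2) by auto
    have "\<forall>\<^sub>F n in sequentially. J n \<phi> / J n (\<lambda>_. 1) =
       (LINT x|distr (posterior prior U (L n)) borel (\<lambda>\<theta>. sqrt (real n) *\<^sub>R (\<theta> - \<theta>0)). \<phi> x)"
      using ev Jpos
    proof eventually_elim
      case (elim n)
      show ?case by (rule main[OF elim, THEN conjunct2, rule_format, OF \<phi> B, symmetric])
    qed
    moreover have "(\<lambda>n. J n \<phi> / J n (\<lambda>_. 1)) \<longlonglongrightarrow> (LINT x|multivariate_normal 0 (- matrix_inv H). \<phi> x)"
    proof -
      have "(\<lambda>n. J n \<phi> / J n (\<lambda>_. 1)) \<longlonglongrightarrow>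
         (gl * f \<theta>0 * (LINT u|lborel. \<phi> u * exp (u \<bullet> (H *v u) / 2))) / (gl * f \<theta>0 * ?I)"
        using J_lim[OF \<phi> B] unfolding Jinf
        by (intro tendsto_divide J1_lim) (use ginf fpos gauss(3) in auto)
      also have "(gl * f \<theta>0 * (LINT u|lborel. \<phi> u * exp (u \<bullet> (H *v u) / 2))) / (gl * f \<theta>0 * ?I)
         = (LINT u|lborel. \<phi> u * exp (u \<bullet> (H *v u) / 2)) / ?I"
        using ginf fpos by simp
      also have "\<dots> = (LINT u|lborel. (exp (u \<bullet> (H *v u) / 2) / ?I) *\<^sub>R \<phi> u)"
        unfolding integral_divide_zero[symmetric] by (simp add: mult_ac)
      also have "\<dots> = (LINT x|multivariate_normal 0 (- matrix_inv H). \<phi> x)"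
        unfolding gauss(1) using expm gauss(3) by (intro integral_density[symmetric]) auto
      finally show ?thesis .
    qed
    ultimately show "(\<lambda>n. LINT x|distr (posterior prior U (L n)) borel (\<lambda>\<theta>. sqrt (real n) *\<^sub>R (\<theta> - \<theta>0)). \<phi> x)
      \<longlonglongrightarrow> (LINT x|multivariate_normal 0 (- matrix_inv H). \<phi> x)"
      by (rule Lim_transform_eventually[rotated])
  qed
qed

section \<open>Smoothness of the cumulant generating function\<close>

lemma Basis_dirs:
  "(Basis :: ((real^'d) \<times> (real^'p)) set) = range s_dir \<union> range th_dir"
  unfolding Basis_prod_def by (auto simp: Basis_vec_def s_dir_def th_dir_def)

lemma sum_Basis_dirs:
  fixes g :: "(real^'d) \<times> (real^'p) \<Rightarrow> real"
  shows "(\<Sum>b\<in>Basis. g b) = (\<Sum>j\<in>UNIV. g (s_dir j)) + (\<Sum>i\<in>UNIV. g (th_dir i))"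
proof -
  have "inj (s_dir :: 'd \<Rightarrow> (real^'d) \<times> (real^'p))" "inj (th_dir :: 'p \<Rightarrow> (real^'d) \<times> (real^'p))"
    by (auto simp: inj_def s_dir_def th_dir_def axis_eq_axis)
  moreover have "range s_dir \<inter> range th_dir = ({} :: ((real^'d) \<times> (real^'p)) set)"
    by (auto simp: s_dir_def th_dir_def axis_eq_0_iff)
  ultimately show ?thesis
    unfolding Basis_dirs by (subst sum.union_disjoint) (auto simp: sum.reindex)
qed

lemma inner_dirs [simp]: "(a, w) \<bullet> s_dir j = a $ j" "(a, w) \<bullet> th_dir i = w $ i"
  by (simp_all add: s_dir_def th_dir_def inner_axis)

lemma dir_deriv_eqI:
  fixes f :: "'a::real_normed_vector \<Rightarrow> real"
  assumes "((\<lambda>t. f (x + t *\<^sub>R v)) has_real_derivative D) (at 0)"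
  shows "dir_deriv v f x = D"
  using assms unfolding dir_deriv_def has_real_derivative_iff_has_vector_derivative
  by (rule vector_derivative_at)

lemma line_eventually_in_open:
  fixes x v :: "'a::real_normed_vector"
  assumes "open D" "x \<in> D"
  shows "\<forall>\<^sub>F t in nhds (0::real). x + t *\<^sub>R v \<in> D"
proof -
  have "open ((\<lambda>t::real. x + t *\<^sub>R v) -` D)"
    by (intro open_vimage assms continuous_intros)
  then show ?thesis
    using assms(2) unfolding eventually_nhds by (intro exI[of _ "(\<lambda>t::real. x + t *\<^sub>R v) -` D"]) auto
qed

lemma has_real_derivative_line_cong:
  fixes x v :: "'a::real_normed_vector" and f g :: "'a \<Rightarrow> real"
  assumes "open D" "x \<in> D" and eq: "\<And>y. y \<in> D \<Longrightarrow> f y = g y"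
    and "((\<lambda>t. f (x + t *\<^sub>R v)) has_real_derivative c) (at 0)"
  shows "((\<lambda>t. g (x + t *\<^sub>R v)) has_real_derivative c) (at 0)"
proof -
  have "\<forall>\<^sub>F t in nhds 0. f (x + t *\<^sub>R v) = g (x + t *\<^sub>R v)"
    using line_eventually_in_open[OF assms(1,2), of v] by eventually_elim (rule eq)
  then show ?thesis using assms(4) by (subst (asm) DERIV_cong_ev[OF refl _ refl]) auto
qed

lemma log_partial_derivatives:
  fixes m :: "'a::euclidean_space \<Rightarrow> real"
  assumes D: "open D" "\<And>x. x \<in> D \<Longrightarrow> 0 < m x"
    and K: "\<And>x. x \<in> D \<Longrightarrow> K x = ln (m x)"
    and md: "\<And>b x. b \<in> B \<Longrightarrow> x \<in> D \<Longrightarrow> ((\<lambda>t. m (x + t *\<^sub>R b)) has_real_derivative md b x) (at 0)"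
    and mdd: "\<And>b c x. b \<in> B \<Longrightarrow> c \<in> B \<Longrightarrow> x \<in> D \<Longrightarrow>
               ((\<lambda>t. md b (x + t *\<^sub>R c)) has_real_derivative mdd c b x) (at 0)"
    and b: "b \<in> B" and c: "c \<in> B" and x: "x \<in> D"
  shows "((\<lambda>t. K (x + t *\<^sub>R b)) has_real_derivative iter_deriv [b] K x) (at 0)"
    and "iter_deriv [b] K x = md b x / m x"
    and "((\<lambda>t. iter_deriv [b] K (x + t *\<^sub>R c)) has_real_derivative iter_deriv [c, b] K x) (at 0)"
    and "iter_deriv [c, b] K x = mdd c b x / m x - md b x * md c x / (m x)\<^sup>2"
proof -
  have 1: "((\<lambda>t. K (y + t *\<^sub>R b)) has_real_derivative md b y / m y) (at 0)" if b: "b \<in> B" and y: "y \<in> D" for b y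
  proof (rule has_real_derivative_line_cong[OF D(1) y])
    show "((\<lambda>t. ln (m (y + t *\<^sub>R b))) has_real_derivative md b y / m y) (at 0)"
      using md[OF b y] D(2)[OF y] by (auto intro!: derivative_eq_intros)
  qed (use K in simp)
  have 2: "iter_deriv [b] K y = md b y / m y" if "b \<in> B" "y \<in> D" for b y
    using dir_deriv_eqI[OF 1[OF that]] by simp
  show "((\<lambda>t. K (x + t *\<^sub>R b)) has_real_derivative iter_deriv [b] K x) (at 0)"
    unfolding 2[OF b x] by (rule 1[OF b x])
  show "iter_deriv [b] K x = md b x / m x" by (rule 2[OF b x])
  have 3: "((\<lambda>t. iter_deriv [b] K (x + t *\<^sub>R c)) has_real_derivative mdd c b x / m x - md b x * md c x / (m x)\<^sup>2) (at 0)"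
  proof (rule has_real_derivative_line_cong[OF D(1) x])
    show "((\<lambda>t. md b (x + t *\<^sub>R c) / m (x + t *\<^sub>R c)) has_real_derivative
           mdd c b x / m x - md b x * md c x / (m x)\<^sup>2) (at 0)"
      using md[OF c x] mdd[OF b c x] D(2)[OF x]
      by (auto intro!: derivative_eq_intros simp: power2_eq_square diff_divide_distrib)
  qed (use 2 b in simp)
  have 4: "iter_deriv [c, b] K x = mdd c b x / m x - md b x * md c x / (m x)\<^sup>2"
    using dir_deriv_eqI[OF 3] by simp
  show "((\<lambda>t. iter_deriv [b] K (x + t *\<^sub>R c)) has_real_derivative iter_deriv [c, b] K x) (at 0)"
    unfolding 4 by (rule 3)
  show "iter_deriv [c, b] K x = mdd c b x / m x - md b x * md c x / (m x)\<^sup>2" by (rule 4)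
qed

locale saddlepoint_model =
  fixes R :: "(real^'p::finite) set"
    and P :: "real^'p \<Rightarrow> 'w measure"
    and Y :: "real^'p \<Rightarrow> 'w \<Rightarrow> real^'d::finite"
    and Ys :: "real^'p \<Rightarrow> nat \<Rightarrow> 'w \<Rightarrow> real^'d"
  assumes model: "iid_copies_model R P Y Ys"
    and decay: "decay_condition R P Y"
    and growth: "growth_condition R P Y"
begin

definition law :: "real^'p \<Rightarrow> (real^'d) measure" where
  "law \<theta> = distr (P \<theta>) borel (Y \<theta>)"

abbreviation dom :: "((real^'d) \<times> (real^'p)) set" where
  "dom \<equiv> interior (S_set R P Y)"

abbreviation K :: "(real^'d) \<times> (real^'p) \<Rightarrow> real" where
  "K \<equiv> (\<lambda>(s, \<theta>). K0 P Y s \<theta>)"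

lemma Y_measurable: "\<theta> \<in> R \<Longrightarrow> Y \<theta> \<in> borel_measurable (P \<theta>)"
  using model by (simp add: iid_copies_model_def)

lemma law: "\<theta> \<in> R \<Longrightarrow> euclidean_law (law \<theta>)"
  using model unfolding iid_copies_model_def law_def euclidean_law_def euclidean_law_axioms_def
  by (auto intro: prob_space.prob_space_distr)

lemma S_at_eq: "\<theta> \<in> R \<Longrightarrow> S_at P Y \<theta> = mgf_domain (law \<theta>)"
  unfolding S_at_def mgf_domain_def law_def by (simp add: integrable_distr_eq Y_measurable)

lemma dom_R: "(s, \<theta>) \<in> dom \<Longrightarrow> \<theta> \<in> R"
  using interior_subset by (fastforce simp: S_set_def)

lemma dom_slice:
  assumes "(s, \<theta>) \<in> dom" shows "s \<in> interior (mgf_domain (law \<theta>))"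
proof -
  have "open ((\<lambda>s. (s, \<theta>)) -` dom)"
    by (intro open_vimage continuous_intros) auto
  moreover have "(\<lambda>s. (s, \<theta>)) -` dom \<subseteq> mgf_domain (law \<theta>)"
    using interior_subset[of "S_set R P Y"] S_at_eq[OF dom_R[OF assms]] by (auto simp: S_set_def)
  ultimately show ?thesis using assms by (auto simp: interior_def)
qed

lemma dom_mgf: "(s, \<theta>) \<in> dom \<Longrightarrow> s \<in> mgf_domain (law \<theta>)"
  using dom_slice interior_subset by blast

lemma M0_eq:
  assumes "\<theta> \<in> R"
  shows "M0 P Y (cvec s \<phi>) \<theta> = (CLINT y|law \<theta>. exp (s \<bullet> y) *\<^sub>R iexp (\<phi> \<bullet> y))"
proof -
  have "(\<Sum>j\<in>UNIV. cvec s \<phi> $ j * complex_of_real (y $ j)) = complex_of_real (s \<bullet> y) + \<i> * complex_of_real (\<phi> \<bullet> y)" for y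
    by (simp add: complex_eq_iff cvec_def inner_vec_def)
  then have "exp (\<Sum>j\<in>UNIV. cvec s \<phi> $ j * complex_of_real (y $ j)) = exp (s \<bullet> y) *\<^sub>R iexp (\<phi> \<bullet> y)" for y
    by (simp add: exp_add scaleR_conv_of_real exp_of_real)
  then show ?thesis
    unfolding M0_def law_def by (subst integral_distr) (auto simp: Y_measurable assms)
qed

lemma M0_real: "\<theta> \<in> R \<Longrightarrow> M0 P Y (cvec s 0) \<theta> = complex_of_real (mgf (law \<theta>) s)"
  by (simp add: M0_eq mgf_def scaleR_conv_of_real)

lemma mchar_tilt_law:
  assumes "(s, \<theta>) \<in> dom"
  shows "mchar (tilt (law \<theta>) s) \<phi> = M0 P Y (cvec s \<phi>) \<theta> / M0 P Y (cvec s 0) \<theta>"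
  unfolding euclidean_law.mchar_tilt[OF law[OF dom_R[OF assms]] dom_mgf[OF assms]]
    M0_real[OF dom_R[OF assms]]
  unfolding M0_eq[OF dom_R[OF assms]] ..

lemma K_eq: "(s, \<theta>) \<in> dom \<Longrightarrow> K (s, \<theta>) = ln (mgf (law \<theta>) s)"
  using dom_R by (simp add: K0_def M0_real)

lemma mgf_law_pos: "(s, \<theta>) \<in> dom \<Longrightarrow> 0 < mgf (law \<theta>) s"
  using euclidean_law.mgf_pos[OF law[OF dom_R] dom_mgf] by blast

lemma growth_partials:
  fixes vs :: "((real^'d) \<times> (real^'p)) list" and \<phi> :: "real^'d"
  assumes vs: "vs = map th_dir is @ map s_dir js"
    and len: "(length is \<le> 1 \<and> 1 \<le> length is + length js \<and> length is + length js \<le> 6)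
             \<or> (length is = 2 \<and> length js \<le> 2)"
  shows "iter_deriv_exists_on dom vs (\<lambda>(s, \<theta>). M0 P Y (cvec s \<phi>) \<theta>)"
    and "continuous_on dom (iter_deriv vs (\<lambda>(s, \<theta>). M0 P Y (cvec s \<phi>) \<theta>))"
proof -
  obtain \<gamma> where "\<forall>(is :: 'p list) (js :: 'd list).
           (length is \<le> 1 \<and> 1 \<le> length is + length js \<and> length is + length js \<le> 6)
             \<or> (length is = 2 \<and> length js \<le> 2) \<longrightarrow>
           (let vs = map th_dir is @ map s_dir js;
                D = (\<lambda>\<phi>. iter_deriv vs (\<lambda>(s, \<theta>). M0 P Y (cvec s \<phi>) \<theta>))
            in (\<forall>\<phi>. iter_deriv_exists_on dom vs
                       (\<lambda>(s, \<theta>). M0 P Y (cvec s \<phi>) \<theta>)) \<and>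
               continuous_on (UNIV \<times> dom) (\<lambda>(\<phi>, x). D \<phi> x) \<and>
               (\<forall>\<phi>. \<forall>x \<in> dom.
                  norm (D \<phi> x) \<le> \<gamma> x * (1 + norm \<phi>) powr \<gamma> x))"
    using growth unfolding growth_condition_def by blast
  from this[rule_format, OF len, folded vs, unfolded Let_def]
  have ex: "iter_deriv_exists_on dom vs (\<lambda>(s, \<theta>). M0 P Y (cvec s \<phi>) \<theta>)"
    and cont: "continuous_on (UNIV \<times> dom) (\<lambda>(\<phi>, x). iter_deriv vs (\<lambda>(s, \<theta>). M0 P Y (cvec s \<phi>) \<theta>) x)"
    by auto
  show "iter_deriv_exists_on dom vs (\<lambda>(s, \<theta>). M0 P Y (cvec s \<phi>) \<theta>)" by (rule ex)
  have "continuous_on dom ((\<lambda>(\<phi>, x). iter_deriv vs (\<lambda>(s, \<theta>). M0 P Y (cvec s \<phi>) \<theta>) x) \<circ> (\<lambda>x. (\<phi>, x)))"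
    by (intro continuous_on_compose continuous_on_subset[OF cont] continuous_intros) auto
  then show "continuous_on dom (iter_deriv vs (\<lambda>(s, \<theta>). M0 P Y (cvec s \<phi>) \<theta>))" by (simp add: o_def)
qed

lemma first_partials:
  assumes b: "b \<in> Basis"
  shows "x \<in> dom \<Longrightarrow> ((\<lambda>t. (\<lambda>(s, \<theta>). M0 P Y (cvec s \<phi>) \<theta>) (x + t *\<^sub>R b))
           has_vector_derivative iter_deriv [b] (\<lambda>(s, \<theta>). M0 P Y (cvec s \<phi>) \<theta>) x) (at 0)"
    and "continuous_on dom (iter_deriv [b] (\<lambda>(s, \<theta>). M0 P Y (cvec s \<phi>) \<theta>))"
proof -
  obtain "is" :: "'p list" and js :: "'d list" where
    eq: "[b] = map th_dir is @ map s_dir js" and "length is + length js = 1"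
  proof -
    from b consider i where "b = th_dir i" | j where "b = s_dir j" unfolding Basis_dirs by blast
    then show ?thesis
    proof cases
      case 1 then show ?thesis using that[of "[i]" "[]"] by simp
    next
      case 2 then show ?thesis using that[of "[]" "[j]"] by simp
    qed
  qed
  note g = growth_partials[OF eq, of \<phi>]
  have "iter_deriv_exists_on dom [b] (\<lambda>(s, \<theta>). M0 P Y (cvec s \<phi>) \<theta>)"
    by (rule g(1)) (use \<open>length is + length js = 1\<close> in linarith)
  then show "x \<in> dom \<Longrightarrow> ((\<lambda>t. (\<lambda>(s, \<theta>). M0 P Y (cvec s \<phi>) \<theta>) (x + t *\<^sub>R b))
           has_vector_derivative iter_deriv [b] (\<lambda>(s, \<theta>). M0 P Y (cvec s \<phi>) \<theta>) x) (at 0)"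
    by (simp add: dir_deriv_def vector_derivative_works[symmetric])
  show "continuous_on dom (iter_deriv [b] (\<lambda>(s, \<theta>). M0 P Y (cvec s \<phi>) \<theta>))"
    by (rule g(2)) (use \<open>length is + length js = 1\<close> in linarith)
qed

text \<open>
  The growth condition bounds derivatives of order at least one. Continuity of \<open>M\<^sub>0\<close> itself comes
  from its first partial derivatives, for the real and the imaginary part separately.
\<close>

lemma M0_continuous: "continuous_on dom (\<lambda>(s, \<theta>). M0 P Y (cvec s \<phi>) \<theta>)"
proof -
  let ?M = "\<lambda>(s, \<theta>). M0 P Y (cvec s \<phi>) \<theta>"
  have op: "open dom" by simp
  have isc: "isCont (iter_deriv [b] ?M) x" if "b \<in> Basis" "x \<in> dom" for b x
    using first_partials(2)[OF that(1)] that(2) op by (simp add: continuous_on_eq_continuous_at)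
  have "isCont (\<lambda>x. Re (?M x)) x \<and> isCont (\<lambda>x. Im (?M x)) x" if x: "x \<in> dom" for x
  proof
    have "((\<lambda>x. Re (?M x)) has_derivative (\<lambda>h. \<Sum>b\<in>Basis. (h \<bullet> b) * Re (iter_deriv [b] ?M x))) (at x)"
    proof (rule has_derivative_of_continuous_partials[OF op x])
      show "((\<lambda>t. Re (?M (y + t *\<^sub>R b))) has_real_derivative Re (iter_deriv [b] ?M y)) (at 0)"
        if "b \<in> Basis" "y \<in> dom" for b y
        using bounded_linear.has_vector_derivative[OF bounded_linear_Re first_partials(1)[OF that, of \<phi>]]
        by (simp add: has_real_derivative_iff_has_vector_derivative)
      show "isCont (\<lambda>x. Re (iter_deriv [b] ?M x)) x" if "b \<in> Basis" for b
        by (rule continuous_Re[OF isc[OF that x]])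
    qed
    then show "isCont (\<lambda>x. Re (?M x)) x" by (rule has_derivative_continuous)
    have "((\<lambda>x. Im (?M x)) has_derivative (\<lambda>h. \<Sum>b\<in>Basis. (h \<bullet> b) * Im (iter_deriv [b] ?M x))) (at x)"
    proof (rule has_derivative_of_continuous_partials[OF op x])
      show "((\<lambda>t. Im (?M (y + t *\<^sub>R b))) has_real_derivative Im (iter_deriv [b] ?M y)) (at 0)"
        if "b \<in> Basis" "y \<in> dom" for b y
        using bounded_linear.has_vector_derivative[OF bounded_linear_Im first_partials(1)[OF that, of \<phi>]]
        by (simp add: has_real_derivative_iff_has_vector_derivative)
      show "isCont (\<lambda>x. Im (iter_deriv [b] ?M x)) x" if "b \<in> Basis" for b
        by (rule continuous_Im[OF isc[OF that x]])
    qed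
    then show "isCont (\<lambda>x. Im (?M x)) x" by (rule has_derivative_continuous)
  qed
  then have "isCont (\<lambda>x. complex_of_real (Re (?M x)) + \<i> * complex_of_real (Im (?M x))) x" if "x \<in> dom" for x
    using that by (intro continuous_intros) auto
  then have "isCont ?M x" if "x \<in> dom" for x
    using that by (simp add: complex_eq[symmetric])
  then show ?thesis by (intro continuous_at_imp_continuous_on) blast
qed

abbreviation joint_mgf :: "(real^'d) \<times> (real^'p) \<Rightarrow> complex" where
  "joint_mgf \<equiv> (\<lambda>(s, \<theta>). M0 P Y (cvec s 0) \<theta>)"

lemma second_partials:
  assumes bc: "(b \<in> range s_dir \<and> c \<in> range s_dir) \<or> (b \<in> range s_dir \<and> c \<in> range th_dir)
               \<or> (b \<in> range th_dir \<and> c \<in> range th_dir)"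
  shows "x \<in> dom \<Longrightarrow> ((\<lambda>t. Re (iter_deriv [b] joint_mgf (x + t *\<^sub>R c)))
           has_real_derivative Re (iter_deriv [c, b] joint_mgf x)) (at 0)"
    and "continuous_on dom (\<lambda>x. Re (iter_deriv [c, b] joint_mgf x))"
proof -
  obtain "is" :: "'p list" and js :: "'d list" where
    eq: "[c, b] = map th_dir is @ map s_dir js" and "length is + length js = 2"
  proof -
    from bc consider j i where "b = s_dir j" "c = s_dir i" | j i where "b = s_dir j" "c = th_dir i"
       | j i where "b = th_dir j" "c = th_dir i" by blast
    then show ?thesis
    proof cases
      case 1 then show ?thesis using that[of "[]" "[i, j]"] by simp
    next
      case 2 then show ?thesis using that[of "[i]" "[j]"] by simp
    next
      case 3 then show ?thesis using that[of "[i, j]" "[]"] by simp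
    qed
  qed
  note g = growth_partials[OF eq, of 0]
  have "iter_deriv_exists_on dom [c, b] joint_mgf"
    by (rule g(1)) (use \<open>length is + length js = 2\<close> in linarith)
  then have "x \<in> dom \<Longrightarrow> ((\<lambda>t. iter_deriv [b] joint_mgf (x + t *\<^sub>R c))
           has_vector_derivative iter_deriv [c, b] joint_mgf x) (at 0)"
    by (simp add: dir_deriv_def vector_derivative_works[symmetric])
  then show "x \<in> dom \<Longrightarrow> ((\<lambda>t. Re (iter_deriv [b] joint_mgf (x + t *\<^sub>R c)))
           has_real_derivative Re (iter_deriv [c, b] joint_mgf x)) (at 0)"
    using bounded_linear.has_vector_derivative[OF bounded_linear_Re]
    by (simp add: has_real_derivative_iff_has_vector_derivative)
  have "continuous_on dom (iter_deriv [c, b] joint_mgf)"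
    by (rule g(2)) (use \<open>length is + length js = 2\<close> in linarith)
  then show "continuous_on dom (\<lambda>x. Re (iter_deriv [c, b] joint_mgf x))" by (rule continuous_on_Re)
qed

definition mgf_partial :: "(real^'d) \<times> (real^'p) \<Rightarrow> (real^'d) \<times> (real^'p) \<Rightarrow> real" where
  "mgf_partial b x = Re (iter_deriv [b] joint_mgf x)"

text \<open>
  The growth condition provides the second derivatives in which \<open>s\<close> is differentiated before
  \<open>\<theta>\<close>; in the opposite order the value is the one given by \<open>mixed_partials_commute\<close>.
\<close>

definition mgf_partial2 :: "(real^'d) \<times> (real^'p) \<Rightarrow> (real^'d) \<times> (real^'p) \<Rightarrow> (real^'d) \<times> (real^'p) \<Rightarrow> real" where
  "mgf_partial2 c b x = (if c \<in> range s_dir \<and> b \<in> range th_dir then Re (iter_deriv [b, c] joint_mgf x)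
               else Re (iter_deriv [c, b] joint_mgf x))"

lemma mgf_partial_derivative:
  assumes "b \<in> Basis" "x \<in> dom"
  shows "((\<lambda>t. Re (joint_mgf (x + t *\<^sub>R b))) has_real_derivative mgf_partial b x) (at 0)"
  using bounded_linear.has_vector_derivative[OF bounded_linear_Re first_partials(1)[OF assms, of 0]]
  by (simp add: has_real_derivative_iff_has_vector_derivative mgf_partial_def)

lemma mgf_partial2_derivative:
  assumes b: "b \<in> Basis" and c: "c \<in> Basis" and x: "x \<in> dom"
  shows "((\<lambda>t. mgf_partial b (x + t *\<^sub>R c)) has_real_derivative mgf_partial2 c b x) (at 0)"
proof (cases "c \<in> range s_dir \<and> b \<in> range th_dir")
  case True
  have isc: "isCont (\<lambda>x. Re (iter_deriv [b, c] joint_mgf x)) x"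
    using second_partials(2)[of c b] True x by (simp add: continuous_on_eq_continuous_at)
  have "((\<lambda>t. mgf_partial b (x + t *\<^sub>R c)) has_real_derivative Re (iter_deriv [b, c] joint_mgf x)) (at 0)"
  proof (rule mixed_partials_commute[OF _ x, where f = "\<lambda>x. Re (joint_mgf x)"])
    show "((\<lambda>t. mgf_partial c (y + t *\<^sub>R b)) has_real_derivative Re (iter_deriv [b, c] joint_mgf y)) (at 0)" if "y \<in> dom" for y
      using second_partials(1)[of c b y] True that by (simp add: mgf_partial_def)
  qed (use mgf_partial_derivative b c isc in auto)
  then show ?thesis using True by (simp add: mgf_partial2_def)
next
  case False
  then have "(b \<in> range s_dir \<and> c \<in> range s_dir) \<or> (b \<in> range s_dir \<and> c \<in> range th_dir)
               \<or> (b \<in> range th_dir \<and> c \<in> range th_dir)"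
    using b c unfolding Basis_dirs by blast
  from second_partials(1)[OF this x] show ?thesis unfolding mgf_partial2_def if_not_P[OF False] mgf_partial_def .
qed

lemma mgf_partial2_continuous:
  assumes b: "b \<in> Basis" and c: "c \<in> Basis"
  shows "continuous_on dom (mgf_partial2 c b)"
proof (cases "c \<in> range s_dir \<and> b \<in> range th_dir")
  case True
  then show ?thesis using second_partials(2)[of c b] by (simp add: mgf_partial2_def[abs_def])
next
  case False
  then have "(b \<in> range s_dir \<and> c \<in> range s_dir) \<or> (b \<in> range s_dir \<and> c \<in> range th_dir)
               \<or> (b \<in> range th_dir \<and> c \<in> range th_dir)"
    using b c unfolding Basis_dirs by blast
  from second_partials(2)[OF this] show ?thesis unfolding mgf_partial2_def if_not_P[OF False] .
qed

lemma mgf_partial2_symmetric: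
  assumes b: "b \<in> Basis" and c: "c \<in> Basis" and x: "x \<in> dom"
  shows "mgf_partial2 c b x = mgf_partial2 b c x"
proof -
  have "((\<lambda>t. mgf_partial c (x + t *\<^sub>R b)) has_real_derivative mgf_partial2 c b x) (at 0)"
  proof (rule mixed_partials_commute[OF open_interior x, where f = "\<lambda>x. Re (joint_mgf x)"])
    show "isCont (mgf_partial2 c b) x"
      using mgf_partial2_continuous[OF b c] x by (simp add: continuous_on_eq_continuous_at)
  qed (erule mgf_partial_derivative[OF b] mgf_partial_derivative[OF c] mgf_partial2_derivative[OF b c])+
  from DERIV_unique[OF this mgf_partial2_derivative[OF c b x]] show ?thesis .
qed

lemma mgf_partial_continuous:
  assumes b: "b \<in> Basis" shows "continuous_on dom (mgf_partial b)"
  unfolding mgf_partial_def by (rule continuous_on_Re[OF first_partials(2)[OF b]])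

lemma joint_mgf_continuous: "continuous_on dom (\<lambda>x. Re (joint_mgf x))"
  by (rule continuous_on_Re[OF M0_continuous])

lemma joint_mgf_pos: "x \<in> dom \<Longrightarrow> 0 < Re (joint_mgf x)"
  using mgf_law_pos dom_R by (cases x) (auto simp: M0_real)

lemma K_log: "x \<in> dom \<Longrightarrow> K x = ln (Re (joint_mgf x))"
  by (cases x) (simp add: K0_def)

lemma
  assumes b: "b \<in> Basis" and c: "c \<in> Basis" and x: "x \<in> dom"
  shows K_partial: "((\<lambda>t. K (x + t *\<^sub>R b)) has_real_derivative iter_deriv [b] K x) (at 0)"
    and K_partial_eq: "iter_deriv [b] K x = mgf_partial b x / Re (joint_mgf x)"
    and K_partial2: "((\<lambda>t. iter_deriv [b] K (x + t *\<^sub>R c)) has_real_derivative iter_deriv [c, b] K x) (at 0)"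
    and K_partial2_eq: "iter_deriv [c, b] K x = mgf_partial2 c b x / Re (joint_mgf x) - mgf_partial b x * mgf_partial c x / (Re (joint_mgf x))\<^sup>2"
  by (rule log_partial_derivatives[where D = dom and B = Basis and m = "\<lambda>x. Re (joint_mgf x)" and md = mgf_partial and mdd = mgf_partial2
        and K = K and b = b and c = c and x = x];
      (erule joint_mgf_pos K_log | erule (1) mgf_partial_derivative | erule (2) mgf_partial2_derivative | rule open_interior b c x))+

lemma K_partial2_symmetric:
  assumes "b \<in> Basis" "c \<in> Basis" "x \<in> dom"
  shows "iter_deriv [c, b] K x = iter_deriv [b, c] K x"
  unfolding K_partial2_eq[OF assms] K_partial2_eq[OF assms(2,1,3)] mgf_partial2_symmetric[OF assms] by simp

lemma K_partial2_continuous: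
  assumes "b \<in> Basis" "c \<in> Basis"
  shows "continuous_on dom (iter_deriv [c, b] K)"
proof -
  have "continuous_on dom (\<lambda>x. mgf_partial2 c b x / Re (joint_mgf x) - mgf_partial b x * mgf_partial c x / (Re (joint_mgf x))\<^sup>2)"
    using joint_mgf_pos by (intro continuous_intros mgf_partial2_continuous mgf_partial_continuous joint_mgf_continuous assms) force+
  then show ?thesis by (rule continuous_on_eq) (simp only: K_partial2_eq[OF assms])
qed

lemma K_partial_continuous:
  assumes "b \<in> Basis"
  shows "continuous_on dom (iter_deriv [b] K)"
proof -
  have "continuous_on dom (\<lambda>x. mgf_partial b x / Re (joint_mgf x))"
    using joint_mgf_pos by (intro continuous_intros mgf_partial_continuous joint_mgf_continuous assms) force
  then show ?thesis by (rule continuous_on_eq) (simp only: K_partial_eq[OF assms assms])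
qed

lemma K_has_derivative:
  assumes x: "x \<in> dom"
  shows "(K has_derivative (\<lambda>h. \<Sum>b\<in>Basis. (h \<bullet> b) * iter_deriv [b] K x)) (at x)"
proof (rule has_derivative_of_continuous_partials[OF _ x])
  show "isCont (iter_deriv [b] K) x" if "b \<in> Basis" for b
    using K_partial_continuous[OF that] x by (simp add: continuous_on_eq_continuous_at del: iter_deriv.simps)
  show "((\<lambda>t. K (y + t *\<^sub>R b)) has_real_derivative iter_deriv [b] K y) (at 0)" if "b \<in> Basis" "y \<in> dom" for b y
    by (rule K_partial[OF that(1,1,2)])
qed (rule open_interior)

lemma K_partial_has_derivative:
  assumes b: "b \<in> Basis" and x: "x \<in> dom"
  shows "(iter_deriv [b] K has_derivative (\<lambda>h. \<Sum>c\<in>Basis. (h \<bullet> c) * iter_deriv [c, b] K x)) (at x)"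
proof (rule has_derivative_of_continuous_partials[OF _ x, where D = "\<lambda>c. iter_deriv [c, b] K"])
  show "isCont (iter_deriv [c, b] K) x" if "c \<in> Basis" for c
    using K_partial2_continuous[OF b that] x by (simp add: continuous_on_eq_continuous_at del: iter_deriv.simps)
qed (rule open_interior, erule (1) K_partial2[OF b])

lemma K_continuous: "continuous_on dom K"
  by (intro continuous_at_imp_continuous_on ballI has_derivative_continuous[OF K_has_derivative])

end

section \<open>The saddlepoint\<close>

context saddlepoint_model
begin

lemma inner_grad_s: "v \<bullet> grad_s_K0 P Y s \<theta> = (\<Sum>j\<in>UNIV. v $ j * iter_deriv [s_dir j] K (s, \<theta>))"
  by (simp add: grad_s_K0_def inner_vec_def)

lemma inner_hess_s: "v \<bullet> (hess_s_K0 P Y s \<theta> *v w)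
    = (\<Sum>i\<in>UNIV. \<Sum>j\<in>UNIV. v $ i * w $ j * iter_deriv [s_dir i, s_dir j] K (s, \<theta>))"
  by (simp add: hess_s_K0_def inner_vec_def matrix_vector_mult_def sum_distrib_left mult_ac)

lemma dirs_Basis [simp]: "s_dir j \<in> Basis" "th_dir i \<in> Basis"
  unfolding Basis_dirs by auto

lemma has_derivative_line:
  fixes f :: "'a::real_normed_vector \<Rightarrow> real"
  assumes "(f has_derivative f') (at x)"
  shows "((\<lambda>t. f (x + t *\<^sub>R v)) has_real_derivative f' v) (at 0)"
proof -
  have lin: "linear f'" using assms has_derivative_linear by blast
  have "((\<lambda>t. f (x + t *\<^sub>R v)) has_derivative (\<lambda>t. f' (t *\<^sub>R v))) (at 0)"
    by (rule has_derivative_compose[of "\<lambda>t. x + t *\<^sub>R v" "\<lambda>t. t *\<^sub>R v" 0 UNIV f f'])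
       (use assms in \<open>auto intro!: derivative_eq_intros\<close>)
  moreover have "(\<lambda>t. f' (t *\<^sub>R v)) = (*) (f' v)" by (auto simp: linear_scale[OF lin])
  ultimately show ?thesis by (simp add: has_field_derivative_def)
qed

text \<open>
  The derivative of \<open>t \<mapsto> K\<^sub>0 (s + t v; \<theta>)\<close> is computed twice: from the partial derivatives, and by
  differentiation under the integral.
\<close>

lemma grad_s_tilted_mean:
  assumes x: "(s, \<theta>) \<in> dom"
  shows "v \<bullet> grad_s_K0 P Y s \<theta> = (LINT y|law \<theta>. exp (s \<bullet> y) * (v \<bullet> y)) / mgf (law \<theta>) s"
proof -
  interpret E: euclidean_law "law \<theta>" by (rule law[OF dom_R[OF x]])
  have Z: "0 < mgf (law \<theta>) s" by (rule mgf_law_pos[OF x])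
  have "((\<lambda>t. K ((s, \<theta>) + t *\<^sub>R (v, 0))) has_real_derivative (\<Sum>b\<in>Basis. ((v, 0) \<bullet> b) * iter_deriv [b] K (s, \<theta>))) (at 0)"
    by (rule has_derivative_line[OF K_has_derivative[OF x]])
  then have 1: "((\<lambda>t. K ((s, \<theta>) + t *\<^sub>R (v, 0))) has_real_derivative v \<bullet> grad_s_K0 P Y s \<theta>) (at 0)"
    by (simp add: sum_Basis_dirs inner_grad_s del: iter_deriv.simps)
  have "((\<lambda>t. mgf (law \<theta>) (s + t *\<^sub>R v)) has_real_derivative (LINT y|law \<theta>. exp (s \<bullet> y) * (v \<bullet> y))) (at 0)"
    using E.mgf_line_derivative[OF dom_slice[OF x], of v 0] by (simp add: mgf_def)
  then have 2: "((\<lambda>t. ln (mgf (law \<theta>) (s + t *\<^sub>R v))) has_real_derivative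
      (LINT y|law \<theta>. exp (s \<bullet> y) * (v \<bullet> y)) / mgf (law \<theta>) s) (at 0)"
    using Z by (auto intro!: derivative_eq_intros)
  have "((\<lambda>t. K ((s, \<theta>) + t *\<^sub>R (v, 0))) has_real_derivative
      (LINT y|law \<theta>. exp (s \<bullet> y) * (v \<bullet> y)) / mgf (law \<theta>) s) (at 0)"
  proof (rule has_real_derivative_line_cong[OF open_interior x, where f = "\<lambda>(s, \<theta>). ln (mgf (law \<theta>) s)"])
    show "(case y of (s, \<theta>) \<Rightarrow> ln (mgf (law \<theta>) s)) = K y" if "y \<in> dom" for y
      using K_eq that by (cases y) auto
  qed (use 2 in simp)
  from DERIV_unique[OF 1 this] show ?thesis .
qed

text \<open>
  The same double computation, now for the derivative of \<open>t \<mapsto> v \<bullet> K\<^sub>0' (s + t v; \<theta>)\<close>.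
\<close>

lemma hess_s_tilted_second_moment:
  assumes x: "(s, \<theta>) \<in> dom"
  shows "v \<bullet> (hess_s_K0 P Y s \<theta> *v v) = (LINT y|law \<theta>. exp (s \<bullet> y) * (v \<bullet> y)\<^sup>2) / mgf (law \<theta>) s
     - ((LINT y|law \<theta>. exp (s \<bullet> y) * (v \<bullet> y)) / mgf (law \<theta>) s)\<^sup>2"
proof -
  interpret E: euclidean_law "law \<theta>" by (rule law[OF dom_R[OF x]])
  have Z: "0 < mgf (law \<theta>) s" by (rule mgf_law_pos[OF x])
  let ?D = "\<lambda>x. \<Sum>j\<in>UNIV. v $ j * iter_deriv [s_dir j] K x"
  have "((\<lambda>t. ?D ((s, \<theta>) + t *\<^sub>R (v, 0))) has_real_derivative
     (\<Sum>j\<in>UNIV. v $ j * (\<Sum>c\<in>Basis. ((v, 0) \<bullet> c) * iter_deriv [c, s_dir j] K (s, \<theta>)))) (at 0)"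
    by (intro DERIV_sum DERIV_cmult has_derivative_line[OF K_partial_has_derivative[OF _ x]]) simp
  moreover have "(\<Sum>j\<in>UNIV. v $ j * (\<Sum>c\<in>Basis. ((v, 0) \<bullet> c) * iter_deriv [c, s_dir j] K (s, \<theta>)))
      = v \<bullet> (hess_s_K0 P Y s \<theta> *v v)"
    unfolding inner_hess_s
    by (subst sum.swap) (simp add: sum_Basis_dirs sum_distrib_left mult_ac del: iter_deriv.simps)
  ultimately have 1: "((\<lambda>t. ?D ((s, \<theta>) + t *\<^sub>R (v, 0))) has_real_derivative v \<bullet> (hess_s_K0 P Y s \<theta> *v v)) (at 0)"
    by simp
  let ?E1 = "\<lambda>s. LINT y|law \<theta>. exp (s \<bullet> y) * (v \<bullet> y)"
  have "((\<lambda>t. mgf (law \<theta>) (s + t *\<^sub>R v)) has_real_derivative ?E1 s) (at 0)"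
    using E.mgf_line_derivative[OF dom_slice[OF x], of v 0] by (simp add: mgf_def)
  moreover have "((\<lambda>t. ?E1 (s + t *\<^sub>R v)) has_real_derivative (LINT y|law \<theta>. exp (s \<bullet> y) * (v \<bullet> y)\<^sup>2)) (at 0)"
    using E.mgf_line_derivative[OF dom_slice[OF x], of v 1] by (simp add: numeral_2_eq_2)
  ultimately have 2: "((\<lambda>t. ?E1 (s + t *\<^sub>R v) / mgf (law \<theta>) (s + t *\<^sub>R v)) has_real_derivative
     (LINT y|law \<theta>. exp (s \<bullet> y) * (v \<bullet> y)\<^sup>2) / mgf (law \<theta>) s - (?E1 s / mgf (law \<theta>) s)\<^sup>2) (at 0)"
    using Z by (auto intro!: derivative_eq_intros simp: power2_eq_square diff_divide_distrib)
  have "((\<lambda>t. ?D ((s, \<theta>) + t *\<^sub>R (v, 0))) has_real_derivative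
     (LINT y|law \<theta>. exp (s \<bullet> y) * (v \<bullet> y)\<^sup>2) / mgf (law \<theta>) s - (?E1 s / mgf (law \<theta>) s)\<^sup>2) (at 0)"
  proof (rule has_real_derivative_line_cong[OF open_interior x,
        where f = "\<lambda>(s, \<theta>). (LINT y|law \<theta>. exp (s \<bullet> y) * (v \<bullet> y)) / mgf (law \<theta>) s"])
    show "(case y of (s, \<theta>) \<Rightarrow> (LINT y|law \<theta>. exp (s \<bullet> y) * (v \<bullet> y)) / mgf (law \<theta>) s) = ?D y" if "y \<in> dom" for y
      using that grad_s_tilted_mean[of "fst y" "snd y" v] by (cases y) (simp add: inner_grad_s del: iter_deriv.simps)
  qed (use 2 in simp)
  from DERIV_unique[OF 1 this] show ?thesis .
qed

lemma hess_s_symmetric: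
  assumes x: "(s, \<theta>) \<in> dom"
  shows "transpose (hess_s_K0 P Y s \<theta>) = hess_s_K0 P Y s \<theta>"
  using K_partial2_symmetric[OF _ _ x]
  by (simp add: hess_s_K0_def transpose_def vec_eq_iff del: iter_deriv.simps)

lemma hess_th_symmetric:
  assumes x: "(s, \<theta>) \<in> dom"
  shows "transpose (hess_th_K0 P Y s \<theta>) = hess_th_K0 P Y s \<theta>"
  using K_partial2_symmetric[OF _ _ x]
  by (simp add: hess_th_K0_def transpose_def vec_eq_iff del: iter_deriv.simps)

lemma decay_bound:
  obtains \<delta> where "continuous_on dom \<delta>" "\<And>x. x \<in> dom \<Longrightarrow> 0 < \<delta> x"
    "\<And>s \<theta> \<phi>. (s, \<theta>) \<in> dom \<Longrightarrow>
       norm (mchar (tilt (law \<theta>) s) \<phi>) \<le> (1 + \<delta> (s, \<theta>) * (norm \<phi>)\<^sup>2) powr (- \<delta> (s, \<theta>))"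
  using decay mchar_tilt_law unfolding decay_condition_def by (force intro: that)

lemma mchar_tilt_less_1:
  assumes x: "(s, \<theta>) \<in> dom" and \<phi>: "\<phi> \<noteq> 0"
  shows "norm (mchar (tilt (law \<theta>) s) \<phi>) < 1"
proof -
  obtain \<delta> where \<delta>: "\<And>x. x \<in> dom \<Longrightarrow> 0 < \<delta> x"
    "\<And>s \<theta> \<phi>. (s, \<theta>) \<in> dom \<Longrightarrow>
       norm (mchar (tilt (law \<theta>) s) \<phi>) \<le> (1 + \<delta> (s, \<theta>) * (norm \<phi>)\<^sup>2) powr (- \<delta> (s, \<theta>))"
    using decay_bound by metis
  have "1 < 1 + \<delta> (s, \<theta>) * (norm \<phi>)\<^sup>2" using \<delta>(1)[OF x] \<phi> by simp
  then have "(1 + \<delta> (s, \<theta>) * (norm \<phi>)\<^sup>2) powr (- \<delta> (s, \<theta>)) < (1 + \<delta> (s, \<theta>) * (norm \<phi>)\<^sup>2) powr 0"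
    using \<delta>(1)[OF x] by (intro powr_less_mono) auto
  then show ?thesis using \<delta>(2)[OF x, of \<phi>] \<open>1 < 1 + _\<close> by simp
qed

lemma tilted_moments:
  assumes x: "(s, \<theta>) \<in> dom" and c: "grad_s_K0 P Y s \<theta> = c"
  shows "(LINT y|tilt (law \<theta>) s. v \<bullet> (y - c)) = 0"
    and "(LINT y|tilt (law \<theta>) s. (v \<bullet> (y - c))\<^sup>2) = v \<bullet> (hess_s_K0 P Y s \<theta> *v v)"
    and "integrable (tilt (law \<theta>) s) (\<lambda>y. (v \<bullet> (y - c))\<^sup>2)"
proof -
  interpret E: euclidean_law "law \<theta>" by (rule law[OF dom_R[OF x]])
  have sd: "s \<in> mgf_domain (law \<theta>)" by (rule dom_mgf[OF x])
  interpret Q: euclidean_law "tilt (law \<theta>) s" by (rule E.euclidean_law_tilt[OF sd])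
  have Z: "0 < mgf (law \<theta>) s" by (rule mgf_law_pos[OF x])
  have i1: "integrable (tilt (law \<theta>) s) (\<lambda>y. v \<bullet> y)"
    using E.integrable_inner_power[OF dom_slice[OF x], of v 1] by (subst E.integrable_tilt[OF sd]) auto
  have i2: "integrable (tilt (law \<theta>) s) (\<lambda>y. (v \<bullet> y)\<^sup>2)"
    using E.integrable_inner_power[OF dom_slice[OF x], of v 2] by (subst E.integrable_tilt[OF sd]) auto
  have e1: "(LINT y|tilt (law \<theta>) s. v \<bullet> y) = v \<bullet> c"
    unfolding c[symmetric] grad_s_tilted_mean[OF x] by (subst E.integral_tilt[OF sd]) (auto simp: divide_inverse)
  have e2: "(LINT y|tilt (law \<theta>) s. (v \<bullet> y)\<^sup>2) = (LINT y|law \<theta>. exp (s \<bullet> y) * (v \<bullet> y)\<^sup>2) / mgf (law \<theta>) s"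
    by (subst E.integral_tilt[OF sd]) (auto simp: divide_inverse)
  have hess: "v \<bullet> (hess_s_K0 P Y s \<theta> *v v) = (LINT y|tilt (law \<theta>) s. (v \<bullet> y)\<^sup>2) - (v \<bullet> c)\<^sup>2"
    unfolding hess_s_tilted_second_moment[OF x] e2 using grad_s_tilted_mean[OF x, of v] c by simp
  have sq: "(v \<bullet> (y - c))\<^sup>2 = (v \<bullet> y)\<^sup>2 - 2 * (v \<bullet> c) * (v \<bullet> y) + (v \<bullet> c)\<^sup>2" for y
    by (simp add: inner_diff_right power2_diff)
  show "(LINT y|tilt (law \<theta>) s. v \<bullet> (y - c)) = 0"
    using i1 e1 by (simp add: inner_diff_right Q.prob_space)
  show "integrable (tilt (law \<theta>) s) (\<lambda>y. (v \<bullet> (y - c))\<^sup>2)"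
    unfolding sq using i1 i2 by auto
  show "(LINT y|tilt (law \<theta>) s. (v \<bullet> (y - c))\<^sup>2) = v \<bullet> (hess_s_K0 P Y s \<theta> *v v)"
    unfolding sq hess using i1 i2 e1 Q.prob_space by (simp add: power2_eq_square)
qed

lemma hess_s_pos_def:
  assumes x: "(s, \<theta>) \<in> dom" and v: "v \<noteq> 0"
  shows "0 < v \<bullet> (hess_s_K0 P Y s \<theta> *v v)"
proof -
  interpret Q: euclidean_law "tilt (law \<theta>) s"
    by (rule euclidean_law.euclidean_law_tilt[OF law[OF dom_R[OF x]] dom_mgf[OF x]])
  show ?thesis
    using Q.variance_pos[OF mchar_tilt_less_1[OF x v] tilted_moments(3)[OF x refl]]
    by (simp add: tilted_moments(2)[OF x refl])
qed

lemma K_strict_minimum: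
  assumes x: "(s, \<theta>) \<in> dom" and u: "u \<in> mgf_domain (law \<theta>)" "u \<noteq> s" and c: "grad_s_K0 P Y s \<theta> = c"
  shows "ln (mgf (law \<theta>) s) - s \<bullet> c < ln (mgf (law \<theta>) u) - u \<bullet> c"
proof (rule euclidean_law.tilted_mean_strict_minimum[OF law[OF dom_R[OF x]] dom_mgf[OF x] u])
  interpret E: euclidean_law "law \<theta>" by (rule law[OF dom_R[OF x]])
  show "integrable (law \<theta>) (\<lambda>y. exp (s \<bullet> y) * ((u - s) \<bullet> y))"
    using E.integrable_inner_power[OF dom_slice[OF x], of "u - s" 1] by simp
  show "(LINT y|law \<theta>. exp (s \<bullet> y) * ((u - s) \<bullet> y)) = mgf (law \<theta>) s * ((u - s) \<bullet> c)"
    using grad_s_tilted_mean[OF x, of "u - s"] mgf_law_pos[OF x] by (simp add: c)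
  show "norm (mchar (tilt (law \<theta>) s) (u - s)) < 1"
    using u by (intro mchar_tilt_less_1[OF x]) auto
qed

lemma saddlepoint_unique:
  assumes "(s, \<theta>) \<in> dom" "grad_s_K0 P Y s \<theta> = c" "(u, \<theta>) \<in> dom" "grad_s_K0 P Y u \<theta> = c"
  shows "u = s"
  using K_strict_minimum[OF assms(1) dom_mgf[OF assms(3)] _ assms(2)]
    K_strict_minimum[OF assms(3) dom_mgf[OF assms(1)] _ assms(4)] by fastforce

lemma saddlepoint_eqI:
  assumes "(s, \<theta>) \<in> dom" "grad_s_K0 P Y s \<theta> = c"
  shows "saddlepoint R P Y \<theta> c = s"
  unfolding saddlepoint_def using assms saddlepoint_unique by (intro the_equality) auto

lemma grad_s_zero_at_local_minimum:
  assumes x: "(s, \<theta>) \<in> dom" and r: "0 < r"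
    and min: "\<And>u. dist u s < r \<Longrightarrow> K (s, \<theta>) - s \<bullet> c \<le> K (u, \<theta>) - u \<bullet> c"
  shows "grad_s_K0 P Y s \<theta> = c"
proof -
  have "iter_deriv [s_dir j] K (s, \<theta>) = c $ j" for j
  proof -
    have "((\<lambda>t. K ((s, \<theta>) + t *\<^sub>R s_dir j)) has_real_derivative iter_deriv [s_dir j] K (s, \<theta>)) (at 0)"
      by (rule K_partial[OF dirs_Basis(1) dirs_Basis(1) x])
    then have "((\<lambda>t. K (s + t *\<^sub>R axis j 1, \<theta>)) has_real_derivative iter_deriv [s_dir j] K (s, \<theta>)) (at 0)"
      by (simp add: s_dir_def del: iter_deriv.simps)
    moreover have "((\<lambda>t. (s + t *\<^sub>R axis j 1) \<bullet> c) has_real_derivative c $ j) (at 0)"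
      by (auto intro!: derivative_eq_intros simp: inner_add_left inner_axis')
    ultimately have "((\<lambda>t. K (s + t *\<^sub>R axis j 1, \<theta>) - (s + t *\<^sub>R axis j 1) \<bullet> c) has_real_derivative
       iter_deriv [s_dir j] K (s, \<theta>) - c $ j) (at 0)" by (rule DERIV_diff)
    from DERIV_local_min[OF this r] show ?thesis
      using min by (simp add: dist_norm del: iter_deriv.simps)
  qed
  then show ?thesis by (simp add: grad_s_K0_def vec_eq_iff del: iter_deriv.simps)
qed

text \<open>
  On a small sphere around the saddlepoint \<open>s1\<close> of \<open>\<theta>1\<close> the function
  \<open>K\<^sub>0 (s; \<theta>) - s \<bullet> c\<close> exceeds its value at \<open>s1\<close>, by strict minimality at \<open>\<theta> = \<theta>1\<close> and by
  compactness for \<open>\<theta>\<close> near \<open>\<theta>1\<close>. Its minimum over the ball is then attained in the interior,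
  where the gradient vanishes. As the ball can be arbitrarily small and saddlepoints are unique,
  existence and continuity come together.
\<close>

lemma saddlepoint_exists_near:
  assumes x1: "(s1, \<theta>1) \<in> dom" and c: "grad_s_K0 P Y s1 \<theta>1 = c" and e: "0 < e"
  shows "\<exists>r>0. \<forall>\<theta>. dist \<theta> \<theta>1 < r \<longrightarrow> (\<exists>s. dist s s1 < e \<and> (s, \<theta>) \<in> dom \<and> grad_s_K0 P Y s \<theta> = c)"
proof -
  obtain A B where AB': "open A" "open B" "(s1, \<theta>1) \<in> A \<times> B" "A \<times> B \<subseteq> dom"
    by (rule open_prod_elim[OF open_interior x1])
  then have AB: "open A" "open B" "s1 \<in> A" "\<theta>1 \<in> B" "A \<times> B \<subseteq> dom" by auto
  obtain r1 where r1: "0 < r1" "cball s1 r1 \<subseteq> A" using bspec[OF AB(1)[unfolded open_contains_cball] AB(3)] by (elim exE conjE) (rule that)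
  obtain r2 where r2: "0 < r2" "cball \<theta>1 r2 \<subseteq> B" using bspec[OF AB(2)[unfolded open_contains_cball] AB(4)] by (elim exE conjE) (rule that)
  define \<rho> where "\<rho> = min r1 (e / 2)"
  have \<rho>: "0 < \<rho>" "\<rho> \<le> r1" "\<rho> < e" using r1 e by (auto simp: \<rho>_def)
  have sub: "cball s1 \<rho> \<times> cball \<theta>1 r2 \<subseteq> dom" using AB(5) r1(2) r2(2) \<rho>(2) by (auto simp: subset_iff)
  let ?F = "\<lambda>(s, \<theta>). K (s, \<theta>) - s \<bullet> c"
  let ?G = "\<lambda>(s, \<theta>). (K (s, \<theta>) - s \<bullet> c) - (K (s1, \<theta>) - s1 \<bullet> c)"
  have Fcont: "continuous_on (cball s1 \<rho> \<times> cball \<theta>1 r2) ?F"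
  proof -
    have "continuous_on (cball s1 \<rho> \<times> cball \<theta>1 r2) (\<lambda>x. K x - fst x \<bullet> c)"
      by (intro continuous_intros continuous_on_subset[OF K_continuous sub])
    then show ?thesis by (simp add: case_prod_unfold)
  qed
  have Kc1: "continuous_on (cball \<theta>1 r2) (\<lambda>\<theta>. K0 P Y s1 \<theta>)"
  proof -
    have im: "(\<lambda>\<theta>. (s1, \<theta>)) ` cball \<theta>1 r2 \<subseteq> dom"
    proof safe
      fix \<theta> assume "\<theta> \<in> cball \<theta>1 r2"
      then have "(s1, \<theta>) \<in> cball s1 \<rho> \<times> cball \<theta>1 r2" using \<rho> by simp
      then show "(s1, \<theta>) \<in> dom" using sub by blast
    qed
    have "continuous_on (cball \<theta>1 r2) (\<lambda>\<theta>. (s1, \<theta>))" by (intro continuous_intros)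
    from continuous_on_compose2[OF K_continuous this im] show ?thesis by simp
  qed
  have Gcont: "continuous_on (sphere s1 \<rho> \<times> cball \<theta>1 r2) ?G"
  proof -
    have "continuous_on (sphere s1 \<rho> \<times> cball \<theta>1 r2) (\<lambda>x. ?F x - (K0 P Y s1 (snd x) - s1 \<bullet> c))"
      by (intro continuous_on_diff continuous_on_subset[OF Fcont] continuous_on_compose2[OF Kc1] continuous_intros) auto
    then show ?thesis by (simp add: case_prod_unfold)
  qed
  have comp: "compact (sphere s1 \<rho> \<times> cball \<theta>1 r2)" by (intro compact_Times) auto
  have pos: "0 < ?G (s, \<theta>1)" if "s \<in> sphere s1 \<rho>" for s
  proof -
    have "(s, \<theta>1) \<in> dom" using sub that r2 by auto
    then show ?thesis
      using K_strict_minimum[OF x1 dom_mgf, of s c] c that \<rho> K_eq[OF x1] K_eq[of s \<theta>1] by auto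
  qed
  obtain m where m: "0 < m" "\<And>s. s \<in> sphere s1 \<rho> \<Longrightarrow> m \<le> ?G (s, \<theta>1)"
  proof -
    have "s1 + \<rho> *\<^sub>R axis undefined 1 \<in> sphere s1 \<rho>" using \<rho> by (simp add: dist_norm)
    then have ne: "sphere s1 \<rho> \<noteq> {}" by blast
    have "continuous_on (sphere s1 \<rho>) (\<lambda>s. ?G (s, \<theta>1))"
    proof -
      have im: "(\<lambda>s. (s, \<theta>1)) ` sphere s1 \<rho> \<subseteq> sphere s1 \<rho> \<times> cball \<theta>1 r2" using r2 by auto
      have "continuous_on (sphere s1 \<rho>) (\<lambda>s. (s, \<theta>1))" by (intro continuous_intros)
      from continuous_on_compose2[OF Gcont this im] show ?thesis .
    qed
    from continuous_attains_inf[OF compact_sphere ne this]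
    obtain s where s: "s \<in> sphere s1 \<rho>" "\<forall>t\<in>sphere s1 \<rho>. ?G (s, \<theta>1) \<le> ?G (t, \<theta>1)"
      by (elim bexE) (rule that)
    show ?thesis by (rule that[OF pos[OF s(1)] bspec[OF s(2)]])
  qed
  have "\<exists>d>0. \<forall>x\<in>sphere s1 \<rho> \<times> cball \<theta>1 r2. \<forall>y\<in>sphere s1 \<rho> \<times> cball \<theta>1 r2.
      dist y x < d \<longrightarrow> dist (?G y) (?G x) < m"
    using compact_uniformly_continuous[OF Gcont comp, unfolded uniformly_continuous_on_def, rule_format, OF m(1)] .
  then obtain r3 where r3: "0 < r3" and unif: "\<forall>x\<in>sphere s1 \<rho> \<times> cball \<theta>1 r2. \<forall>y\<in>sphere s1 \<rho> \<times> cball \<theta>1 r2.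
      dist y x < r3 \<longrightarrow> dist (?G y) (?G x) < m"
    by (elim exE conjE) (rule that)
  show ?thesis
  proof (intro exI[of _ "min r2 r3"] conjI allI impI)
    show "0 < min r2 r3" using r2 r3 by simp
    fix \<theta> assume \<theta>: "dist \<theta> \<theta>1 < min r2 r3"
    then have \<theta>2: "\<theta> \<in> cball \<theta>1 r2" by (simp add: dist_commute)
    have gpos: "0 < ?G (s, \<theta>)" if s: "s \<in> sphere s1 \<rho>" for s
    proof -
      have "dist (?G (s, \<theta>)) (?G (s, \<theta>1)) < m"
        using s \<theta>2 r2 \<theta> by (intro unif[rule_format]) (auto simp: dist_Pair_Pair)
      then show ?thesis using m(2)[OF s] by (auto simp: dist_real_def)
    qed
    have "continuous_on (cball s1 \<rho>) (\<lambda>s. ?F (s, \<theta>))"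
    proof -
      have im: "(\<lambda>s. (s, \<theta>)) ` cball s1 \<rho> \<subseteq> cball s1 \<rho> \<times> cball \<theta>1 r2" using \<theta>2 by auto
      have "continuous_on (cball s1 \<rho>) (\<lambda>s. (s, \<theta>))" by (intro continuous_intros)
      from continuous_on_compose2[OF Fcont this im] show ?thesis .
    qed
    moreover have "cball s1 \<rho> \<noteq> {}" using \<rho> by simp
    ultimately have "\<exists>s\<in>cball s1 \<rho>. \<forall>t\<in>cball s1 \<rho>. ?F (s, \<theta>) \<le> ?F (t, \<theta>)"
      by (intro continuous_attains_inf compact_cball)
    then obtain s where s: "s \<in> cball s1 \<rho>" and smin: "\<forall>t\<in>cball s1 \<rho>. ?F (s, \<theta>) \<le> ?F (t, \<theta>)"
      by (elim bexE) (rule that)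
    note s = s smin[rule_format]
    have "s \<notin> sphere s1 \<rho>"
      using gpos[of s] s(2)[of s1] \<rho> by auto
    then have sb: "s \<in> ball s1 \<rho>" using s(1) by (auto simp: less_le)
    have sd: "(s, \<theta>) \<in> dom" using sub s(1) \<theta>2 by blast
    have "grad_s_K0 P Y s \<theta> = c"
    proof (rule grad_s_zero_at_local_minimum[OF sd])
      show "0 < \<rho> - dist s1 s" using sb by simp
      fix u assume "dist u s < \<rho> - dist s1 s"
      then have "u \<in> cball s1 \<rho>" using dist_triangle[of s1 u s] by (simp add: dist_commute)
      from s(2)[OF this] show "K (s, \<theta>) - s \<bullet> c \<le> K (u, \<theta>) - u \<bullet> c" by simp
    qed
    then show "\<exists>s. dist s s1 < e \<and> (s, \<theta>) \<in> dom \<and> grad_s_K0 P Y s \<theta> = c"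
      using sd sb \<rho> by (intro exI[of _ s]) (auto simp: dist_commute)
  qed
qed

lemma saddle_domain_iff:
  "(c, \<theta>) \<in> saddle_domain R P Y \<longleftrightarrow>
     (saddlepoint R P Y \<theta> c, \<theta>) \<in> dom \<and> grad_s_K0 P Y (saddlepoint R P Y \<theta> c) \<theta> = c"
proof
  assume "(c, \<theta>) \<in> saddle_domain R P Y"
  then obtain s where "(s, \<theta>) \<in> dom" "grad_s_K0 P Y s \<theta> = c" by (auto simp: saddle_domain_def)
  then show "(saddlepoint R P Y \<theta> c, \<theta>) \<in> dom \<and> grad_s_K0 P Y (saddlepoint R P Y \<theta> c) \<theta> = c"
    using saddlepoint_eqI by metis
qed (auto simp: saddle_domain_def)

lemma open_saddle_section: "open {\<theta>. (c, \<theta>) \<in> saddle_domain R P Y}"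
  unfolding open_dist
proof safe
  fix \<theta> assume "(c, \<theta>) \<in> saddle_domain R P Y"
  then have "(saddlepoint R P Y \<theta> c, \<theta>) \<in> dom" "grad_s_K0 P Y (saddlepoint R P Y \<theta> c) \<theta> = c"
    by (simp_all add: saddle_domain_iff)
  from saddlepoint_exists_near[OF this zero_less_one]
  show "\<exists>e>0. \<forall>y. dist y \<theta> < e \<longrightarrow> y \<in> {\<theta>. (c, \<theta>) \<in> saddle_domain R P Y}"
    unfolding mem_Collect_eq saddle_domain_def prod.case by blast
qed

lemma saddlepoint_continuous:
  assumes "(c, \<theta>) \<in> saddle_domain R P Y"
  shows "isCont (\<lambda>\<theta>. saddlepoint R P Y \<theta> c) \<theta>"
  unfolding continuous_at_eps_delta
proof (intro allI impI)
  fix e :: real assume "0 < e"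
  have "(saddlepoint R P Y \<theta> c, \<theta>) \<in> dom" "grad_s_K0 P Y (saddlepoint R P Y \<theta> c) \<theta> = c"
    using assms by (simp_all add: saddle_domain_iff)
  from saddlepoint_exists_near[OF this \<open>0 < e\<close>]
  obtain r where r: "0 < r" "\<forall>\<theta>'. dist \<theta>' \<theta> < r \<longrightarrow>
     (\<exists>s. dist s (saddlepoint R P Y \<theta> c) < e \<and> (s, \<theta>') \<in> dom \<and> grad_s_K0 P Y s \<theta>' = c)"
    by (elim exE conjE) (rule that)
  then show "\<exists>d>0. \<forall>x'. dist x' \<theta> < d \<longrightarrow> dist (saddlepoint R P Y x' c) (saddlepoint R P Y \<theta> c) < e"
    using saddlepoint_eqI by (intro exI[of _ r]) metis
qed

lemma K0_second_order_taylor: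
  assumes x: "(s0, \<theta>0) \<in> dom" and e: "0 < e"
  shows "\<exists>r>0. \<forall>a w. norm (a, w) < r \<longrightarrow>
    \<bar>K (s0 + a, \<theta>0 + w) - K (s0, \<theta>0) - a \<bullet> grad_s_K0 P Y s0 \<theta>0 - w \<bullet> grad_th_K0 P Y s0 \<theta>0
      - (a \<bullet> (hess_s_K0 P Y s0 \<theta>0 *v a) + 2 * (a \<bullet> (mixed_K0 P Y s0 \<theta>0 *v w))
         + w \<bullet> (hess_th_K0 P Y s0 \<theta>0 *v w)) / 2\<bar> \<le> e * ((norm a)\<^sup>2 + (norm w)\<^sup>2)"
proof -
  let ?x = "(s0, \<theta>0)"
  obtain r where r: "0 < r" "\<And>h. norm h < r \<Longrightarrow>
    \<bar>K (?x + h) - K ?x - (\<Sum>b\<in>Basis. (h \<bullet> b) * iter_deriv [b] K ?x) -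
       (\<Sum>b\<in>Basis. \<Sum>c\<in>Basis. (h \<bullet> b) * (h \<bullet> c) * iter_deriv [c, b] K ?x) / 2\<bar> \<le> e * (norm h)\<^sup>2"
    using second_order_taylor[of dom ?x K "\<lambda>b. iter_deriv [b] K" "\<lambda>c b. iter_deriv [c, b] K ?x", OF open_interior x
        K_has_derivative K_partial_has_derivative[OF _ x] e] by blast
  show ?thesis
  proof (intro exI[of _ r] conjI allI impI r(1))
    fix a :: "real^'d" and w :: "real^'p" assume n: "norm (a, w) < r"
    have 1: "(\<Sum>b\<in>Basis. ((a, w) \<bullet> b) * iter_deriv [b] K ?x) = a \<bullet> grad_s_K0 P Y s0 \<theta>0 + w \<bullet> grad_th_K0 P Y s0 \<theta>0"
    proof -
      have "w \<bullet> grad_th_K0 P Y s0 \<theta>0 = (\<Sum>i\<in>UNIV. w $ i * iter_deriv [th_dir i] K ?x)"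
        by (simp add: grad_th_K0_def inner_vec_def)
      then show ?thesis by (simp add: sum_Basis_dirs inner_grad_s del: iter_deriv.simps)
    qed
    let ?k = "\<lambda>c b. iter_deriv [c, b] K ?x"
    have ss: "(\<Sum>j\<in>UNIV. \<Sum>i\<in>UNIV. a $ j * a $ i * ?k (s_dir i) (s_dir j)) = a \<bullet> (hess_s_K0 P Y s0 \<theta>0 *v a)"
      unfolding inner_hess_s by (subst sum.swap) (simp add: mult_ac del: iter_deriv.simps)
    have tt: "(\<Sum>j\<in>UNIV. \<Sum>i\<in>UNIV. w $ j * w $ i * ?k (th_dir i) (th_dir j)) = w \<bullet> (hess_th_K0 P Y s0 \<theta>0 *v w)"
      by (subst sum.swap)
         (simp add: hess_th_K0_def inner_vec_def matrix_vector_mult_def sum_distrib_left mult_ac del: iter_deriv.simps)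
    have ts: "(\<Sum>j\<in>UNIV. \<Sum>i\<in>UNIV. w $ j * a $ i * ?k (s_dir i) (th_dir j)) = a \<bullet> (mixed_K0 P Y s0 \<theta>0 *v w)"
      by (subst sum.swap)
         (simp add: mixed_K0_def inner_vec_def matrix_vector_mult_def sum_distrib_left mult_ac del: iter_deriv.simps)
    have "(\<Sum>j\<in>UNIV. \<Sum>i\<in>UNIV. a $ j * w $ i * ?k (th_dir i) (s_dir j))
        = (\<Sum>j\<in>UNIV. \<Sum>i\<in>UNIV. a $ j * w $ i * ?k (s_dir j) (th_dir i))"
      using K_partial2_symmetric[OF _ _ x] by (simp del: iter_deriv.simps)
    also have "\<dots> = a \<bullet> (mixed_K0 P Y s0 \<theta>0 *v w)"
      unfolding ts[symmetric] by (subst sum.swap) (simp add: mult_ac del: iter_deriv.simps)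
    finally have st: "(\<Sum>j\<in>UNIV. \<Sum>i\<in>UNIV. a $ j * w $ i * ?k (th_dir i) (s_dir j)) = a \<bullet> (mixed_K0 P Y s0 \<theta>0 *v w)" .
    have 2: "(\<Sum>b\<in>Basis. \<Sum>c\<in>Basis. ((a, w) \<bullet> b) * ((a, w) \<bullet> c) * ?k c b)
       = a \<bullet> (hess_s_K0 P Y s0 \<theta>0 *v a) + 2 * (a \<bullet> (mixed_K0 P Y s0 \<theta>0 *v w)) + w \<bullet> (hess_th_K0 P Y s0 \<theta>0 *v w)"
      using ss tt ts st by (simp add: sum_Basis_dirs sum.distrib del: iter_deriv.simps)
    have 3: "(norm (a, w))\<^sup>2 = (norm a)\<^sup>2 + (norm w)\<^sup>2" by (simp add: norm_Pair)
    show "\<bar>K (s0 + a, \<theta>0 + w) - K (s0, \<theta>0) - a \<bullet> grad_s_K0 P Y s0 \<theta>0 - w \<bullet> grad_th_K0 P Y s0 \<theta>0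
      - (a \<bullet> (hess_s_K0 P Y s0 \<theta>0 *v a) + 2 * (a \<bullet> (mixed_K0 P Y s0 \<theta>0 *v w))
         + w \<bullet> (hess_th_K0 P Y s0 \<theta>0 *v w)) / 2\<bar> \<le> e * ((norm a)\<^sup>2 + (norm w)\<^sup>2)"
      using r(2)[OF n] unfolding 1 2 3 by (simp add: diff_diff_eq)
  qed
qed

end

section \<open>The likelihood as a Fourier integral\<close>

lemma continuous_density_unique:
  fixes X :: "'w \<Rightarrow> real^'d"
  assumes f: "continuous_density M X f" and g: "continuous_density M X g"
  shows "f = g"
proof
  fix x
  have fc: "continuous_on UNIV f" and gc: "continuous_on UNIV g" and nn: "\<And>x. 0 \<le> f x" "\<And>x. 0 \<le> g x"
    using f g by (auto simp: continuous_density_def)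
  have "density lborel (\<lambda>x. ennreal (f x)) = density lborel (\<lambda>x. ennreal (g x))"
    using f g by (auto simp: continuous_density_def distributed_def)
  then have "AE x in lborel. ennreal (f x) = ennreal (g x)"
    using borel_measurable_continuous_onI[OF fc] borel_measurable_continuous_onI[OF gc]
    by (intro sigma_finite_measure.density_unique[OF sigma_finite_lborel]) auto
  then have "AE x in lebesgue. x \<in> {x. f x = g x}"
    by (intro AE_completion) (auto simp: nn)
  moreover have "closed {x. f x = g x}" by (intro closed_Collect_eq fc gc)
  ultimately have "x \<in> {x. f x = g x}" using mem_closed_if_AE_lebesgue by blast
  then show "f x = g x" by simp
qed

lemma mchar_borel_measurable [measurable]:
  assumes "euclidean_law M" shows "mchar M \<in> borel_measurable borel"
proof -
  interpret euclidean_law M by fact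
  show ?thesis unfolding mchar_def[abs_def] by measurable
qed

context saddlepoint_model
begin

text \<open>
  By independence the law of the sum, tilted by \<open>s\<close>, has as characteristic function the \<open>n\<close>-th
  power of that of the tilted law of \<open>Y\<close>. Fourier inversion gives it a continuous density, and undoing the
  tilt multiplies this density by \<open>mgf\<^sup>n exp (- s \<bullet> x)\<close>.
\<close>

lemma sum_copies_density:
  assumes x: "(s, \<theta>) \<in> dom" and int: "integrable lborel (\<lambda>v. mchar (tilt (law \<theta>) s) v ^ n)"
  shows "continuous_density (P \<theta>) (sum_copies Ys n \<theta>)
     (\<lambda>x. mgf (law \<theta>) s ^ n * exp (- (s \<bullet> x)) * inverse_fourier (\<lambda>v. mchar (tilt (law \<theta>) s) v ^ n) x)"
    and "0 \<le> inverse_fourier (\<lambda>v. mchar (tilt (law \<theta>) s) v ^ n) z"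
proof -
  have \<theta>: "\<theta> \<in> R" by (rule dom_R[OF x])
  interpret Pr: prob_space "P \<theta>" using model \<theta> by (simp add: iid_copies_model_def)
  interpret E: euclidean_law "law \<theta>" by (rule law[OF \<theta>])
  have sd: "s \<in> mgf_domain (law \<theta>)" by (rule dom_mgf[OF x])
  have Z: "0 < mgf (law \<theta>) s" by (rule mgf_law_pos[OF x])
  have indep: "Pr.indep_vars (\<lambda>_. borel) (Ys \<theta>) UNIV" and same: "\<And>i. distr (P \<theta>) borel (Ys \<theta> i) = law \<theta>"
    using model \<theta> by (auto simp: iid_copies_model_def law_def)
  have Ysm[measurable]: "Ys \<theta> i \<in> borel_measurable (P \<theta>)" for i
    using indep by (simp add: Pr.indep_vars_def)
  let ?X = "sum_copies Ys n \<theta>"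
  have Xm[measurable]: "?X \<in> borel_measurable (P \<theta>)" unfolding sum_copies_def[abs_def] by measurable
  define f where "f v y = exp (s \<bullet> y) *\<^sub>R iexp (v \<bullet> y)" for v y :: "real^'d"
  have fm[measurable]: "f v \<in> borel_measurable borel" for v unfolding f_def[abs_def] by measurable
  have fint: "integrable (law \<theta>) (f v)" for v
  proof (rule Bochner_Integration.integrable_bound)
    show "integrable (law \<theta>) (\<lambda>y. exp (s \<bullet> y))" using sd by (simp add: mgf_domain_def)
  qed (auto simp: f_def)
  have fval: "(CLINT y|law \<theta>. f v y) = complex_of_real (mgf (law \<theta>) s) * mchar (tilt (law \<theta>) s) v" for v
    unfolding E.mchar_tilt[OF sd] f_def using Z by simp
  have Yint: "integrable (P \<theta>) (\<lambda>\<omega>. f v (Ys \<theta> i \<omega>))" for v i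
    using fint[of v] unfolding same[of i, symmetric] by (subst (asm) integrable_distr_eq) auto
  have Yval: "(CLINT \<omega>|P \<theta>. f v (Ys \<theta> i \<omega>)) = complex_of_real (mgf (law \<theta>) s) * mchar (tilt (law \<theta>) s) v" for v i
  proof -
    have "(CLINT \<omega>|P \<theta>. f v (Ys \<theta> i \<omega>)) = (CLINT y|distr (P \<theta>) borel (Ys \<theta> i). f v y)"
      by (rule integral_distr[symmetric]) auto
    then show ?thesis by (simp only: same fval)
  qed
  have ind: "Pr.indep_vars (\<lambda>_. borel) (\<lambda>i \<omega>. f v (Ys \<theta> i \<omega>)) {..<n}" for v
    by (rule Pr.indep_vars_compose2[OF Pr.indep_vars_subset[OF indep]]) auto
  have prod: "f v (?X \<omega>) = (\<Prod>i<n. f v (Ys \<theta> i \<omega>))" for v \<omega>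
    by (simp add: f_def sum_copies_def inner_sum_right exp_sum sum_distrib_left scaleR_conv_of_real prod.distrib)
  define \<nu> where "\<nu> = distr (P \<theta>) borel ?X"
  interpret N: euclidean_law \<nu>
    unfolding euclidean_law_def euclidean_law_axioms_def \<nu>_def by (auto intro: Pr.prob_space_distr)
  have Nint: "integrable \<nu> (f v)" for v
    unfolding \<nu>_def using Pr.indep_vars_integrable[OF _ ind Yint, of v]
    by (subst integrable_distr_eq) (auto simp: prod)
  have Nval: "(CLINT y|\<nu>. f v y) = (complex_of_real (mgf (law \<theta>) s) * mchar (tilt (law \<theta>) s) v) ^ n" for v
  proof -
    have "(CLINT y|\<nu>. f v y) = (CLINT \<omega>|P \<theta>. (\<Prod>i<n. f v (Ys \<theta> i \<omega>)))"
      unfolding \<nu>_def by (subst integral_distr) (auto simp: prod)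
    also have "\<dots> = (\<Prod>i<n. CLINT \<omega>|P \<theta>. f v (Ys \<theta> i \<omega>))"
      by (rule Pr.indep_vars_lebesgue_integral[OF _ ind Yint]) simp
    finally show ?thesis by (simp add: Yval)
  qed
  have f0: "f 0 = (\<lambda>y. complex_of_real (exp (s \<bullet> y)))" by (auto simp: f_def scaleR_conv_of_real)
  have sN: "s \<in> mgf_domain \<nu>"
    using Nint[of 0] unfolding f0 mgf_domain_def by (simp only: mem_Collect_eq complex_of_real_integrable_eq)
  have "mchar (tilt (law \<theta>) s) 0 = 1"
    using E.mchar_tilt[OF sd, of 0] Z by (simp add: mgf_def scaleR_conv_of_real)
  then have "complex_of_real (mgf \<nu> s) = complex_of_real (mgf (law \<theta>) s ^ n)"
    using Nval[of 0] unfolding f0 by (simp add: mgf_def)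
  then have mN: "mgf \<nu> s = mgf (law \<theta>) s ^ n" using of_real_eq_iff by blast
  have ch: "mchar (tilt \<nu> s) = (\<lambda>v. mchar (tilt (law \<theta>) s) v ^ n)"
  proof
    fix v
    show "mchar (tilt \<nu> s) v = mchar (tilt (law \<theta>) s) v ^ n"
      using N.mchar_tilt[OF sN, of v] Nval[of v] Z by (simp add: f_def mN power_mult_distrib)
  qed
  interpret T: euclidean_law "tilt \<nu> s" by (rule N.euclidean_law_tilt[OF sN])
  let ?q = "inverse_fourier (\<lambda>v. mchar (tilt (law \<theta>) s) v ^ n)"
  have qnn: "0 \<le> ?q z" for z
    using fourier_inversion(1)[OF T.prob_space_axioms T.sets_M, unfolded ch, OF int] .
  show "0 \<le> ?q z" by (rule qnn)
  have tq: "tilt \<nu> s = density lborel (\<lambda>x. ennreal (?q x))"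
    using fourier_inversion(2)[OF T.prob_space_axioms T.sets_M, unfolded ch, OF int] .
  have qc: "continuous_on UNIV ?q" by (rule continuous_inverse_fourier[OF int])
  have qm[measurable]: "?q \<in> borel_measurable borel" by (rule borel_measurable_continuous_onI[OF qc])
  let ?b = "\<lambda>x. mgf (law \<theta>) s ^ n * exp (- (s \<bullet> x))"
  have "density (tilt \<nu> s) (\<lambda>x. ennreal (?b x)) = density \<nu> (\<lambda>x. ennreal (exp (s \<bullet> x) / mgf \<nu> s) * ennreal (?b x))"
    unfolding tilt_def by (rule density_density_eq) auto
  also have "(\<lambda>x. ennreal (exp (s \<bullet> x) / mgf \<nu> s) * ennreal (?b x)) = (\<lambda>x. 1)"
    using Z by (auto simp: mN ennreal_mult[symmetric] exp_minus)
  also have "density \<nu> (\<lambda>x. 1) = \<nu>" by (rule density_1)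
  finally have "\<nu> = density (density lborel (\<lambda>x. ennreal (?q x))) (\<lambda>x. ennreal (?b x))" unfolding tq by simp
  also have "\<dots> = density lborel (\<lambda>x. ennreal (?q x) * ennreal (?b x))" by (rule density_density_eq) auto
  also have "(\<lambda>x. ennreal (?q x) * ennreal (?b x)) = (\<lambda>x. ennreal (?b x * ?q x))"
    using Z qnn by (auto simp: ennreal_mult[symmetric] mult.commute)
  finally have \<nu>: "distr (P \<theta>) borel ?X = density lborel (\<lambda>x. ennreal (?b x * ?q x))" unfolding \<nu>_def .
  \<comment> \<open>\<open>distributed\<close> refers to the distribution on \<open>lborel\<close>, which has the same measurable sets as \<open>borel\<close>\<close>
  have dl: "distr (P \<theta>) lborel ?X = distr (P \<theta>) borel ?X" by (intro distr_cong) auto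
  show "continuous_density (P \<theta>) ?X (\<lambda>x. ?b x * ?q x)"
    unfolding continuous_density_def distributed_def dl \<nu>
    using qc qnn Z by (auto intro!: continuous_intros)
qed

lemma likelihood_eq:
  assumes x: "(s, \<theta>) \<in> dom" and int: "integrable lborel (\<lambda>v. mchar (tilt (law \<theta>) s) v ^ n)"
  shows "likelihood P Ys n z \<theta> =
     mgf (law \<theta>) s ^ n * exp (- (s \<bullet> z)) * inverse_fourier (\<lambda>v. mchar (tilt (law \<theta>) s) v ^ n) z"
  unfolding likelihood_def
  by (subst the_equality[where P = "continuous_density (P \<theta>) (sum_copies Ys n \<theta>)", OF sum_copies_density(1)[OF x int]])
     (auto intro: continuous_density_unique sum_copies_density(1)[OF x int])

definition centred_char :: "real^'d \<Rightarrow> real^'p \<Rightarrow> real^'d \<Rightarrow> real^'d \<Rightarrow> complex" where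
  "centred_char c \<theta> s v = iexp (- (v \<bullet> c)) * mchar (tilt (law \<theta>) s) v"

text \<open>
  The Fourier integral for the density of the tilted sum at its mean, in the variable \<open>v / \<surd>n\<close> in
  which it converges.
\<close>

definition fourier_mass :: "real^'d \<Rightarrow> nat \<Rightarrow> real^'p \<Rightarrow> real^'d \<Rightarrow> real" where
  "fourier_mass c n \<theta> s = Re (CLINT v|lborel. centred_char c \<theta> s (v /\<^sub>R sqrt (real n)) ^ n)"

lemma norm_centred_char [simp]: "norm (centred_char c \<theta> s v) = norm (mchar (tilt (law \<theta>) s) v)"
  by (simp add: centred_char_def norm_mult)

lemma law_tilt: "(s, \<theta>) \<in> dom \<Longrightarrow> euclidean_law (tilt (law \<theta>) s)"
  by (rule euclidean_law.euclidean_law_tilt[OF law[OF dom_R] dom_mgf])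

lemma centred_char_measurable:
  assumes "(s, \<theta>) \<in> dom" shows "centred_char c \<theta> s \<in> borel_measurable borel"
proof -
  have [measurable]: "mchar (tilt (law \<theta>) s) \<in> borel_measurable borel" by (rule mchar_borel_measurable[OF law_tilt[OF assms]])
  show ?thesis unfolding centred_char_def[abs_def] by measurable
qed

lemma centred_char_eq:
  assumes "(s, \<theta>) \<in> dom"
  shows "centred_char c \<theta> s v = (CLINT y|tilt (law \<theta>) s. iexp (v \<bullet> (y - c)))"
  unfolding centred_char_def mchar_def integral_mult_right_zero[symmetric] exp_add[symmetric]
  by (simp add: inner_diff_right algebra_simps)

text \<open>
  At \<open>x = n c\<close> the phase \<open>exp (- i v x)\<close> is the \<open>n\<close>-th power of \<open>exp (- i v c)\<close>, so the
  integrand is the \<open>n\<close>-th power of the centred characteristic function.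
\<close>

lemma likelihood_at_multiple:
  assumes x: "(s, \<theta>) \<in> dom" and n: "0 < n"
    and int: "integrable lborel (\<lambda>v. mchar (tilt (law \<theta>) s) v ^ n)"
  shows "likelihood P Ys n (real n *\<^sub>R c) \<theta> =
     exp (real n * (K (s, \<theta>) - s \<bullet> c)) * ((1 / sqrt (real n)) ^ CARD('d) / (2 * pi) ^ CARD('d)) * fourier_mass c n \<theta> s"
    and "0 \<le> fourier_mass c n \<theta> s"
proof -
  have Z: "0 < mgf (law \<theta>) s" by (rule mgf_law_pos[OF x])
  have [measurable]: "centred_char c \<theta> s \<in> borel_measurable borel" by (rule centred_char_measurable[OF x])
  have n0: "0 < real n" using n by simp
  have 1: "iexp (- (v \<bullet> (real n *\<^sub>R c))) * mchar (tilt (law \<theta>) s) v ^ n = centred_char c \<theta> s v ^ n" for v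
    unfolding centred_char_def power_mult_distrib exp_of_nat_mult[symmetric] by (simp add: mult_ac)
  have "(CLINT v|lborel. centred_char c \<theta> s v ^ n)
      = \<bar>1 / sqrt (real n)\<bar> ^ DIM(real^'d) *\<^sub>R (CLINT v|lborel. centred_char c \<theta> s (0 + (1 / sqrt (real n)) *\<^sub>R v) ^ n)"
    using n0 by (intro integral_lborel_affine) auto
  then have 2: "inverse_fourier (\<lambda>v. mchar (tilt (law \<theta>) s) v ^ n) (real n *\<^sub>R c)
     = (1 / sqrt (real n)) ^ CARD('d) / (2 * pi) ^ CARD('d) * fourier_mass c n \<theta> s"
    unfolding inverse_fourier_def 1 fourier_mass_def by (simp add: divide_inverse)
  have "exp (real n * (K (s, \<theta>) - s \<bullet> c)) = exp (K (s, \<theta>)) ^ n * exp (- (s \<bullet> (real n *\<^sub>R c)))"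
    unfolding exp_of_nat_mult[symmetric] exp_add[symmetric] by (simp add: algebra_simps)
  also have "exp (K (s, \<theta>)) = mgf (law \<theta>) s" unfolding K_eq[OF x] using Z by simp
  finally have 3: "mgf (law \<theta>) s ^ n * exp (- (s \<bullet> (real n *\<^sub>R c))) = exp (real n * (K (s, \<theta>) - s \<bullet> c))" by simp
  show "likelihood P Ys n (real n *\<^sub>R c) \<theta> =
     exp (real n * (K (s, \<theta>) - s \<bullet> c)) * ((1 / sqrt (real n)) ^ CARD('d) / (2 * pi) ^ CARD('d)) * fourier_mass c n \<theta> s"
    unfolding likelihood_eq[OF x int] 3 2 by simp
  have "0 < (1 / sqrt (real n)) ^ CARD('d) / (2 * pi) ^ CARD('d)" using n0 by simp
  then show "0 \<le> fourier_mass c n \<theta> s"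
    using sum_copies_density(2)[OF x int, of "real n *\<^sub>R c"] mult_pos_neg[of _ "fourier_mass c n \<theta> s"]
    unfolding 2 by (meson not_le)
qed

text \<open>
  The tilts vary with \<open>n\<close>, so the error in \<open>char_power_estimate\<close> has to be controlled along the
  sequence: the second moments converge because \<open>K\<^sub>0''\<close> is continuous, and the third moments are
  bounded because the moment generating function is continuous at two points near \<open>s0\<close>.
\<close>

lemma centred_char_power_limit:
  fixes s :: "nat \<Rightarrow> real^'d" and \<theta> :: "nat \<Rightarrow> real^'p"
  assumes x0: "(s0, \<theta>0) \<in> dom"
    and ev: "\<forall>\<^sub>F n in sequentially. (s n, \<theta> n) \<in> dom \<and> grad_s_K0 P Y (s n) (\<theta> n) = c"
    and lim: "(\<lambda>n. (s n, \<theta> n)) \<longlonglongrightarrow> (s0, \<theta>0)"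
  shows "(\<lambda>n. centred_char c (\<theta> n) (s n) (v /\<^sub>R sqrt (real n)) ^ n)
     \<longlonglongrightarrow> complex_of_real (exp (- (v \<bullet> (hess_s_K0 P Y s0 \<theta>0 *v v)) / 2))"
proof -
  have limdom: "(\<lambda>n. g (s n, \<theta> n)) \<longlonglongrightarrow> g (s0, \<theta>0)" if "continuous_on dom g" for g :: "_ \<Rightarrow> 'b::topological_space"
    using that x0 by (intro isCont_tendsto_compose[OF _ lim]) (simp add: continuous_on_eq_continuous_at)
  define q where "q n = v \<bullet> (hess_s_K0 P Y (s n) (\<theta> n) *v v)" for n
  define R where "R n = (LINT y|tilt (law (\<theta> n)) (s n). \<bar>v \<bullet> (y - c)\<bar> ^ 3)" for n
  have q: "q \<longlonglongrightarrow> v \<bullet> (hess_s_K0 P Y s0 \<theta>0 *v v)"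
    unfolding q_def inner_hess_s by (intro tendsto_sum tendsto_mult tendsto_const limdom K_partial2_continuous) auto
  have "open dom" by simp
  then obtain \<rho> where \<rho>: "0 < \<rho>" "ball (s0, \<theta>0) \<rho> \<subseteq> dom" using x0 open_contains_ball by blast
  \<comment> \<open>\<open>s0 \<plusminus> \<eta> v\<close> still lies in the domain at \<open>\<theta>0\<close>\<close>
  define \<eta> where "\<eta> = \<rho> / (2 * (norm v + 1))"
  have nv: "0 < norm v + 1" by (intro add_nonneg_pos) auto
  have \<eta>: "0 < \<eta>" using \<rho> nv by (simp add: \<eta>_def)
  have "\<eta> * norm v \<le> \<eta> * (norm v + 1)" using \<eta> by (intro mult_left_mono) auto
  also have "\<dots> = \<rho> / 2"
  proof -
    have "\<rho> / (2 * k) * k = \<rho> / 2" if "0 < k" for k :: real using that by simp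
    then show ?thesis unfolding \<eta>_def using nv by blast
  qed
  also have "\<dots> < \<rho>" using \<rho> by simp
  finally have \<eta>v: "\<eta> * norm v < \<rho>" .
  have in1: "(s0 + \<eta> *\<^sub>R v, \<theta>0) \<in> dom" and in2: "(s0 - \<eta> *\<^sub>R v, \<theta>0) \<in> dom"
    using \<rho>(2) \<eta> \<eta>v by (auto simp: dist_Pair_Pair dist_norm subset_iff)
  have l1: "(\<lambda>n. (s n + \<eta> *\<^sub>R v, \<theta> n)) \<longlonglongrightarrow> (s0 + \<eta> *\<^sub>R v, \<theta>0)"
    and l2: "(\<lambda>n. (s n - \<eta> *\<^sub>R v, \<theta> n)) \<longlonglongrightarrow> (s0 - \<eta> *\<^sub>R v, \<theta>0)"
    using tendsto_fst[OF lim] tendsto_snd[OF lim] by (auto intro!: tendsto_intros)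
  have mlim: "(\<lambda>n. Re (joint_mgf (x n))) \<longlonglongrightarrow> Re (joint_mgf x')" if "x \<longlonglongrightarrow> x'" "x' \<in> dom" for x x'
    using joint_mgf_continuous that(2) by (intro isCont_tendsto_compose[OF _ that(1)]) (simp add: continuous_on_eq_continuous_at)
  define B where "B n = 6 / \<eta> ^ 3 * (Re (joint_mgf (s n + \<eta> *\<^sub>R v, \<theta> n)) * exp (- (\<eta> * (v \<bullet> c)))
      + Re (joint_mgf (s n - \<eta> *\<^sub>R v, \<theta> n)) * exp (\<eta> * (v \<bullet> c))) / Re (joint_mgf (s n, \<theta> n))" for n
  have Blim: "B \<longlonglongrightarrow> 6 / \<eta> ^ 3 * (Re (joint_mgf (s0 + \<eta> *\<^sub>R v, \<theta>0)) * exp (- (\<eta> * (v \<bullet> c)))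
      + Re (joint_mgf (s0 - \<eta> *\<^sub>R v, \<theta>0)) * exp (\<eta> * (v \<bullet> c))) / Re (joint_mgf (s0, \<theta>0))"
    unfolding B_def using joint_mgf_pos[OF x0]
    by (intro tendsto_intros mlim[OF l1 in1] mlim[OF l2 in2] mlim[OF lim x0]) auto
  have d1: "\<forall>\<^sub>F n in sequentially. (s n + \<eta> *\<^sub>R v, \<theta> n) \<in> dom" and d2: "\<forall>\<^sub>F n in sequentially. (s n - \<eta> *\<^sub>R v, \<theta> n) \<in> dom"
    using topological_tendstoD[OF l1 open_interior in1] topological_tendstoD[OF l2 open_interior in2] by auto
  have "\<forall>\<^sub>F n in sequentially. norm (centred_char c (\<theta> n) (s n) (v /\<^sub>R sqrt (real n)) ^ n - complex_of_real (exp (- q n / 2)))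
     \<le> B n / sqrt (real n) + (q n)\<^sup>2 / real n"
    using ev d1 d2 eventually_gt_at_top[of 0]
  proof eventually_elim
    case (elim n)
    then have x: "(s n, \<theta> n) \<in> dom" and c: "grad_s_K0 P Y (s n) (\<theta> n) = c" by auto
    interpret E: euclidean_law "law (\<theta> n)" by (rule law[OF dom_R[OF x]])
    interpret Q: euclidean_law "tilt (law (\<theta> n)) (s n)" by (rule law_tilt[OF x])
    note third = E.tilted_third_moment[OF dom_mgf[OF x] \<eta> dom_mgf[OF elim(2)] dom_mgf[OF elim(3)], of c]
    have eq: "centred_char c (\<theta> n) (s n) (v /\<^sub>R sqrt (real n)) = (CLINT y|tilt (law (\<theta> n)) (s n). iexp (v \<bullet> (y - c) / sqrt (real n)))"
      unfolding centred_char_eq[OF x] by (simp add: divide_inverse mult.commute)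
    have "norm (centred_char c (\<theta> n) (s n) (v /\<^sub>R sqrt (real n)) ^ n - complex_of_real (exp (- q n / 2)))
       \<le> R n / sqrt (real n) + (q n)\<^sup>2 / real n"
      unfolding eq q_def tilted_moments(2)[OF x c, symmetric] R_def
      by (rule char_power_estimate[OF Q.prob_space_axioms _ third(1) tilted_moments(1)[OF x c] elim(4)]) measurable
    also have "R n \<le> B n"
      using third(2) dom_R[OF x] by (simp add: R_def B_def M0_real)
    finally show ?case by (simp add: divide_right_mono)
  qed
  moreover have "(\<lambda>n. B n / sqrt (real n) + (q n)\<^sup>2 / real n) \<longlonglongrightarrow> 0"
  proof -
    have "(\<lambda>n. B n / sqrt (real n)) \<longlonglongrightarrow> 0"
      by (intro tendsto_divide_0[OF Blim] filterlim_at_top_imp_at_infinity filterlim_compose[OF sqrt_at_top] filterlim_real_sequentially)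
    moreover have "(\<lambda>n. (q n)\<^sup>2 / real n) \<longlonglongrightarrow> 0"
      by (intro tendsto_divide_0[OF tendsto_power[OF q]] filterlim_at_top_imp_at_infinity filterlim_real_sequentially)
    ultimately show ?thesis using tendsto_add by fastforce
  qed
  ultimately have "(\<lambda>n. centred_char c (\<theta> n) (s n) (v /\<^sub>R sqrt (real n)) ^ n - complex_of_real (exp (- q n / 2))) \<longlonglongrightarrow> 0"
    by (rule Lim_null_comparison)
  moreover have "(\<lambda>n. complex_of_real (exp (- q n / 2))) \<longlonglongrightarrow> complex_of_real (exp (- (v \<bullet> (hess_s_K0 P Y s0 \<theta>0 *v v)) / 2))"
    by (intro tendsto_intros q) auto
  ultimately show ?thesis by (rule Lim_transform[rotated])
qed

end

section \<open>Asymptotic normality of the posteriors\<close>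

context saddlepoint_model
begin

lemma isCont_along_saddlepoint:
  assumes "continuous_on dom g" "(c, \<theta>) \<in> saddle_domain R P Y"
  shows "isCont (\<lambda>\<theta>. g (saddlepoint R P Y \<theta> c, \<theta>)) \<theta>"
proof -
  have "isCont g (saddlepoint R P Y \<theta> c, \<theta>)"
    using assms saddle_domain_iff by (simp add: continuous_on_eq_continuous_at)
  moreover have "isCont (\<lambda>\<theta>. (saddlepoint R P Y \<theta> c, \<theta>)) \<theta>"
    by (rule continuous_Pair[OF saddlepoint_continuous[OF assms(2)] continuous_ident])
  ultimately show ?thesis by (rule isCont_o2[rotated])
qed

lemma H_matrix_symmetric:
  assumes x: "(s, \<theta>) \<in> dom"
  shows "transpose (H_matrix P Y s \<theta>) = H_matrix P Y s \<theta>"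
proof -
  let ?A = "hess_s_K0 P Y s \<theta>" and ?B = "mixed_K0 P Y s \<theta>"
  let ?N = "matrix_inv ?A"
  have AN: "?A ** ?N = mat 1" by (rule pos_def_matrix_inv[OF hess_s_symmetric[OF x] hess_s_pos_def[OF x]])
  then have "transpose (?A ** ?N) = mat 1" by simp
  then have NA: "transpose ?N ** ?A = mat 1" by (simp add: matrix_transpose_mul hess_s_symmetric[OF x])
  have "transpose ?N = transpose ?N ** (?A ** ?N)" by (simp add: AN)
  also have "\<dots> = ?N" by (simp add: matrix_mul_assoc NA)
  finally have N: "transpose ?N = ?N" .
  have "transpose (X - Z) = transpose X - transpose Z" for X Z :: "real^'p^'p"
    by (simp add: transpose_def vec_eq_iff)
  then show ?thesis
    by (simp add: H_matrix_def hess_th_symmetric[OF x] matrix_transpose_mul N matrix_mul_assoc)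
qed

lemma profile_expansion:
  assumes x: "(s0, \<theta>0) \<in> dom" and c: "grad_s_K0 P Y s0 \<theta>0 = c" and g: "grad_th_K0 P Y s0 \<theta>0 = 0"
    and e: "0 < e"
  defines "h \<equiv> \<lambda>\<theta>. K (saddlepoint R P Y \<theta> c, \<theta>) - saddlepoint R P Y \<theta> c \<bullet> c"
  shows "\<exists>r>0. \<forall>w. norm w < r \<longrightarrow>
     \<bar>h (\<theta>0 + w) - h \<theta>0 - w \<bullet> (H_matrix P Y s0 \<theta>0 *v w) / 2\<bar> \<le> e * (norm w)\<^sup>2"
proof -
  let ?\<sigma> = "\<lambda>\<theta>. saddlepoint R P Y \<theta> c"
  let ?F = "\<lambda>x. K x - fst x \<bullet> c"
  let ?V = "{\<theta>. (c, \<theta>) \<in> saddle_domain R P Y}"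
  have \<sigma>0: "?\<sigma> \<theta>0 = s0" by (rule saddlepoint_eqI[OF x c])
  have \<theta>0: "(c, \<theta>0) \<in> saddle_domain R P Y" using x c by (auto simp: saddle_domain_def)
  have "open (dom \<inter> (UNIV \<times> ?V))" by (intro open_Int open_Times open_interior open_UNIV open_saddle_section)
  moreover have "(s0, \<theta>0) \<in> dom \<inter> (UNIV \<times> ?V)" using x \<theta>0 by simp
  ultimately obtain r0 where r0: "0 < r0" "ball (s0, \<theta>0) r0 \<subseteq> dom \<inter> (UNIV \<times> ?V)"
    using open_contains_ball by blast
  have "\<exists>r>0. \<forall>w. norm w < r \<longrightarrow> \<bar>?F (?\<sigma> (\<theta>0 + w), \<theta>0 + w) - ?F (s0, \<theta>0)
      - w \<bullet> ((hess_th_K0 P Y s0 \<theta>0 - transpose (mixed_K0 P Y s0 \<theta>0) ** matrix_inv (hess_s_K0 P Y s0 \<theta>0) ** mixed_K0 P Y s0 \<theta>0) *v w) / 2\<bar>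
      \<le> e * (norm w)\<^sup>2"
  proof (rule partial_minimum_expansion[OF hess_s_symmetric[OF x] hess_s_pos_def[OF x] _ _ r0(1) _ e])
    fix e' :: real assume "0 < e'"
    from K0_second_order_taylor[OF x this]
    obtain r where r: "0 < r" "\<forall>a w. norm (a, w) < r \<longrightarrow>
      \<bar>K (s0 + a, \<theta>0 + w) - K (s0, \<theta>0) - a \<bullet> grad_s_K0 P Y s0 \<theta>0 - w \<bullet> grad_th_K0 P Y s0 \<theta>0
      - (a \<bullet> (hess_s_K0 P Y s0 \<theta>0 *v a) + 2 * (a \<bullet> (mixed_K0 P Y s0 \<theta>0 *v w))
         + w \<bullet> (hess_th_K0 P Y s0 \<theta>0 *v w)) / 2\<bar> \<le> e' * ((norm a)\<^sup>2 + (norm w)\<^sup>2)"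
      by (elim exE conjE) (rule that)
    show "\<exists>r>0. \<forall>a w. norm (a, w) < r \<longrightarrow>
      \<bar>?F (s0 + a, \<theta>0 + w) - ?F (s0, \<theta>0) - (a \<bullet> (hess_s_K0 P Y s0 \<theta>0 *v a) + 2 * (a \<bullet> (mixed_K0 P Y s0 \<theta>0 *v w))
         + w \<bullet> (hess_th_K0 P Y s0 \<theta>0 *v w)) / 2\<bar> \<le> e' * ((norm a)\<^sup>2 + (norm w)\<^sup>2)"
    proof (intro exI[of _ r] conjI allI impI r(1))
      fix a :: "real^'d" and w :: "real^'p" assume n: "norm (a, w) < r"
      have "?F (s0 + a, \<theta>0 + w) - ?F (s0, \<theta>0) = K (s0 + a, \<theta>0 + w) - K (s0, \<theta>0) - a \<bullet> grad_s_K0 P Y s0 \<theta>0 - w \<bullet> grad_th_K0 P Y s0 \<theta>0"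
        by (simp add: c g inner_add_left)
      then show "\<bar>?F (s0 + a, \<theta>0 + w) - ?F (s0, \<theta>0) - (a \<bullet> (hess_s_K0 P Y s0 \<theta>0 *v a) + 2 * (a \<bullet> (mixed_K0 P Y s0 \<theta>0 *v w))
         + w \<bullet> (hess_th_K0 P Y s0 \<theta>0 *v w)) / 2\<bar> \<le> e' * ((norm a)\<^sup>2 + (norm w)\<^sup>2)"
        using r(2)[rule_format, OF n] by simp
    qed
  next
    have "(?\<sigma> \<longlongrightarrow> ?\<sigma> \<theta>0) (nhds \<theta>0)"
      by (rule tendsto_at_iff_tendsto_nhds[of ?\<sigma> \<theta>0, THEN iffD1])
         (rule saddlepoint_continuous[OF \<theta>0, unfolded isCont_def])
    then show "(?\<sigma> \<longlongrightarrow> s0) (nhds \<theta>0)" unfolding \<sigma>0 .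
  next
    fix s \<theta> assume "norm (s - s0, \<theta> - \<theta>0) < r0"
    then have "dist (s, \<theta>) (s0, \<theta>0) < r0" by (simp add: dist_norm)
    then have "(s, \<theta>) \<in> ball (s0, \<theta>0) r0" by (simp only: mem_ball dist_commute)
    then have sd: "(s, \<theta>) \<in> dom" and sad: "(c, \<theta>) \<in> saddle_domain R P Y" using r0(2) by auto
    have xd: "(?\<sigma> \<theta>, \<theta>) \<in> dom" "grad_s_K0 P Y (?\<sigma> \<theta>) \<theta> = c" using sad by (simp_all add: saddle_domain_iff)
    show "?F (?\<sigma> \<theta>, \<theta>) \<le> ?F (s, \<theta>)"
    proof (cases "s = ?\<sigma> \<theta>")
      case False
      then have "ln (mgf (law \<theta>) (?\<sigma> \<theta>)) - ?\<sigma> \<theta> \<bullet> c < ln (mgf (law \<theta>) s) - s \<bullet> c"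
        by (intro K_strict_minimum[OF xd(1) dom_mgf[OF sd] _ xd(2)]) simp
      then show ?thesis unfolding K_eq[OF xd(1)] K_eq[OF sd] fst_conv by simp
    qed simp
  qed
  then show ?thesis by (simp add: h_def \<sigma>0 H_matrix_def)
qed

lemma centred_char_isCont:
  assumes "(c, \<theta>) \<in> saddle_domain R P Y"
  shows "isCont (\<lambda>\<theta>. centred_char c \<theta> (saddlepoint R P Y \<theta> c) v) \<theta>"
proof -
  let ?\<sigma> = "\<lambda>\<theta>. saddlepoint R P Y \<theta> c"
  let ?q = "\<lambda>\<theta>. iexp (- (v \<bullet> c)) * (M0 P Y (cvec (?\<sigma> \<theta>) v) \<theta> / M0 P Y (cvec (?\<sigma> \<theta>) 0) \<theta>)"
  have x: "(?\<sigma> \<theta>, \<theta>) \<in> dom" using assms by (simp add: saddle_domain_iff)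
  have c1: "isCont (\<lambda>\<theta>. M0 P Y (cvec (?\<sigma> \<theta>) w) \<theta>) \<theta>" for w
    using isCont_along_saddlepoint[OF M0_continuous assms, of w] by simp
  have "M0 P Y (cvec (?\<sigma> \<theta>) 0) \<theta> \<noteq> 0"
    using mgf_law_pos[OF x] by (simp add: M0_real[OF dom_R[OF x]])
  then have "isCont ?q \<theta>" by (intro continuous_intros c1) auto
  moreover have "\<forall>\<^sub>F \<theta>' in nhds \<theta>. (c, \<theta>') \<in> saddle_domain R P Y"
    using open_saddle_section[of c] assms by (auto simp: eventually_nhds)
  then have "\<forall>\<^sub>F \<theta>' in nhds \<theta>. ?q \<theta>' = centred_char c \<theta>' (?\<sigma> \<theta>') v"
    by eventually_elim (simp add: centred_char_def saddle_domain_iff mchar_tilt_law)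
  ultimately show ?thesis using isCont_cong by fast
qed

text \<open>
  The neighbourhood \<open>U\<close> collects what the Laplace argument needs uniformly: saddlepoints exist, the
  exponent in the decay condition and the determinant of \<open>K\<^sub>0''\<close> stay away from \<open>0\<close>, the prior
  density is bounded, and \<open>h\<close> lies below a downward paraboloid. The two posteriors then differ only in
  the prefactor: \<open>J n \<theta>\<close> for the likelihood, and the inverse square root of the determinant for the
  saddlepoint likelihood.
\<close>

theorem posterior_normality:
  assumes s0_\<theta>0: "(s0, \<theta>0) \<in> dom"
    and y0: "y0 = grad_s_K0 P Y s0 \<theta>0"
    and grad_zero: "grad_th_K0 P Y s0 \<theta>0 = 0"
    and H: "H = H_matrix P Y s0 \<theta>0"
    and H_neg: "negative_definite H"
    and prior_density: "prior = density lborel (\<lambda>\<theta>. ennreal (f \<theta>))"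
    and f_meas: "f \<in> borel_measurable borel"
    and f_nonneg: "\<And>\<theta>. 0 \<le> f \<theta>"
    and f_cont: "isCont f \<theta>0"
    and f_pos: "0 < f \<theta>0"
  shows "\<exists>U. open U \<and> \<theta>0 \<in> U \<and> U \<subseteq> R \<and>
    (\<forall>\<theta>\<in>U. (y0, \<theta>) \<in> saddle_domain R P Y) \<and>
    (\<forall>\<^sub>F n in sequentially.
       (\<forall>\<theta>\<in>U. \<exists>g. continuous_density (P \<theta>) (sum_copies Ys n \<theta>) g) \<and>
       prob_space (posterior prior U (likelihood P Ys n (real n *\<^sub>R y0))) \<and>
       prob_space (posterior prior U (saddlepoint_likelihood R P Y n (real n *\<^sub>R y0)))) \<and>
    weakly_converges
      (\<lambda>n. distr (posterior prior U (likelihood P Ys n (real n *\<^sub>R y0))) borel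
             (\<lambda>\<theta>. sqrt (real n) *\<^sub>R (\<theta> - \<theta>0)))
      (multivariate_normal 0 (- matrix_inv H)) \<and>
    weakly_converges
      (\<lambda>n. distr (posterior prior U (saddlepoint_likelihood R P Y n (real n *\<^sub>R y0))) borel
             (\<lambda>\<theta>. sqrt (real n) *\<^sub>R (\<theta> - \<theta>0)))
      (multivariate_normal 0 (- matrix_inv H))"
proof -
  define \<sigma> where "\<sigma> = (\<lambda>\<theta>. saddlepoint R P Y \<theta> y0)"
  define V where "V = {\<theta>. (y0, \<theta>) \<in> saddle_domain R P Y}"
  define h where "h \<theta> = K (\<sigma> \<theta>, \<theta>) - \<sigma> \<theta> \<bullet> y0" for \<theta>
  define A where "A \<theta> = hess_s_K0 P Y (\<sigma> \<theta>) \<theta>" for \<theta>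
  have V_sad: "(y0, \<theta>) \<in> saddle_domain R P Y" if "\<theta> \<in> V" for \<theta> using that by (simp add: V_def)
  have openV: "open V" unfolding V_def by (rule open_saddle_section)
  have \<sigma>0: "\<sigma> \<theta>0 = s0" unfolding \<sigma>_def by (rule saddlepoint_eqI[OF s0_\<theta>0 y0[symmetric]])
  have \<theta>0V: "\<theta>0 \<in> V" using s0_\<theta>0 y0 by (auto simp: V_def saddle_domain_def)
  have xd: "(\<sigma> \<theta>, \<theta>) \<in> dom" and xg: "grad_s_K0 P Y (\<sigma> \<theta>) \<theta> = y0" if "\<theta> \<in> V" for \<theta>
    using V_sad[OF that] by (simp_all add: \<sigma>_def saddle_domain_iff)
  have cont\<sigma>: "isCont \<sigma> \<theta>" if "\<theta> \<in> V" for \<theta>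
    unfolding \<sigma>_def by (rule saddlepoint_continuous[OF V_sad[OF that]])
  have comp: "isCont (\<lambda>\<theta>. g (\<sigma> \<theta>, \<theta>)) \<theta>" if "continuous_on dom g" "\<theta> \<in> V" for g :: "_ \<Rightarrow> real" and \<theta>
    unfolding \<sigma>_def by (rule isCont_along_saddlepoint[OF that(1) V_sad[OF that(2)]])
  have conth: "isCont h \<theta>" if "\<theta> \<in> V" for \<theta>
    unfolding h_def using comp[OF K_continuous that] cont\<sigma>[OF that] by (intro continuous_intros) auto
  have contdet: "isCont (\<lambda>\<theta>. det (A \<theta>)) \<theta>" if "\<theta> \<in> V" for \<theta>
    unfolding A_def det_def hess_s_K0_def vec_lambda_beta
    by (intro continuous_intros comp[OF K_partial2_continuous that]) auto
  have symA: "transpose (A \<theta>) = A \<theta>" and posA: "\<And>v. v \<noteq> 0 \<Longrightarrow> 0 < v \<bullet> (A \<theta> *v v)" if "\<theta> \<in> V" for \<theta>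
    unfolding A_def using hess_s_symmetric[OF xd[OF that]] hess_s_pos_def[OF xd[OF that]] by auto
  have detA: "0 < det (A \<theta>)" if "\<theta> \<in> V" for \<theta> by (rule det_pos_def[OF symA[OF that] posA[OF that]])
  have H_sym: "transpose H = H" unfolding H by (rule H_matrix_symmetric[OF s0_\<theta>0])
  have expansion: "\<exists>r>0. \<forall>w. norm w < r \<longrightarrow> \<bar>h (\<theta>0 + w) - h \<theta>0 - w \<bullet> (H *v w) / 2\<bar> \<le> e * (norm w)\<^sup>2" if "0 < e" for e
    using profile_expansion[OF s0_\<theta>0 y0[symmetric] grad_zero that] by (simp add: h_def \<sigma>_def H)
  have hlim: "(\<lambda>n. real n * (h (\<theta>0 + u /\<^sub>R sqrt (real n)) - h \<theta>0)) \<longlonglongrightarrow> u \<bullet> (H *v u) / 2" for u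
    by (rule quadratic_expansion_scaled_limit[OF expansion])
  have negH: "(- H) *v v = - (H *v v)" for v
    by (simp add: matrix_vector_mult_def vec_eq_iff sum_negf)
  obtain \<alpha> where \<alpha>: "0 < \<alpha>" "\<And>v. \<alpha> * (norm v)\<^sup>2 \<le> v \<bullet> ((- H) *v v)"
    using pos_def_coercive[of "- H"] H_neg by (auto simp: negH negative_definite_def)
  obtain \<delta> where \<delta>: "continuous_on dom \<delta>" "\<And>x. x \<in> dom \<Longrightarrow> 0 < \<delta> x"
    "\<And>s \<theta> \<phi>. (s, \<theta>) \<in> dom \<Longrightarrow>
       norm (mchar (tilt (law \<theta>) s) \<phi>) \<le> (1 + \<delta> (s, \<theta>) * (norm \<phi>)\<^sup>2) powr (- \<delta> (s, \<theta>))"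
    using decay_bound by metis
  define d where "d = \<delta> (s0, \<theta>0) / 2"
  have d: "0 < d" "d < \<delta> (\<sigma> \<theta>0, \<theta>0)" using \<delta>(2)[OF s0_\<theta>0] by (simp_all add: d_def \<sigma>0)
  define D0 where "D0 = det (A \<theta>0) / 2"
  have D0: "0 < D0" "D0 < det (A \<theta>0)" using detA[OF \<theta>0V] by (simp_all add: D0_def)

  have at_nhds: "\<forall>\<^sub>F \<theta> in nhds \<theta>0. a < g \<theta>" if "isCont g \<theta>0" "a < g \<theta>0" for a and g :: "real^'p \<Rightarrow> real"
    using that(1) unfolding isCont_def tendsto_at_iff_tendsto_nhds by (rule order_tendstoD(1)) fact
  have e1: "\<forall>\<^sub>F \<theta> in nhds \<theta>0. \<theta> \<in> V" using openV \<theta>0V by (rule eventually_nhds_in_open)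
  have e2: "\<forall>\<^sub>F \<theta> in nhds \<theta>0. d < \<delta> (\<sigma> \<theta>, \<theta>)" by (rule at_nhds[OF comp[OF \<delta>(1) \<theta>0V] d(2)])
  have e3: "\<forall>\<^sub>F \<theta> in nhds \<theta>0. D0 < det (A \<theta>)" by (rule at_nhds[OF contdet[OF \<theta>0V] D0(2)])
  have e4: "\<forall>\<^sub>F \<theta> in nhds \<theta>0. - (f \<theta>0 + 1) < - f \<theta>" by (rule at_nhds) (use f_cont in \<open>auto intro!: continuous_intros\<close>)
  have e5: "\<forall>\<^sub>F \<theta> in nhds \<theta>0. h \<theta> - h \<theta>0 \<le> - (\<alpha> / 4 * (norm (\<theta> - \<theta>0))\<^sup>2)"
  proof -
    have "0 < \<alpha> / 4" using \<alpha> by simp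
    from expansion[OF this] obtain r where r: "0 < r"
      "\<forall>w. norm w < r \<longrightarrow> \<bar>h (\<theta>0 + w) - h \<theta>0 - w \<bullet> (H *v w) / 2\<bar> \<le> \<alpha> / 4 * (norm w)\<^sup>2"
      by (elim exE conjE) (rule that)
    show ?thesis unfolding eventually_nhds_metric
    proof (intro exI[of _ r] conjI allI impI r(1))
      fix \<theta> assume "dist \<theta> \<theta>0 < r"
      then have n: "norm (\<theta> - \<theta>0) < r" by (simp add: dist_norm)
      have "\<bar>h \<theta> - h \<theta>0 - (\<theta> - \<theta>0) \<bullet> (H *v (\<theta> - \<theta>0)) / 2\<bar> \<le> \<alpha> / 4 * (norm (\<theta> - \<theta>0))\<^sup>2"
        using r(2)[rule_format, OF n] by simp
      moreover have "(\<theta> - \<theta>0) \<bullet> (H *v (\<theta> - \<theta>0)) \<le> - (\<alpha> * (norm (\<theta> - \<theta>0))\<^sup>2)"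
        using \<alpha>(2)[of "\<theta> - \<theta>0"] by (simp add: negH)
      ultimately show "h \<theta> - h \<theta>0 \<le> - (\<alpha> / 4 * (norm (\<theta> - \<theta>0))\<^sup>2)" by linarith
    qed
  qed
  have "\<forall>\<^sub>F \<theta> in nhds \<theta>0. \<theta> \<in> V \<and> d < \<delta> (\<sigma> \<theta>, \<theta>) \<and> D0 < det (A \<theta>) \<and> f \<theta> \<le> f \<theta>0 + 1
      \<and> h \<theta> - h \<theta>0 \<le> - (\<alpha> / 4 * (norm (\<theta> - \<theta>0))\<^sup>2)"
    using e1 e2 e3 e4 e5 by eventually_elim auto
  then obtain U where U: "open U" "\<theta>0 \<in> U" and UP: "\<forall>\<theta>\<in>U. \<theta> \<in> V \<and> d < \<delta> (\<sigma> \<theta>, \<theta>) \<and> D0 < det (A \<theta>) \<and> f \<theta> \<le> f \<theta>0 + 1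
      \<and> h \<theta> - h \<theta>0 \<le> - (\<alpha> / 4 * (norm (\<theta> - \<theta>0))\<^sup>2)"
    unfolding eventually_nhds by (elim exE conjE) (rule that)
  have UV: "\<theta> \<in> V" and Ud: "d < \<delta> (\<sigma> \<theta>, \<theta>)" and UD: "D0 < det (A \<theta>)" and Uf: "f \<theta> \<le> f \<theta>0 + 1"
    and Uh: "h \<theta> - h \<theta>0 \<le> - (\<alpha> / 4 * (norm (\<theta> - \<theta>0))\<^sup>2)" if "\<theta> \<in> U" for \<theta>
    using bspec[OF UP that] by auto
  have UR: "U \<subseteq> R" using dom_R[OF xd[OF UV]] by blast

  \<comment> \<open>from \<open>N\<close> on the powers of the characteristic functions are integrable\<close>
  obtain N :: nat where N: "real CARD('d) / d < real N" using reals_Archimedean2 by blast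
  have N0: "0 < N"
  proof (rule ccontr)
    assume "\<not> 0 < N"
    then have "real CARD('d) / d < 0" using N by simp
    then show False using d(1) by (simp add: divide_less_0_iff)
  qed
  have Nd: "real DIM(real^'d) \<le> d * real N" using N d(1) by (simp add: field_simps)
  define maj :: "real^'d \<Rightarrow> real" where "maj = decay_majorant (d / real N)"
  have maj_int: "integrable lborel maj"
    unfolding maj_def using d(1) N0 by (intro integrable_decay_majorant) auto
  define \<psi> where "\<psi> \<theta> = mchar (tilt (law \<theta>) (\<sigma> \<theta>))" for \<theta>
  have \<psi>_maj: "norm (\<psi> \<theta> (v /\<^sub>R sqrt (real n)) ^ n) \<le> maj v" if n: "N \<le> n" and \<theta>: "\<theta> \<in> U" for n \<theta> v
  proof -
    let ?w = "v /\<^sub>R sqrt (real n)"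
    have base: "1 \<le> 1 + a * (norm ?w)\<^sup>2" if "0 < a" for a using that by simp
    have "norm (\<psi> \<theta> ?w) \<le> (1 + \<delta> (\<sigma> \<theta>, \<theta>) * (norm ?w)\<^sup>2) powr (- \<delta> (\<sigma> \<theta>, \<theta>))"
      unfolding \<psi>_def by (rule \<delta>(3)[OF xd[OF UV[OF \<theta>]]])
    also have "\<dots> \<le> (1 + \<delta> (\<sigma> \<theta>, \<theta>) * (norm ?w)\<^sup>2) powr (- d)"
      using base[of "\<delta> (\<sigma> \<theta>, \<theta>)"] Ud[OF \<theta>] d(1) by (intro powr_mono) auto
    also have "\<dots> \<le> (1 + d * (norm ?w)\<^sup>2) powr (- d)"
      using base[of d] Ud[OF \<theta>] d(1) by (intro powr_mono2') (auto intro!: mult_right_mono add_pos_nonneg mult_nonneg_nonneg)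
    finally have "norm (\<psi> \<theta> ?w) \<le> (1 + d * (norm ?w)\<^sup>2) powr (- d)" .
    then have "norm (\<psi> \<theta> ?w) ^ n \<le> ((1 + d * (norm ?w)\<^sup>2) powr (- d)) ^ n" by (intro power_mono) auto
    also have "\<dots> \<le> maj v" unfolding maj_def by (rule decay_power_le_majorant[OF d(1) N0 Nd n])
    finally show ?thesis by (simp add: norm_power)
  qed
  have \<psi>_meas: "\<psi> \<theta> \<in> borel_measurable borel" if "\<theta> \<in> U" for \<theta>
    unfolding \<psi>_def by (rule mchar_borel_measurable[OF law_tilt[OF xd[OF UV[OF that]]]])
  have \<psi>_int: "integrable lborel (\<lambda>v. \<psi> \<theta> v ^ n)" if n: "N \<le> n" and \<theta>: "\<theta> \<in> U" for n \<theta>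
  proof -
    have [measurable]: "\<psi> \<theta> \<in> borel_measurable borel" by (rule \<psi>_meas[OF \<theta>])
    have "integrable lborel (\<lambda>v. \<psi> \<theta> (v /\<^sub>R sqrt (real n)) ^ n)"
      by (rule Bochner_Integration.integrable_bound[OF maj_int])
         (use order_trans[OF \<psi>_maj[OF n \<theta>] abs_ge_self] in \<open>auto\<close>)
    then have "integrable lborel (\<lambda>v. \<psi> \<theta> ((0 + sqrt (real n) *\<^sub>R v) /\<^sub>R sqrt (real n)) ^ n)"
      using n N0 by (intro integrable_lborel_affine) auto
    then show ?thesis using n N0 by simp
  qed
  define \<zeta> where "\<zeta> \<theta> = centred_char y0 \<theta> (\<sigma> \<theta>)" for \<theta>
  have \<zeta>_maj: "norm (\<zeta> \<theta> (v /\<^sub>R sqrt (real n)) ^ n) \<le> maj v" if "N \<le> n" "\<theta> \<in> U" for n \<theta> v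
    using \<psi>_maj[OF that, of v] by (simp add: \<zeta>_def \<psi>_def norm_power)
  have \<zeta>_meas: "(\<lambda>v. \<zeta> \<theta> (v /\<^sub>R sqrt (real n)) ^ n) \<in> borel_measurable borel" if "\<theta> \<in> U" for n \<theta>
  proof -
    have [measurable]: "\<zeta> \<theta> \<in> borel_measurable borel"
      unfolding \<zeta>_def by (rule centred_char_measurable[OF xd[OF UV[OF that]]])
    show ?thesis by measurable
  qed
  define J where "J n \<theta> = fourier_mass y0 n \<theta> (\<sigma> \<theta>)" for n \<theta>
  have J_eq: "J n \<theta> = Re (CLINT v|lborel. \<zeta> \<theta> (v /\<^sub>R sqrt (real n)) ^ n)" for n \<theta>
    by (simp add: J_def \<zeta>_def fourier_mass_def)
  define CJ where "CJ = (LINT v|lborel. maj v)"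
  have J_bound: "0 \<le> J n \<theta> \<and> J n \<theta> \<le> CJ" if n: "N \<le> n" and \<theta>: "\<theta> \<in> U" for n \<theta>
  proof
    show "0 \<le> J n \<theta>" unfolding J_def
      by (rule likelihood_at_multiple(2)[OF xd[OF UV[OF \<theta>]] _ \<psi>_int[OF n \<theta>, unfolded \<psi>_def]]) (use n N0 in simp)
    have "J n \<theta> \<le> norm (CLINT v|lborel. \<zeta> \<theta> (v /\<^sub>R sqrt (real n)) ^ n)"
      unfolding J_eq by (rule complex_Re_le_cmod)
    also have "\<dots> \<le> CJ" unfolding CJ_def
    proof (rule Bochner_Integration.integral_norm_bound_integral)
      show "integrable lborel (\<lambda>v. \<zeta> \<theta> (v /\<^sub>R sqrt (real n)) ^ n)"
        by (rule Bochner_Integration.integrable_bound[OF maj_int])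
           (use \<zeta>_meas[OF \<theta>] order_trans[OF \<zeta>_maj[OF n \<theta>] abs_ge_self] in auto)
    qed (use maj_int \<zeta>_maj[OF n \<theta>] in auto)
    finally show "J n \<theta> \<le> CJ" .
  qed
  have J_cont: "continuous_on U (J n)" if n: "N \<le> n" for n
    unfolding continuous_on_sequentially
  proof (intro allI ballI impI, elim conjE)
    fix u \<theta> assume \<theta>: "\<theta> \<in> U" and u: "\<forall>k. u k \<in> U" and lim: "u \<longlonglongrightarrow> \<theta>"
    have "(\<lambda>k. CLINT v|lborel. \<zeta> (u k) (v /\<^sub>R sqrt (real n)) ^ n) \<longlonglongrightarrow> (CLINT v|lborel. \<zeta> \<theta> (v /\<^sub>R sqrt (real n)) ^ n)"
    proof (rule integral_dominated_convergence[where w = maj])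
      show "AE v in lborel. (\<lambda>k. \<zeta> (u k) (v /\<^sub>R sqrt (real n)) ^ n) \<longlonglongrightarrow> \<zeta> \<theta> (v /\<^sub>R sqrt (real n)) ^ n"
        unfolding \<zeta>_def \<sigma>_def
        by (intro AE_I2 tendsto_power isCont_tendsto_compose[OF centred_char_isCont[OF V_sad[OF UV[OF \<theta>]]] lim])
    qed (use maj_int \<zeta>_meas u \<theta> \<zeta>_maj[OF n] in auto)
    then show "(J n \<circ> u) \<longlonglongrightarrow> J n \<theta>" unfolding J_eq o_def by (rule tendsto_Re)
  qed
  note tend = rescaled_point_tendsto[of \<theta>0]
  define gl where "gl = (LINT v|lborel. exp (- (v \<bullet> (A \<theta>0 *v v)) / 2))"
  have gauss: "integrable lborel (\<lambda>v. exp (- (v \<bullet> (A \<theta>0 *v v)) / 2))"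
      "gl = sqrt (2 * pi) ^ CARD('d) / sqrt (det (A \<theta>0))"
    unfolding gl_def by (rule gaussian_integral_pos_def[OF symA[OF \<theta>0V] posA[OF \<theta>0V]]; assumption)+
  have gl: "0 < gl" unfolding gauss(2) using detA[OF \<theta>0V] by simp
  have J_lim: "(\<lambda>n. J n (\<theta>0 + u /\<^sub>R sqrt (real n))) \<longlonglongrightarrow> gl" for u
  proof -
    have ev: "\<forall>\<^sub>F n in sequentially. \<theta>0 + u /\<^sub>R sqrt (real n) \<in> U \<and> N \<le> n"
      using topological_tendstoD[OF tend U] eventually_ge_at_top by (rule eventually_conj)
    then obtain N1 where N1: "\<And>n. N1 \<le> n \<Longrightarrow> \<theta>0 + u /\<^sub>R sqrt (real n) \<in> U \<and> N \<le> n"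
      by (auto simp: eventually_sequentially)
    have xlim: "(\<lambda>n. (\<sigma> (\<theta>0 + u /\<^sub>R sqrt (real n)), \<theta>0 + u /\<^sub>R sqrt (real n))) \<longlonglongrightarrow> (s0, \<theta>0)"
      using isCont_tendsto_compose[OF cont\<sigma>[OF \<theta>0V] tend] tend unfolding \<sigma>0 by (intro tendsto_Pair)
    have xev: "\<forall>\<^sub>F n in sequentially. (\<sigma> (\<theta>0 + u /\<^sub>R sqrt (real n)), \<theta>0 + u /\<^sub>R sqrt (real n)) \<in> dom
        \<and> grad_s_K0 P Y (\<sigma> (\<theta>0 + u /\<^sub>R sqrt (real n))) (\<theta>0 + u /\<^sub>R sqrt (real n)) = y0"
      using ev by eventually_elim (use xd xg UV in auto)
    have "(\<lambda>n. CLINT v|lborel. \<zeta> (\<theta>0 + u /\<^sub>R sqrt (real (n + N1))) (v /\<^sub>R sqrt (real (n + N1))) ^ (n + N1))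
       \<longlonglongrightarrow> (CLINT v|lborel. complex_of_real (exp (- (v \<bullet> (A \<theta>0 *v v)) / 2)))"
    proof (rule integral_dominated_convergence[where w = maj])
      show "(\<lambda>v. complex_of_real (exp (- (v \<bullet> (A \<theta>0 *v v)) / 2))) \<in> borel_measurable lborel"
        by (rule measurable_compose[OF borel_measurable_integrable[OF gauss(1)] borel_measurable_of_real])
      show "(\<lambda>v. \<zeta> (\<theta>0 + u /\<^sub>R sqrt (real (n + N1))) (v /\<^sub>R sqrt (real (n + N1))) ^ (n + N1)) \<in> borel_measurable lborel" for n
        using \<zeta>_meas[of "\<theta>0 + u /\<^sub>R sqrt (real (n + N1))" "n + N1"] N1[of "n + N1"] by simp
      show "AE v in lborel. (\<lambda>n. \<zeta> (\<theta>0 + u /\<^sub>R sqrt (real (n + N1))) (v /\<^sub>R sqrt (real (n + N1))) ^ (n + N1))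
         \<longlonglongrightarrow> complex_of_real (exp (- (v \<bullet> (A \<theta>0 *v v)) / 2))"
        using LIMSEQ_ignore_initial_segment[OF centred_char_power_limit[OF s0_\<theta>0 xev xlim], of N1]
        by (simp add: \<zeta>_def A_def \<sigma>0)
      show "AE v in lborel. norm (\<zeta> (\<theta>0 + u /\<^sub>R sqrt (real (n + N1))) (v /\<^sub>R sqrt (real (n + N1))) ^ (n + N1)) \<le> maj v" for n
        using N1[of "n + N1"] by (intro AE_I2 \<zeta>_maj) auto
    qed (rule maj_int)
    then have "(\<lambda>n. CLINT v|lborel. \<zeta> (\<theta>0 + u /\<^sub>R sqrt (real n)) (v /\<^sub>R sqrt (real n)) ^ n)
       \<longlonglongrightarrow> complex_of_real gl"
      unfolding gl_def integral_complex_of_real by (rule LIMSEQ_offset)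
    from tendsto_Re[OF this] show ?thesis unfolding J_eq by simp
  qed

  have meas_on_U: "(\<lambda>\<theta>. L \<theta> * indicator U \<theta>) \<in> borel_measurable borel"
    if "continuous_on U M" and eq: "\<And>\<theta>. \<theta> \<in> U \<Longrightarrow> L \<theta> = M \<theta>" for L M :: "real^'p \<Rightarrow> real"
  proof -
    have "(\<lambda>\<theta>. indicator U \<theta> *\<^sub>R M \<theta>) \<in> borel_measurable borel"
      using that(1) U(1) by (intro borel_measurable_continuous_on_indicator) auto
    moreover have "(\<lambda>\<theta>. indicator U \<theta> *\<^sub>R M \<theta>) = (\<lambda>\<theta>. L \<theta> * indicator U \<theta>)"
      using eq by (auto simp: indicator_def)
    ultimately show ?thesis by (simp only:)
  qed
  have h_on_U: "continuous_on U h" using conth UV by (intro continuous_at_imp_continuous_on) auto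
  let ?L = "\<lambda>n. likelihood P Ys n (real n *\<^sub>R y0)" and ?S = "\<lambda>n. saddlepoint_likelihood R P Y n (real n *\<^sub>R y0)"
  define cL where "cL n = exp (real n * h \<theta>0) * ((1 / sqrt (real n)) ^ CARD('d) / (2 * pi) ^ CARD('d))" for n
  define cS where "cS n = exp (real n * h \<theta>0) / sqrt ((2 * pi * real n) ^ CARD('d))" for n
  have split: "exp (real n * h \<theta>) = exp (real n * h \<theta>0) * exp (real n * (h \<theta> - h \<theta>0))" for n \<theta>
    by (simp add: exp_add[symmetric] algebra_simps)
  have L_eq: "?L n \<theta> = cL n * exp (real n * (h \<theta> - h \<theta>0)) * J n \<theta>" if n: "N \<le> n" and \<theta>: "\<theta> \<in> U" for n \<theta>
  proof -
    have "?L n \<theta> = exp (real n * h \<theta>) * ((1 / sqrt (real n)) ^ CARD('d) / (2 * pi) ^ CARD('d)) * J n \<theta>"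
      unfolding h_def J_def
      by (rule likelihood_at_multiple(1)[OF xd[OF UV[OF \<theta>]] _ \<psi>_int[OF n \<theta>, unfolded \<psi>_def]]) (use n N0 in simp)
    then show ?thesis unfolding split[of n \<theta>] cL_def by (simp add: mult_ac)
  qed
  have S_eq: "?S n \<theta> = cS n * exp (real n * (h \<theta> - h \<theta>0)) * (1 / sqrt (det (A \<theta>)))" if n: "N \<le> n" and \<theta>: "\<theta> \<in> U" for n \<theta>
  proof -
    have n0: "0 < real n" using n N0 by simp
    have "(real n *\<^sub>R y0) /\<^sub>R real n = y0" using n0 by simp
    then have "?S n \<theta> = exp (real n * h \<theta>) / sqrt (det ((2 * pi * real n) *\<^sub>R A \<theta>))"
      unfolding saddlepoint_likelihood_def Let_def h_def A_def \<sigma>_def by simp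
    also have "\<dots> = exp (real n * h \<theta>) / sqrt ((2 * pi * real n) ^ CARD('d)) * (1 / sqrt (det (A \<theta>)))"
      by (simp add: det_scaleR real_sqrt_mult)
    finally show ?thesis unfolding split[of n \<theta>] cS_def by simp
  qed
  have cL: "0 < cL n" and cS: "0 < cS n" if "N \<le> n" for n
    using that N0 by (simp_all add: cL_def cS_def)
  have \<alpha>4: "0 < \<alpha> / 4" using \<alpha> by simp
  have Lm: "(\<lambda>\<theta>. ?L n \<theta> * indicator U \<theta>) \<in> borel_measurable borel" if n: "N \<le> n" for n
  proof (rule meas_on_U)
    show "continuous_on U (\<lambda>\<theta>. cL n * exp (real n * (h \<theta> - h \<theta>0)) * J n \<theta>)"
      by (intro continuous_intros h_on_U J_cont[OF n])
  qed (rule L_eq[OF n])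
  have Sm: "(\<lambda>\<theta>. ?S n \<theta> * indicator U \<theta>) \<in> borel_measurable borel" if n: "N \<le> n" for n
  proof (rule meas_on_U)
    have "continuous_on U (\<lambda>\<theta>. det (A \<theta>))" using contdet UV by (intro continuous_at_imp_continuous_on) auto
    then show "continuous_on U (\<lambda>\<theta>. cS n * exp (real n * (h \<theta> - h \<theta>0)) * (1 / sqrt (det (A \<theta>))))"
      using detA UV by (intro continuous_intros h_on_U) force+
  qed (rule S_eq[OF n])
  have S_bound: "0 \<le> 1 / sqrt (det (A \<theta>)) \<and> 1 / sqrt (det (A \<theta>)) \<le> 1 / sqrt D0" if "\<theta> \<in> U" for \<theta>
    using UD[OF that] D0(1) by (auto intro!: divide_left_mono)
  have S_lim: "(\<lambda>n. 1 / sqrt (det (A (\<theta>0 + u /\<^sub>R sqrt (real n))))) \<longlonglongrightarrow> 1 / sqrt (det (A \<theta>0))" for u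
    using detA[OF \<theta>0V] by (intro tendsto_intros isCont_tendsto_compose[OF contdet[OF \<theta>0V] tend]) auto
  have S_pos: "0 < 1 / sqrt (det (A \<theta>0))" using detA[OF \<theta>0V] by simp
  have post_L: "\<forall>\<^sub>F n in sequentially. prob_space (posterior prior U (?L n))"
      "weakly_converges (\<lambda>n. distr (posterior prior U (?L n)) borel (\<lambda>\<theta>. sqrt (real n) *\<^sub>R (\<theta> - \<theta>0)))
         (multivariate_normal 0 (- matrix_inv H))"
    by (rule laplace_posterior[OF U H_sym H_neg L_eq cL N0 Lm \<alpha>4 Uh hlim J_bound J_lim gl
          prior_density f_meas f_nonneg f_cont f_pos Uf]; assumption)+
  have post_S: "\<forall>\<^sub>F n in sequentially. prob_space (posterior prior U (?S n))"
      "weakly_converges (\<lambda>n. distr (posterior prior U (?S n)) borel (\<lambda>\<theta>. sqrt (real n) *\<^sub>R (\<theta> - \<theta>0)))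
         (multivariate_normal 0 (- matrix_inv H))"
    by (rule laplace_posterior[OF U H_sym H_neg S_eq cS N0 Sm \<alpha>4 Uh hlim S_bound S_lim S_pos
          prior_density f_meas f_nonneg f_cont f_pos Uf]; assumption)+
  have dens: "\<exists>g. continuous_density (P \<theta>) (sum_copies Ys n \<theta>) g" if n: "N \<le> n" and \<theta>: "\<theta> \<in> U" for n \<theta>
    using sum_copies_density(1)[OF xd[OF UV[OF \<theta>]] \<psi>_int[OF n \<theta>, unfolded \<psi>_def]] by blast
  have "\<forall>\<^sub>F n in sequentially. (\<forall>\<theta>\<in>U. \<exists>g. continuous_density (P \<theta>) (sum_copies Ys n \<theta>) g) \<and>
       prob_space (posterior prior U (?L n)) \<and> prob_space (posterior prior U (?S n))"
    using post_L(1) post_S(1) eventually_ge_at_top[of N] by eventually_elim (use dens in blast)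
  then show ?thesis
    using U UR V_sad[OF UV] post_L(2) post_S(2) by (intro exI[of _ U] conjI) auto
qed

end

theorem theorem3:
  fixes R :: "(real^'p::finite) set"
    and P :: "real^'p \<Rightarrow> 'w measure"
    and Y :: "real^'p \<Rightarrow> 'w \<Rightarrow> real^'d::finite"
    and Ys :: "real^'p \<Rightarrow> nat \<Rightarrow> 'w \<Rightarrow> real^'d"
    and s0 y0 :: "real^'d" and \<theta>0 :: "real^'p"
    and H :: "real^'p^'p"
    and prior :: "(real^'p) measure" and f :: "real^'p \<Rightarrow> real"
  assumes model: "iid_copies_model R P Y Ys"
    and decay: "decay_condition R P Y"
    and growth: "growth_condition R P Y"
    and s0_\<theta>0: "(s0, \<theta>0) \<in> interior (S_set R P Y)"
    and y0: "y0 = grad_s_K0 P Y s0 \<theta>0"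
    and grad_zero: "grad_th_K0 P Y s0 \<theta>0 = 0"
    and H: "H = H_matrix P Y s0 \<theta>0"
    and H_neg: "negative_definite H"
    and prior_prob: "prob_space prior"
    and prior_on_R: "AE \<theta> in prior. \<theta> \<in> R"
    and prior_density: "prior = density lborel (\<lambda>\<theta>. ennreal (f \<theta>))"
    and f_meas: "f \<in> borel_measurable borel"
    and f_nonneg: "\<And>\<theta>. 0 \<le> f \<theta>"
    and f_cont: "isCont f \<theta>0"
    and f_pos: "0 < f \<theta>0"
  shows "\<exists>U. open U \<and> \<theta>0 \<in> U \<and> U \<subseteq> R \<and>
    (\<forall>\<theta>\<in>U. (y0, \<theta>) \<in> saddle_domain R P Y) \<and>
    (\<forall>\<^sub>F n in sequentially.
       (\<forall>\<theta>\<in>U. \<exists>g. continuous_density (P \<theta>) (sum_copies Ys n \<theta>) g) \<and>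
       prob_space (posterior prior U (likelihood P Ys n (real n *\<^sub>R y0))) \<and>
       prob_space (posterior prior U (saddlepoint_likelihood R P Y n (real n *\<^sub>R y0)))) \<and>
    weakly_converges
      (\<lambda>n. distr (posterior prior U (likelihood P Ys n (real n *\<^sub>R y0))) borel
             (\<lambda>\<theta>. sqrt (real n) *\<^sub>R (\<theta> - \<theta>0)))
      (multivariate_normal 0 (- matrix_inv H)) \<and>
    weakly_converges
      (\<lambda>n. distr (posterior prior U (saddlepoint_likelihood R P Y n (real n *\<^sub>R y0))) borel
             (\<lambda>\<theta>. sqrt (real n) *\<^sub>R (\<theta> - \<theta>0)))
      (multivariate_normal 0 (- matrix_inv H))"
proof -
  interpret saddlepoint_model R P Y Ys using model decay growth by unfold_locales
  show ?thesis
    by (rule posterior_normality[OF s0_\<theta>0 y0 grad_zero H H_neg prior_density f_meas f_nonneg f_cont f_pos])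
qed

end
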